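(* Let $G=(V,E)$ be a bipartite quadrangulation of a connected orientable compact surface $\mathcal{S}$ without boundary, with set of faces $F$. Let $W=(w^f_i)_{f\in F,\,1\le i\le 5}$ be positive weights for the $C^{(1)}_2$ loop model on $G$ such that at every face $f\in F$ the free-fermionic relations $$w^f_1 w^f_4 = w^f_3 w^f_5,\qquad w^f_2 w^f_3 = w^f_4 w^f_5,\qquad w^f_5(w^f_1+w^f_2)=w^f_3w^f_4$$ hold. For every $f\in F$ let $\lambda_f,a_f,b_f\in(0,\infty)$ be the unique parameters with $a_f^2+b_f^2=1$ and $$w^f_1=\lambda_f a_f^2,\quad w^f_2=\lambda_f b_f^2,\quad w^f_3=\lambda_f a_f,\quad w^f_4=\lambda_f b_f,\quad w^f_5=\lambda_f a_f b_f .$$ Consider the dimer model on the decorated graph $G^Q$ with edge weights $\mu=(\mu_e)_{e\in E^Q}$ defined as follows: every road has weight $1$; in the city of the face $f$, the two city edges at the white corners $u^f$ and $v^f$ have weight $a_f$, and the two city edges at the black corners $x^f$ and $y^f$ have weight $b_f$. Then $$\mathcal{Z}^G_{\mathrm{loop}}(W)=\Big(\prod_{f\in F}\lambda_f\Big)\,\big(\mathcal{Z}^G_{\mathrm{dim}}(\mu)\big)^2 .$$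
   Context: A quadrangulation of $\mathcal S$ is a finite connected simple graph $G=(V,E)$ embedded in $\mathcal S$ so that edges do not intersect and the faces (connected components of the complement of the embedding) are homeomorphic to disks and have degree $4$; $F$ is the set of faces. $G$ is bipartite with a fixed black/white colouring of $V$. For each face $f$, the boundary vertices are named in clockwise order $x^f,u^f,y^f,v^f$, with $x^f,y^f$ black and $u^f,v^f$ white (superscripts are dropped when unambiguous). Local configurations. Inside a face $f$, the midpoints of its four sides are joined in pairs by two strands, each coloured red or blue. A strand "turns around" a corner $p$ of $f$ if it joins the midpoints of the two sides of $f$ incident to $p$. There are ten local configurations $1_a,1_b,\dots,5_a,5_b$: - $1_a,1_b$: the two strands turn around $u$ and $v$ respectively and have the same colour (both red or both blue); - $2_a,2_b$: the two strands turn around $x$ and $y$ respectively and have the same colour; - $3_a,3_b$: the two strands turn around $u$ and $v$ respectively and have different colours (two choices); - $4_a,4_b$: the two strands turn around $x$ and $y$ respectively and have different colours (two choices); - $5_a,5_b$: the two strands join opposite sides, hence cross, and have different colours (two choices). A $C^{(1)}_2$ loop configuration $\sigma$ on $G$ is the choice, for every face $f$, of one local configuration $i_k$ ($i\in\{1,\dots,5\}$, $k\in\{a,b\}$) such that the colours agree on the two sides of each edge of $G$; one writes $(f,i_k)\in\sigma$. The strands then glue into red and blue closed loops, and $N_\sigma$ is the total number of loops. The weight of $\sigma$ is $w^G_{\mathrm{loop}}(\sigma)=2^{N_\sigma}\prod_{(f,i_k)\in\sigma}w^f_i$ and the partition function is $\mathcal Z^G_{\mathrm{loop}}(W)=\sum_\sigma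 w^G_{\mathrm{loop}}(\sigma)$. Decorated graph. $G^Q$ is obtained from the dual graph $G^*$ by expanding every (degree $4$) dual vertex into a quadrangle: for each face $f$ of $G$ there is a "city", a $4$-cycle whose four vertices correspond to the four sides of $f$ in cyclic order; the city edge joining the vertices of two consecutive sides is said to be at the corner of $f$ common to these two sides. For each edge $e$ of $G$ there is a "road" joining the two city vertices corresponding to the two sides of $e$. $E^Q$ is the set of edges of $G^Q$ (city edges and roads). A dimer configuration is a subset $m\subset E^Q$ such that every vertex of $G^Q$ belongs to exactly one edge of $m$, and $\mathcal Z^G_{\mathrm{dim}}(\mu)=\sum_m\prod_{e\in m}\mu_e$, the sum being over all dimer configurations. *)

theory Defs
  imports "HOL-Complex_Analysis.Complex_Analysis" "HOL-Library.FuncSet"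
begin

section \<open>Oriented compact surfaces\<close>

text \<open>A homeomorphism between open subsets of the plane is orientation preserving if it maps small
  counterclockwise circles to loops that wind once counterclockwise around the image of the centre.\<close>

definition orientation_preserving_on :: "complex set \<Rightarrow> (complex \<Rightarrow> complex) \<Rightarrow> bool" where
  "orientation_preserving_on U g \<longleftrightarrow>
     continuous_on U g \<and> inj_on g U \<and>
     (\<forall>z r. 0 < r \<and> cball z r \<subseteq> U \<longrightarrow> winding_number (g \<circ> circlepath z r) (g z) = 1)"

text \<open>The Hausdorff property comes from the ambient type. Charts take values in open subsets of the
  whole plane, so there is no boundary. A surface is orientable iff it has such an atlas \<open>A\<close>, and
  \<open>A\<close> fixes an orientation, which is needed to speak of the clockwise order.\<close>

definition oriented_closed_surface ::
    "'s::t2_space set \<Rightarrow> ('s set \<times> ('s \<Rightarrow> complex)) set \<Rightarrow> bool" where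
  "oriented_closed_surface S A \<longleftrightarrow>
     compact S \<and> connected S \<and> S \<noteq> {} \<and>
     (\<Union>(U, h)\<in>A. U) = S \<and>
     (\<forall>(U, h)\<in>A. openin (top_of_set S) U \<and> open (h ` U) \<and> (\<exists>k. homeomorphism U (h ` U) h k)) \<and>
     (\<forall>(U, h)\<in>A. \<forall>(U', h')\<in>A.
        orientation_preserving_on (h ` (U \<inter> U')) (h' \<circ> the_inv_into U h))"


section \<open>Quadrangulations\<close>

text \<open>Vertices are points of the surface and an edge of the simple graph is the set of its two
  endpoints; \<open>curve G e\<close> is the closed arc that represents the edge \<open>e\<close> on the surface.
  The function \<open>param G f\<close> maps the closed unit disk onto the closed face \<open>f\<close> and
  thereby names the corners and sides of \<open>f\<close>.\<close>

record 's surface_graph =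
  surface :: "'s set"
  atlas :: "('s set \<times> ('s \<Rightarrow> complex)) set"
  verts :: "'s set"
  edges :: "'s set set"
  curve :: "'s set \<Rightarrow> 's set"
  black :: "'s set"
  param :: "'s set \<Rightarrow> complex \<Rightarrow> 's"

definition embedded_simple_graph :: "('s::t2_space) surface_graph \<Rightarrow> bool" where
  "embedded_simple_graph G \<longleftrightarrow>
     finite (verts G) \<and> verts G \<subseteq> surface G \<and>
     (\<forall>e\<in>edges G. e \<subseteq> verts G \<and> card e = 2) \<and>
     (\<forall>e\<in>edges G. curve G e \<subseteq> surface G \<and> curve G e \<inter> verts G = e \<and>
        (\<exists>g. arc g \<and> path_image g = curve G e \<and> {pathstart g, pathfinish g} = e)) \<and>
     (\<forall>e\<in>edges G. \<forall>e'\<in>edges G. e \<noteq> e' \<longrightarrow> curve G e \<inter> curve G e' = e \<inter> e')"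

definition connected_graph :: "'s surface_graph \<Rightarrow> bool" where
  "connected_graph G \<longleftrightarrow>
     (\<forall>p\<in>verts G. \<forall>q\<in>verts G. (p, q) \<in> {(p', q'). {p', q'} \<in> edges G}\<^sup>*)"

definition properly_coloured :: "'s surface_graph \<Rightarrow> bool" where
  "properly_coloured G \<longleftrightarrow> black G \<subseteq> verts G \<and> (\<forall>e\<in>edges G. card (e \<inter> black G) = 1)"

definition faces :: "('s::t2_space) surface_graph \<Rightarrow> 's set set" where
  "faces G = components (surface G - (verts G \<union> (\<Union>e\<in>edges G. curve G e)))"

text \<open>The unit circle is cut at \<open>1, -\<i>, -1, \<i>\<close> into four open arcs, numbered clockwise:
  the arc \<open>k\<close> runs from the corner \<open>k\<close> to the corner \<open>k + 1\<close> (modulo 4).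
  The corners \<open>0, 1, 2, 3\<close> of a face \<open>f\<close> are \<open>x\<^sup>f, u\<^sup>f, y\<^sup>f, v\<^sup>f\<close>, so the even
  ones are black and the odd ones are white.\<close>

definition disk_corner :: "nat \<Rightarrow> complex" where
  "disk_corner k = cis (- (pi / 2) * real k)"

definition disk_side :: "nat \<Rightarrow> complex set" where
  "disk_side k = {cis (- (pi / 2) * t) | t::real. real k < t \<and> t < real k + 1}"

text \<open>The face \<open>f\<close> is an open disk of degree 4 whose boundary walk is
  \<open>x\<^sup>f, u\<^sup>f, y\<^sup>f, v\<^sup>f\<close> in clockwise order. The walk may visit a vertex or an edge more than
  once, so \<open>\<phi>\<close> need not be injective on the circle.\<close>

definition quadrilateral_face ::
    "('s::t2_space) surface_graph \<Rightarrow> 's set \<Rightarrow> (complex \<Rightarrow> 's) \<Rightarrow> bool" where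
  "quadrilateral_face G f \<phi> \<longleftrightarrow>
     continuous_on (cball 0 1) \<phi> \<and>
     (\<exists>\<psi>. homeomorphism (ball 0 1) f \<phi> \<psi>) \<and>
     (\<forall>(U, h)\<in>atlas G. orientation_preserving_on {z \<in> ball 0 1. \<phi> z \<in> U} (h \<circ> \<phi>)) \<and>
     (\<forall>k<4. \<exists>e\<in>edges G. \<exists>\<psi>. homeomorphism (disk_side k) (curve G e - e) \<phi> \<psi>) \<and>
     {\<phi> (disk_corner 0), \<phi> (disk_corner 2)} \<subseteq> black G \<and>
     {\<phi> (disk_corner 1), \<phi> (disk_corner 3)} \<subseteq> verts G - black G"

definition bipartite_quadrangulation :: "('s::t2_space) surface_graph \<Rightarrow> bool" where
  "bipartite_quadrangulation G \<longleftrightarrow>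
     oriented_closed_surface (surface G) (atlas G) \<and>
     embedded_simple_graph G \<and> connected_graph G \<and> properly_coloured G \<and>
     (\<forall>f\<in>faces G. quadrilateral_face G f (param G f))"

text \<open>The side \<open>(f, k)\<close> of the face \<open>f\<close> joins its corners \<open>k\<close> and \<open>k + 1\<close> (modulo 4).\<close>

definition sides :: "('s::t2_space) surface_graph \<Rightarrow> ('s set \<times> nat) set" where
  "sides G = faces G \<times> {..<4}"

definition side_edge :: "('s::t2_space) surface_graph \<Rightarrow> 's set \<times> nat \<Rightarrow> 's set" where
  "side_edge G s = (THE e. e \<in> edges G \<and> param G (fst s) ` disk_side (snd s) = curve G e - e)"


section \<open>The loop model\<close>

datatype colour = Red | Blue

datatype variant = Va | Vb

type_synonym local_config = "nat \<times> variant"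

definition local_configs :: "local_config set" where
  "local_configs = {1..5} \<times> UNIV"

text \<open>A strand is given by the two sides that it joins. The strands turning around
  \<open>x, u, y, v\<close> are \<open>{3, 0}\<close>, \<open>{0, 1}\<close>, \<open>{1, 2}\<close>, \<open>{2, 3}\<close>.\<close>

definition first_strand :: "nat \<Rightarrow> nat set" where
  "first_strand i = (if i \<in> {1, 3} then {0, 1} else if i \<in> {2, 4} then {3, 0} else {0, 2})"

definition strands :: "nat \<Rightarrow> nat set set" where
  "strands i = {first_strand i, {..<4} - first_strand i}"

fun strand_colour :: "local_config \<Rightarrow> nat set \<Rightarrow> colour" where
  "strand_colour (i, c) t =
     (if i \<in> {1, 2} \<or> t = first_strand i
      then (case c of Va \<Rightarrow> Red | Vb \<Rightarrow> Blue)
      else (case c of Va \<Rightarrow> Blue | Vb \<Rightarrow> Red))"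

definition side_colour :: "local_config \<Rightarrow> nat \<Rightarrow> colour" where
  "side_colour c k = strand_colour c (THE t. t \<in> strands (fst c) \<and> k \<in> t)"

definition loop_configs :: "('s::t2_space) surface_graph \<Rightarrow> ('s set \<Rightarrow> local_config) set" where
  "loop_configs G = {\<sigma> \<in> faces G \<rightarrow>\<^sub>E local_configs.
     \<forall>(f, k)\<in>sides G. \<forall>(f', k')\<in>sides G.
       side_edge G (f, k) = side_edge G (f', k') \<longrightarrow>
       side_colour (\<sigma> f) k = side_colour (\<sigma> f') k'}"

text \<open>A loop is recorded as the set of the ends of its strands, where an end is a side of a face:
  two ends are linked if they belong to the same strand or are glued along an edge.\<close>

definition linked ::
    "('s::t2_space) surface_graph \<Rightarrow> ('s set \<Rightarrow> local_config) \<Rightarrow> (('s set \<times> nat) \<times> ('s set \<times> nat)) set"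
  where
  "linked G \<sigma> =
     {((f, k), (f, l)) | f k l t. f \<in> faces G \<and> t \<in> strands (fst (\<sigma> f)) \<and> k \<in> t \<and> l \<in> t} \<union>
     {(s, s'). s \<in> sides G \<and> s' \<in> sides G \<and> side_edge G s = side_edge G s'}"

definition loops ::
    "('s::t2_space) surface_graph \<Rightarrow> ('s set \<Rightarrow> local_config) \<Rightarrow> ('s set \<times> nat) set set" where
  "loops G \<sigma> = sides G // (linked G \<sigma>)\<^sup>*"

definition loop_weight ::
    "('s::t2_space) surface_graph \<Rightarrow> ('s set \<Rightarrow> nat \<Rightarrow> real) \<Rightarrow> ('s set \<Rightarrow> local_config) \<Rightarrow> real" where
  "loop_weight G w \<sigma> = 2 ^ card (loops G \<sigma>) * (\<Prod>f\<in>faces G. w f (fst (\<sigma> f)))"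

definition Z_loop :: "('s::t2_space) surface_graph \<Rightarrow> ('s set \<Rightarrow> nat \<Rightarrow> real) \<Rightarrow> real" where
  "Z_loop G w = (\<Sum>\<sigma>\<in>loop_configs G. loop_weight G w \<sigma>)"

definition free_fermionic :: "(nat \<Rightarrow> real) \<Rightarrow> bool" where
  "free_fermionic w \<longleftrightarrow>
     w 1 * w 4 = w 3 * w 5 \<and> w 2 * w 3 = w 4 * w 5 \<and> w 5 * (w 1 + w 2) = w 3 * w 4"

definition ff_parameters :: "(nat \<Rightarrow> real) \<Rightarrow> real \<times> real \<times> real \<Rightarrow> bool" where
  "ff_parameters w = (\<lambda>(l, a, b).
     0 < l \<and> 0 < a \<and> 0 < b \<and> a\<^sup>2 + b\<^sup>2 = 1 \<and>
     w 1 = l * a\<^sup>2 \<and> w 2 = l * b\<^sup>2 \<and> w 3 = l * a \<and> w 4 = l * b \<and> w 5 = l * a * b)"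


section \<open>The dimer model on the decorated graph\<close>

text \<open>The vertices of the decorated graph are the sides \<open>(f, k)\<close>. Edges are labelled, because a
  city edge and a road can have the same two ends (if a vertex has degree 1). The city edge
  \<open>City f k\<close> is the one at the corner \<open>k\<close>, common to the sides \<open>k - 1\<close> and \<open>k\<close> modulo 4.\<close>

datatype 's dec_edge = City "'s set" nat | Road "'s set"

fun dec_ends :: "('s::t2_space) surface_graph \<Rightarrow> 's dec_edge \<Rightarrow> ('s set \<times> nat) set" where
  "dec_ends G (City f k) = {(f, (k + 3) mod 4), (f, k)}"
| "dec_ends G (Road e) = {s \<in> sides G. side_edge G s = e}"

definition dec_edges :: "('s::t2_space) surface_graph \<Rightarrow> 's dec_edge set" where
  "dec_edges G = {City f k | f k. f \<in> faces G \<and> k < 4} \<union> {Road e | e. e \<in> edges G}"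

definition dimer_configs :: "('s::t2_space) surface_graph \<Rightarrow> 's dec_edge set set" where
  "dimer_configs G = {m. m \<subseteq> dec_edges G \<and> (\<forall>s\<in>sides G. \<exists>!q. q \<in> m \<and> s \<in> dec_ends G q)}"

definition Z_dim :: "('s::t2_space) surface_graph \<Rightarrow> ('s dec_edge \<Rightarrow> real) \<Rightarrow> real" where
  "Z_dim G \<mu> = (\<Sum>m\<in>dimer_configs G. \<Prod>q\<in>m. \<mu> q)"

fun dec_weight :: "('s set \<Rightarrow> real) \<Rightarrow> ('s set \<Rightarrow> real) \<Rightarrow> 's dec_edge \<Rightarrow> real" where
  "dec_weight a b (Road e) = 1"
| "dec_weight a b (City f k) = (if odd k then a f else b f)"

end

theory Submission
  imports Defs
begin

text \<open>The square of \<open>Z_dim\<close> sums over pairs of dimer configurations. A dimer configuration is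
  determined by the set \<open>R\<close> of the roads that it uses, seen as a set of edges of \<open>G\<close>, and by
  independent matchings of what is left of the cities. In a city, summing over these matchings gives
  \<open>1\<close> if all four sides or no side carry a road (in the second case the sum is
  \<open>a\<^sup>2 + b\<^sup>2 = 1\<close>), \<open>a\<close> or \<open>b\<close> if the two roads leave a white or a black corner to be
  matched, and \<open>0\<close> otherwise (\<open>city_weight_eq\<close>). So \<open>Z_dim\<close> is a sum over sets of edges of a
  product over faces (\<open>Z_dim_as_vertex_model\<close>).

  On the loop side, the factor \<open>2\<close> of a loop counts its two orientations. An oriented coloured
  strand that crosses an edge \<open>e\<close> has a colour and a direction, and the direction is recorded by
  one bit, telling on which side of the strand the black end of \<open>e\<close> lies. A strand that turns
  around a corner keeps this bit, because that corner stays on the same side. A strand that joins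
  opposite sides of a face flips it, because the colours of the corners alternate around the face.
  Hence \<open>Z_loop\<close> is a sum over pairs \<open>(C, P)\<close> of sets of edges, the red edges and the edges with
  bit \<open>1\<close>, again of a product over faces (\<open>Z_loop_as_vertex_model\<close>).

  Now the two sums agree term by term: take the pair of road sets \<open>R = P\<close> and \<open>R'\<close>, the symmetric
  difference of \<open>P\<close> and \<open>C\<close>. At each face the weight of \<open>(C, P)\<close> is \<open>\<lambda>\<close> times the product of the
  city weights of \<open>R\<close> and \<open>R'\<close> (\<open>local_factorisation\<close>). This is where the free-fermionic relations
  enter, through the parametrisation by \<open>\<lambda>, a, b\<close>.

  Recording orientations by bits on edges uses the surface. It needs every edge to have exactly two
  sides, and it needs the bit seen from the two sides to be the same. The sides of a face are numbered
  clockwise from a black corner, so side \<open>k\<close> runs from black to white, clockwise, iff \<open>k\<close> is even.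
  Two faces that meet along an edge run through it in opposite directions, because the surface is
  oriented, so the two sides of an edge have numbers of opposite parity (\<open>opposite_parity\<close>). With
  this, orientations of the loops correspond to the admissible sets \<open>P\<close> (\<open>card_directions\<close>).

  The faces are given by mere homeomorphisms of the disk, and edges by mere arcs, so the local picture
  along an edge is obtained from invariance of domain. Close to an edge, the parametrisation of a
  face is a map of a half plane. Gluing the half planes of two sides gives an injective continuous
  map of an open set, which is open. So there is no room for a third side; and interior
  points of an edge with no side, or only one, would have a neighbourhood inside an arc, or inside the
  image of a half plane (\<open>at_most_two_sides\<close>,
  \<open>ex_side\<close>, \<open>ex_second_side\<close>). If the two sides had the same parity, the glued map would preserve
  the orientation on one half and reverse it on the other, although winding numbers of images of
  small circles are locally constant.\<close>

section \<open>Two perfect matchings and their cycles\<close>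

text \<open>A perfect matching of a set is encoded by the involution without fixed points that exchanges
  matched elements.\<close>

definition perfect_matching :: "'a set \<Rightarrow> ('a \<Rightarrow> 'a) \<Rightarrow> bool" where
  "perfect_matching X f \<longleftrightarrow> (\<forall>x\<in>X. f x \<in> X \<and> f (f x) = x \<and> f x \<noteq> x)"

definition alternating :: "'a set \<Rightarrow> ('a \<Rightarrow> 'a) \<Rightarrow> 'a set \<Rightarrow> bool" where
  "alternating X f D \<longleftrightarrow> D \<subseteq> X \<and> (\<forall>x\<in>X. f x \<in> D \<longleftrightarrow> x \<notin> D)"

definition matching_steps :: "'a set \<Rightarrow> ('a \<Rightarrow> 'a) \<Rightarrow> ('a \<Rightarrow> 'a) \<Rightarrow> ('a \<times> 'a) set" where
  "matching_steps X f g = {(x, y). x \<in> X \<and> (y = f x \<or> y = g x)}"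

definition rotation :: "('a \<Rightarrow> 'a) \<Rightarrow> ('a \<Rightarrow> 'a) \<Rightarrow> 'a \<Rightarrow> 'a" where
  "rotation f g x = f (g x)"

lemma rotation_power_in:
  assumes "perfect_matching X f" "perfect_matching X g" "x \<in> X"
  shows "(rotation f g ^^ n) x \<in> X"
  using assms by (induction n) (auto simp: perfect_matching_def rotation_def)

lemma rotation_power_inj:
  assumes "perfect_matching X f" "perfect_matching X g" "x \<in> X" "y \<in> X"
    and "(rotation f g ^^ n) x = (rotation f g ^^ n) y"
  shows "x = y"
  using assms(5)
proof (induction n)
  case (Suc n)
  let ?x = "(rotation f g ^^ n) x" and ?y = "(rotation f g ^^ n) y"
  have "?x \<in> X" "?y \<in> X" using rotation_power_in assms by metis+
  moreover have "f (g ?x) = f (g ?y)" using Suc.prems by (metis comp_apply funpow.simps(2) rotation_def)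
  ultimately have "?x = ?y" using assms(1,2) unfolding perfect_matching_def by metis
  then show ?case using Suc.IH by blast
qed simp

text \<open>The composite of the two matchings moves along an alternating cycle by two steps. If it took
  \<open>x\<close> to its partner \<open>g x\<close>, the alternating path from \<open>x\<close> to \<open>g x\<close> would be symmetric about its
  middle, and the middle would be an element matched with itself. Removing one step at each end
  reduces \<open>n\<close> by two.\<close>

lemma matching_neq_rotation_power:
  assumes f: "perfect_matching X f" and g: "perfect_matching X g" and "x \<in> X"
  shows "g x \<noteq> (rotation f g ^^ n) x"
  using \<open>x \<in> X\<close>
proof (induction n arbitrary: x rule: less_induct)
  case (less n)
  consider "n = 0" | "n = 1" | m where "n = Suc (Suc m)"
    by (metis One_nat_def not0_implies_Suc)
  then show ?case
  proof cases
    case 1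
    then show ?thesis using g less.prems by (auto simp: perfect_matching_def)
  next
    case 2
    then show ?thesis using f g less.prems by (auto simp: perfect_matching_def rotation_def) metis
  next
    case (3 m)
    let ?y = "(rotation f g ^^ m) (f (g x))"
    have x': "f (g x) \<in> X" using f g less.prems by (auto simp: perfect_matching_def)
    have y: "?y \<in> X" using rotation_power_in[OF f g x'] .
    have *: "(rotation f g ^^ n) x = f (g ?y)"
      unfolding 3 by (metis comp_apply funpow.simps(2) funpow_swap1 rotation_def)
    show ?thesis
    proof
      assume "g x = (rotation f g ^^ n) x"
      then have "f (g x) = g ?y"
        using * f g y unfolding perfect_matching_def by metis
      then have "g (f (g x)) = ?y" using g y unfolding perfect_matching_def by metis
      then show False using less.IH[of m "f (g x)"] 3 x' by simp
    qed
  qed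
qed

text \<open>The orbits of the rotation, without using its inverse: one of two points is reached from the
  other.\<close>

definition rotation_related :: "('a \<Rightarrow> 'a) \<Rightarrow> 'a \<Rightarrow> 'a \<Rightarrow> bool" where
  "rotation_related p x y \<longleftrightarrow> (\<exists>n. y = (p ^^ n) x \<or> x = (p ^^ n) y)"

lemma matching_steps_sym:
  assumes "perfect_matching X f" "perfect_matching X g"
  shows "sym ((matching_steps X f g)\<^sup>*)"
  using assms by (intro sym_rtrancl) (auto simp: sym_def matching_steps_def perfect_matching_def)

lemma matching_steps_in:
  assumes "perfect_matching X f" "perfect_matching X g"
    and "(x, y) \<in> (matching_steps X f g)\<^sup>*" "x \<in> X"
  shows "y \<in> X"
  using assms(3,4) by (induction) (use assms(1,2) in \<open>auto simp: matching_steps_def perfect_matching_def\<close>)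

lemma rotation_related_forward:
  assumes "rotation_related p r z"
  shows "rotation_related p r (p z)"
proof -
  obtain n where "z = (p ^^ n) r \<or> r = (p ^^ n) z" using assms by (auto simp: rotation_related_def)
  then show ?thesis
  proof
    assume "z = (p ^^ n) r"
    then have "p z = (p ^^ Suc n) r" by simp
    then show ?thesis unfolding rotation_related_def by blast
  next
    assume r: "r = (p ^^ n) z"
    show ?thesis
    proof (cases n)
      case 0
      then have "p z = (p ^^ 1) r" using r by simp
      then show ?thesis unfolding rotation_related_def by blast
    next
      case (Suc m)
      then have "r = (p ^^ m) (p z)" using r by (simp add: funpow_swap1)
      then show ?thesis unfolding rotation_related_def by blast
    qed
  qed
qed

lemma rotation_related_backward:
  assumes "rotation_related p r (p z)" and inj: "\<And>x. x \<in> X \<Longrightarrow> p x = p z \<Longrightarrow> x = z"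
    and "\<And>n. (p ^^ n) r \<in> X"
  shows "rotation_related p r z"
proof -
  obtain n where "p z = (p ^^ n) r \<or> r = (p ^^ n) (p z)" using assms by (auto simp: rotation_related_def)
  then show ?thesis
  proof
    assume r: "p z = (p ^^ n) r"
    show ?thesis
    proof (cases n)
      case 0
      then have "r = (p ^^ 1) z" using r by simp
      then show ?thesis unfolding rotation_related_def by blast
    next
      case (Suc m)
      then have "z = (p ^^ m) r" using r inj[of "(p ^^ m) r"] assms(3) by simp
      then show ?thesis unfolding rotation_related_def by blast
    qed
  next
    assume "r = (p ^^ n) (p z)"
    then have "r = (p ^^ Suc n) z" by (simp add: funpow_swap1)
    then show ?thesis unfolding rotation_related_def by blast
  qed
qed

text \<open>A component of the union of two matchings is the disjoint union of a rotation orbit and its set of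
  \<open>g\<close>-partners: a step along \<open>g\<close> exchanges the two, and a step along \<open>f\<close> is a step along \<open>g\<close>
  combined with a rotation step or its inverse. Disjointness is the next lemma.\<close>

lemma rotation_related_cover:
  assumes f: "perfect_matching X f" and g: "perfect_matching X g"
    and "(r, x) \<in> (matching_steps X f g)\<^sup>*" and r: "r \<in> X"
  shows "rotation_related (rotation f g) r x \<or> rotation_related (rotation f g) r (g x)"
  using assms(3)
proof (induction)
  case base
  have "r = (rotation f g ^^ 0) r" by simp
  then show ?case unfolding rotation_related_def by blast
next
  case (step x y)
  have x: "x \<in> X" using matching_steps_in[OF f g step.hyps(1) r] .
  have "y = g x \<or> y = f x" using step.hyps(2) by (auto simp: matching_steps_def)
  then show ?case
  proof
    assume "y = g x"
    then show ?thesis using step.IH x g by (auto simp: perfect_matching_def)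
  next
    assume y: "y = f x"
    show ?thesis using step.IH
    proof
      assume "rotation_related (rotation f g) r (g x)"
      from rotation_related_forward[OF this] show ?thesis
        using y x g by (simp add: perfect_matching_def rotation_def[of f g "g x"])
    next
      assume *: "rotation_related (rotation f g) r x"
      let ?z = "g (f x)"
      have z: "?z \<in> X" "rotation f g ?z = x" using x f g by (auto simp: perfect_matching_def rotation_def)
      have "rotation_related (rotation f g) r ?z"
      proof (rule rotation_related_backward[where X = X])
        show "rotation_related (rotation f g) r (rotation f g ?z)" using * z by simp
        show "u = ?z" if "u \<in> X" "rotation f g u = rotation f g ?z" for u
          using rotation_power_inj[OF f g that(1) z(1), of 1] that by simp
        show "(rotation f g ^^ n) r \<in> X" for n using rotation_power_in[OF f g r] .
      qed
      then show ?thesis using y by simp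
    qed
  qed
qed

lemma rotation_related_exclusive:
  assumes f: "perfect_matching X f" and g: "perfect_matching X g" and r: "r \<in> X" and x: "x \<in> X"
    and 1: "rotation_related (rotation f g) r x" and 2: "rotation_related (rotation f g) r (g x)"
  shows False
proof -
  let ?p = "rotation f g"
  have gx: "g x \<in> X" "g (g x) = x" using g x by (auto simp: perfect_matching_def)
  note neq = matching_neq_rotation_power[OF f g x] matching_neq_rotation_power[OF f g gx(1), unfolded gx(2)]
  have inj: "u = (?p ^^ (n - m)) v" if "(?p ^^ m) u = (?p ^^ n) v" "m \<le> n" "u \<in> X" "v \<in> X" for u v m n
  proof (rule rotation_power_inj[OF f g that(3) rotation_power_in[OF f g that(4)]])
    show "(?p ^^ m) u = (?p ^^ m) ((?p ^^ (n - m)) v)"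
      using that(1,2) by (metis comp_apply funpow_add le_add_diff_inverse)
  qed
  obtain n m where n: "x = (?p ^^ n) r \<or> r = (?p ^^ n) x" and m: "g x = (?p ^^ m) r \<or> r = (?p ^^ m) (g x)"
    using 1 2 by (auto simp: rotation_related_def)
  consider "x = (?p ^^ n) r" "g x = (?p ^^ m) r" | "x = (?p ^^ n) r" "r = (?p ^^ m) (g x)"
    | "r = (?p ^^ n) x" "g x = (?p ^^ m) r" | "r = (?p ^^ n) x" "r = (?p ^^ m) (g x)"
    using n m by blast
  then show False
  proof cases
    case 1
    show False
    proof (cases "n \<le> m")
      case True
      then have "g x = (?p ^^ (m - n)) x" 
        using 1 by (metis comp_apply funpow_add le_add_diff_inverse2)
      then show False using neq by blast
    next
      case False
      then have "x = (?p ^^ (n - m)) (g x)" 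
        using 1 by (metis comp_apply funpow_add le_add_diff_inverse2 nat_le_linear)
      then show False using neq by blast
    qed
  next
    case 2
    then have "x = (?p ^^ (n + m)) (g x)" by (metis comp_apply funpow_add)
    then show False using neq by blast
  next
    case 3
    then have "g x = (?p ^^ (m + n)) x" by (metis comp_apply funpow_add)
    then show False using neq by blast
  next
    case 4
    then show False using inj[of n x m "g x"] inj[of m "g x" n x] x gx neq nat_le_linear by metis
  qed
qed

text \<open>Every component is an even cycle or an infinite path, so it can be coloured alternately: choose a
  base point in each component and take its rotation orbit.\<close>

lemma ex_alternating:
  assumes f: "perfect_matching X f" and g: "perfect_matching X g"
  shows "\<exists>D. alternating X f D \<and> alternating X g D"
proof -
  let ?R = "(matching_steps X f g)\<^sup>*"
  define rep where "rep x = (SOME y. (x, y) \<in> ?R)" for x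
  note sym = symD[OF matching_steps_sym[OF f g]]
  have rep: "(x, rep x) \<in> ?R" for x unfolding rep_def by (rule someI[of _ x]) simp
  have rep_eq: "rep x = rep y" if "(x, y) \<in> ?R" for x y
  proof -
    have "(x, z) \<in> ?R \<longleftrightarrow> (y, z) \<in> ?R" for z using that sym by (meson rtrancl_trans)
    then show ?thesis by (simp add: rep_def)
  qed
  define D where "D = {x \<in> X. rotation_related (rotation f g) (rep x) x}"
  have gD: "g x \<in> D \<longleftrightarrow> x \<notin> D" if x: "x \<in> X" for x
  proof -
    have "rep (g x) = rep x" using x by (intro rep_eq[symmetric] r_into_rtrancl) (auto simp: matching_steps_def)
    moreover have "g x \<in> X" using x g by (auto simp: perfect_matching_def)
    moreover have "rep x \<in> X" using matching_steps_in[OF f g rep x] .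
    ultimately show ?thesis unfolding D_def
      using rotation_related_exclusive[OF f g _ x] rotation_related_cover[OF f g sym[OF rep]] x by auto
  qed
  have pD: "f (g x) \<in> D \<longleftrightarrow> x \<in> D" if x: "x \<in> X" for x
  proof -
    have "(x, f (g x)) \<in> ?R" using x g
      by (intro rtrancl_into_rtrancl[OF r_into_rtrancl, of x "g x"]) (auto simp: matching_steps_def perfect_matching_def)
    then have eq: "rep (f (g x)) = rep x" using rep_eq by simp
    have X: "f (g x) \<in> X" using x f g by (auto simp: perfect_matching_def)
    have r: "rep x \<in> X" using matching_steps_in[OF f g rep x] .
    have "rotation_related (rotation f g) (rep x) x" if "rotation_related (rotation f g) (rep x) (rotation f g x)"
    proof (rule rotation_related_backward[where X = X, OF that])
      show "u = x" if "u \<in> X" "rotation f g u = rotation f g x" for u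
        using rotation_power_inj[OF f g that(1) x, of 1] that by simp
      show "(rotation f g ^^ n) (rep x) \<in> X" for n using rotation_power_in[OF f g r] .
    qed
    then show ?thesis unfolding D_def using eq X x rotation_related_forward[of "rotation f g" "rep x" x]
      by (auto simp: rotation_def[of f g x])
  qed
  have fD: "f x \<in> D \<longleftrightarrow> x \<notin> D" if x: "x \<in> X" for x
  proof -
    have *: "g x \<in> X" "g (g x) = x" using g x by (auto simp: perfect_matching_def)
    show ?thesis using pD[of "g x"] gD[OF x] * by auto
  qed
  show ?thesis using gD fD by (intro exI[of _ D]) (auto simp: alternating_def D_def)
qed

text \<open>Two alternating sets differ by a union of components, and each component may be flipped
  independently.\<close>

lemma card_alternating:
  assumes f: "perfect_matching X f" and g: "perfect_matching X g" and fin: "finite X"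
  shows "card {D. alternating X f D \<and> alternating X g D} = 2 ^ card (X // (matching_steps X f g)\<^sup>*)"
proof -
  let ?R = "(matching_steps X f g)\<^sup>*"
  let ?Q = "X // ?R"
  note sym = symD[OF matching_steps_sym[OF f g]]
  obtain D0 where D0: "alternating X f D0" "alternating X g D0" using ex_alternating[OF f g] by blast
  \<comment> \<open>flip \<open>D0\<close> on the components in \<open>A\<close>\<close>
  define T where "T A = (D0 - \<Union>A) \<union> (\<Union>A - D0)" for A
  have steps: "f x \<in> X" "g x \<in> X" "(x, f x) \<in> ?R" "(x, g x) \<in> ?R" if "x \<in> X" for x 
    using that f g by (auto simp: perfect_matching_def matching_steps_def)
  have QX: "C \<subseteq> X" if "C \<in> ?Q" for C 
    using that matching_steps_in[OF f g] by (auto elim!: quotientE)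
  have Q_closed: "y \<in> C \<longleftrightarrow> x \<in> C" if "C \<in> ?Q" "(x, y) \<in> ?R" for C x y
    using that sym by (auto elim!: quotientE intro: rtrancl_trans)
  have Q_mem: "C = ?R `` {x}" if "C \<in> ?Q" "x \<in> C" for C x
    using that sym by (auto elim!: quotientE) (meson rtrancl_trans)+
  have TX: "T A \<subseteq> X" if "A \<subseteq> ?Q" for A using QX D0 that unfolding T_def alternating_def by blast
  have mem_T: "y \<in> T A \<longleftrightarrow> x \<notin> T A" if "A \<subseteq> ?Q" "(x, y) \<in> ?R" "y \<in> D0 \<longleftrightarrow> x \<notin> D0" for A x y
  proof -
    have "y \<in> \<Union>A \<longleftrightarrow> x \<in> \<Union>A" using that Q_closed by blast
    then show ?thesis using that unfolding T_def by blast
  qed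
  have "bij_betw T (Pow ?Q) {D. alternating X f D \<and> alternating X g D}"
  proof (rule bij_betwI')
    fix A B assume AB: "A \<in> Pow ?Q" "B \<in> Pow ?Q"
    show "T A = T B \<longleftrightarrow> A = B"
    proof
      assume "T A = T B"
      then have eq: "\<Union>A = \<Union>B" unfolding T_def by blast
      have "A \<subseteq> B" if sub: "A \<subseteq> ?Q" "B \<subseteq> ?Q" "\<Union>A = \<Union>B" for A B
      proof
        fix C assume C: "C \<in> A"
        then have "C \<in> ?Q" using sub by blast
        then obtain x where x: "x \<in> C" unfolding quotient_def by blast
        then obtain C' where "C' \<in> B" "x \<in> C'" using C sub by blast
        then show "C \<in> B" using Q_mem[of C x] Q_mem[of C' x] C x sub by auto
      qed
      then show "A = B" using AB eq by (intro subset_antisym) simp_all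
    qed simp
  next
    fix A assume A: "A \<in> Pow ?Q"
    then show "T A \<in> {D. alternating X f D \<and> alternating X g D}"
      using TX mem_T[of A] steps D0 unfolding alternating_def by simp
  next
    fix D assume D: "D \<in> {D. alternating X f D \<and> alternating X g D}"
    define U where "U = (D0 - D) \<union> (D - D0)"
    have UX: "U \<subseteq> X" using D D0 by (auto simp: U_def alternating_def)
    have closed: "y \<in> U \<longleftrightarrow> x \<in> U" if "(x, y) \<in> ?R" for x y using that
    proof (induction)
      case (step y z)
      have "z \<in> U \<longleftrightarrow> y \<in> U" using step.hyps(2) D D0 
        unfolding U_def alternating_def matching_steps_def by auto
      then show ?case using step.IH by simp
    qed simp
    \<comment> \<open>the components on which the two alternating sets differ\<close>
  define A where "A = {C \<in> ?Q. C \<subseteq> U}"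
    have "U = \<Union>A"
    proof
      show "U \<subseteq> \<Union>A"
      proof
        fix x assume "x \<in> U"
        then have "?R `` {x} \<in> A" using UX closed by (auto simp: A_def intro: quotientI)
        then show "x \<in> \<Union>A" by blast
      qed
    qed (auto simp: A_def)
    then have "D = T A" unfolding T_def by (auto simp: U_def)
    then show "\<exists>A\<in>Pow ?Q. D = T A" unfolding A_def by blast
  qed
  from bij_betw_same_card[OF this] show ?thesis
    using card_Pow[of ?Q] finite_imageI[OF fin, of "\<lambda>x. ?R `` {x}"]
    by (simp add: quotient_def UNION_singleton_eq_range)
qed

section \<open>Strands inside a face\<close>

text \<open>The other end of the strand of type \<open>i\<close> that starts at side \<open>k\<close>.\<close>

definition mate :: "nat \<Rightarrow> nat \<Rightarrow> nat" where
  "mate i k = (if i \<in> {1, 3} then (if even k then k + 1 else k - 1)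
     else if i \<in> {2, 4} then (if even k then (k + 3) mod 4 else (k + 1) mod 4)
     else (k + 2) mod 4)"

lemma less_four: "(k::nat) < 4 \<longleftrightarrow> k = 0 \<or> k = 1 \<or> k = 2 \<or> k = 3"
  by auto

lemma all_less_four: "(\<forall>k<4::nat. P k) \<longleftrightarrow> P 0 \<and> P 1 \<and> P 2 \<and> P 3"
  by (auto simp: less_four)

lemma one_to_five: "(i::nat) \<in> {1..5} \<longleftrightarrow> i = 1 \<or> i = 2 \<or> i = 3 \<or> i = 4 \<or> i = 5"
  by auto

lemma one_to_five_set: "{1..5::nat} = {1, 2, 3, 4, 5}"
  by auto

lemma lessThan_four: "{..<4::nat} = {0, 1, 2, 3}"
  by (auto simp: less_four)

lemma mate_simps [simp]:
  "mate (Suc 0) 0 = 1" "mate (Suc 0) (Suc 0) = 0" "mate (Suc 0) 2 = 3" "mate (Suc 0) 3 = 2"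
  "mate 2 0 = 3" "mate 2 (Suc 0) = 2" "mate 2 2 = 1" "mate 2 3 = 0"
  "mate 3 0 = 1" "mate 3 (Suc 0) = 0" "mate 3 2 = 3" "mate 3 3 = 2"
  "mate 4 0 = 3" "mate 4 (Suc 0) = 2" "mate 4 2 = 1" "mate 4 3 = 0"
  "mate 5 0 = 2" "mate 5 (Suc 0) = 3" "mate 5 2 = 0" "mate 5 3 = 1"
  by (simp_all add: mate_def)

lemma mate_less: "i \<in> {1..5} \<Longrightarrow> k < 4 \<Longrightarrow> mate i k < 4"
  unfolding one_to_five less_four by (elim disjE; simp)

lemma mate_mate: "i \<in> {1..5} \<Longrightarrow> k < 4 \<Longrightarrow> mate i (mate i k) = k"
  unfolding one_to_five less_four by (elim disjE; simp)

lemma mate_neq: "i \<in> {1..5} \<Longrightarrow> k < 4 \<Longrightarrow> mate i k \<noteq> k"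
  unfolding one_to_five less_four by (elim disjE; simp)

lemma strands_eq:
  "strands i = (if i \<in> {1, 3} then {{0, 1}, {2, 3}} else if i \<in> {2, 4} then {{3, 0}, {1, 2}} else {{0, 2}, {1, 3}})"
  by (simp add: strands_def first_strand_def lessThan_four insert_Diff_if)

lemma strand_eq:
  assumes "i \<in> {1..5}" "k < 4"
  shows "t \<in> strands i \<and> k \<in> t \<longleftrightarrow> t = {k, mate i k}"
proof -
  have pair: "t \<in> {A, B} \<and> k \<in> t \<longleftrightarrow> t = (if k \<in> A then A else B)" if "k \<in> A \<longleftrightarrow> k \<notin> B" for A B :: "nat set"
    using that by (cases "k \<in> A") auto
  consider "i \<in> {1, 3}" | "i \<in> {2, 4}" | "i = 5" using assms(1) unfolding one_to_five by blast
  then show ?thesis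
  proof cases
    case 1
    then have "strands i = {{0, 1}, {2, 3}}" by (auto simp: strands_eq)
    moreover have "k \<in> {0, 1} \<longleftrightarrow> k \<notin> {2, 3}"
      using assms(2) unfolding less_four by (elim disjE) simp_all
    moreover have "{k, mate i k} = (if k \<in> {0, 1} then {0, 1} else {2, 3})"
      using 1 assms(2) unfolding less_four by (elim insertE emptyE disjE) (simp_all add: insert_commute)
    ultimately show ?thesis using pair by metis
  next
    case 2
    then have "strands i = {{3, 0}, {1, 2}}" by (auto simp: strands_eq)
    moreover have "k \<in> {3, 0} \<longleftrightarrow> k \<notin> {1, 2}"
      using assms(2) unfolding less_four by (elim disjE) simp_all
    moreover have "{k, mate i k} = (if k \<in> {3, 0} then {3, 0} else {1, 2})"
      using 2 assms(2) unfolding less_four by (elim insertE emptyE disjE) (simp_all add: insert_commute)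
    ultimately show ?thesis using pair by metis
  next
    case 3
    then have "strands i = {{0, 2}, {1, 3}}" by (auto simp: strands_eq)
    moreover have "k \<in> {0, 2} \<longleftrightarrow> k \<notin> {1, 3}"
      using assms(2) unfolding less_four by (elim disjE) simp_all
    moreover have "{k, mate i k} = (if k \<in> {0, 2} then {0, 2} else {1, 3})"
      using 3 assms(2) unfolding less_four by (elim insertE emptyE disjE) (simp_all add: insert_commute)
    ultimately show ?thesis using pair by metis
  qed
qed

lemma strand_first:
  assumes "i \<in> {1..5}" "k < 4"
  shows "{k, mate i k} = first_strand i \<longleftrightarrow> k \<in> first_strand i"
  using assms strand_eq[OF assms, of "first_strand i"] by (auto simp: strands_def)

lemma side_colour_red:
  assumes "i \<in> {1..5}" "k < 4"
  shows "side_colour (i, v) k = Red \<longleftrightarrow> (i \<in> {1, 2} \<or> k \<in> first_strand i) = (v = Va)"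
proof -
  have "(THE t. t \<in> strands i \<and> k \<in> t) = {k, mate i k}"
    using strand_eq[OF assms] by (intro the_equality) auto
  then show ?thesis
    by (cases v) (simp_all add: side_colour_def strand_first[OF assms])
qed

section \<open>Weights around a face\<close>

text \<open>The contribution of a face to the sum over coloured oriented loops, when \<open>C\<close> is the set of its
  red sides and \<open>P\<close> the set of sides with direction bit \<open>1\<close>. The second condition says that the bit
  is kept along a strand that joins neighbouring sides, whose numbers differ in parity, and is
  flipped along a strand that joins opposite sides.\<close>

definition local_loop_weight :: "(nat \<Rightarrow> real) \<Rightarrow> nat set \<Rightarrow> nat set \<Rightarrow> real" where
  "local_loop_weight w C P = (\<Sum>c\<in>local_configs.
     if (\<forall>k<4. side_colour c k = Red \<longleftrightarrow> k \<in> C) \<and>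
        (\<forall>k<4. (k \<in> P \<longleftrightarrow> mate (fst c) k \<in> P) \<longleftrightarrow> (even k \<noteq> even (mate (fst c) k)))
     then w (fst c) else 0)"

definition covered_once :: "bool \<Rightarrow> bool \<Rightarrow> bool \<Rightarrow> bool" where
  "covered_once p q r \<longleftrightarrow> p \<and> \<not> q \<and> \<not> r \<or> \<not> p \<and> q \<and> \<not> r \<or> \<not> p \<and> \<not> q \<and> r"

text \<open>The sum over all ways to match, inside a city, the vertices whose sides are not in \<open>R\<close>; side
  \<open>k\<close> is an end of the city edges at the corners \<open>k\<close> and \<open>k + 1\<close>.\<close>

definition city_weight :: "real \<Rightarrow> real \<Rightarrow> nat set \<Rightarrow> real" where
  "city_weight a b R = (\<Sum>C\<in>Pow {..<4}.
     if \<forall>k<4. covered_once (k \<in> R) (k \<in> C) ((k + 1) mod 4 \<in> C)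
     then (\<Prod>k\<in>C. if odd k then a else b) else 0)"

lemma sum_Pow_insert:
  fixes g :: "'a set \<Rightarrow> 'b::comm_monoid_add"
  assumes "finite A" "x \<notin> A"
  shows "sum g (Pow (insert x A)) = (\<Sum>C\<in>Pow A. g C + g (insert x C))"
proof -
  have "sum g (Pow (insert x A)) = sum g (Pow A) + sum g (insert x ` Pow A)"
    unfolding Pow_insert using assms by (intro sum.union_disjoint) auto
  also have "sum g (insert x ` Pow A) = (\<Sum>C\<in>Pow A. g (insert x C))"
    using assms(2) by (subst sum.reindex) (auto simp: inj_on_def)
  finally show ?thesis by (simp add: sum.distrib)
qed

lemma city_weight_eq:
  "city_weight a b R =
     (if (0 \<in> R) = (2 \<in> R) then (if (0 \<in> R) = (1 \<in> R) \<and> (0 \<in> R) = (3 \<in> R) 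
         then (if 0 \<in> R then 1 else a\<^sup>2 + b\<^sup>2) else 0)
      else if (0 \<in> R) = (1 \<in> R) \<and> (2 \<in> R) = (3 \<in> R) then a
      else if (0 \<in> R) = (3 \<in> R) \<and> (1 \<in> R) = (2 \<in> R) then b else 0)"
proof -
  have "city_weight a b R = (\<Sum>C\<in>Pow {0, 1, 2, 3}.
     if \<forall>k<4. covered_once (k \<in> R) (k \<in> C) ((k + 1) mod 4 \<in> C)
     then (\<Prod>k\<in>C. if odd k then a else b) else 0)"
    unfolding city_weight_def lessThan_four ..
  also have "\<dots> = (if (0 \<in> R) = (2 \<in> R) then (if (0 \<in> R) = (1 \<in> R) \<and> (0 \<in> R) = (3 \<in> R) 
         then (if 0 \<in> R then 1 else a\<^sup>2 + b\<^sup>2) else 0)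
      else if (0 \<in> R) = (1 \<in> R) \<and> (2 \<in> R) = (3 \<in> R) then a
      else if (0 \<in> R) = (3 \<in> R) \<and> (1 \<in> R) = (2 \<in> R) then b else 0)"
    unfolding all_less_four
    by (cases "0 \<in> R"; cases "1 \<in> R"; cases "2 \<in> R"; cases "3 \<in> R")
       (simp_all add: sum_Pow_insert covered_once_def power2_eq_square)
  finally show ?thesis .
qed

lemma UNIV_variant: "(UNIV :: variant set) = {Va, Vb}"
  using variant.exhaust by auto

lemma strand_directions:
  "(\<forall>k<4. ((k \<in> P) = (mate 1 k \<in> P)) = (even k \<noteq> even (mate 1 k))) \<longleftrightarrow> (0 \<in> P) = (1 \<in> P) \<and> (2 \<in> P) = (3 \<in> P)"
  "(\<forall>k<4. ((k \<in> P) = (mate 2 k \<in> P)) = (even k \<noteq> even (mate 2 k))) \<longleftrightarrow> (0 \<in> P) = (3 \<in> P) \<and> (1 \<in> P) = (2 \<in> P)"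
  "(\<forall>k<4. ((k \<in> P) = (mate 3 k \<in> P)) = (even k \<noteq> even (mate 3 k))) \<longleftrightarrow> (0 \<in> P) = (1 \<in> P) \<and> (2 \<in> P) = (3 \<in> P)"
  "(\<forall>k<4. ((k \<in> P) = (mate 4 k \<in> P)) = (even k \<noteq> even (mate 4 k))) \<longleftrightarrow> (0 \<in> P) = (3 \<in> P) \<and> (1 \<in> P) = (2 \<in> P)"
  "(\<forall>k<4. ((k \<in> P) = (mate 5 k \<in> P)) = (even k \<noteq> even (mate 5 k))) \<longleftrightarrow> (0 \<in> P) \<noteq> (2 \<in> P) \<and> (1 \<in> P) \<noteq> (3 \<in> P)"
  unfolding all_less_four by (simp; blast)+

lemma strand_colours:
  "(\<forall>k<4. ((1 \<in> {1, 2::nat} \<or> k \<in> first_strand 1) = (Va = Va)) = (k \<in> C)) \<longleftrightarrow> 0 \<in> C \<and> 1 \<in> C \<and> 2 \<in> C \<and> 3 \<in> C"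
  "(\<forall>k<4. ((1 \<in> {1, 2::nat} \<or> k \<in> first_strand 1) = (Vb = Va)) = (k \<in> C)) \<longleftrightarrow> 0 \<notin> C \<and> 1 \<notin> C \<and> 2 \<notin> C \<and> 3 \<notin> C"
  "(\<forall>k<4. ((2 \<in> {1, 2::nat} \<or> k \<in> first_strand 2) = (Va = Va)) = (k \<in> C)) \<longleftrightarrow> 0 \<in> C \<and> 1 \<in> C \<and> 2 \<in> C \<and> 3 \<in> C"
  "(\<forall>k<4. ((2 \<in> {1, 2::nat} \<or> k \<in> first_strand 2) = (Vb = Va)) = (k \<in> C)) \<longleftrightarrow> 0 \<notin> C \<and> 1 \<notin> C \<and> 2 \<notin> C \<and> 3 \<notin> C"
  "(\<forall>k<4. ((3 \<in> {1, 2::nat} \<or> k \<in> first_strand 3) = (Va = Va)) = (k \<in> C)) \<longleftrightarrow> 0 \<in> C \<and> 1 \<in> C \<and> 2 \<notin> C \<and> 3 \<notin> C"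
  "(\<forall>k<4. ((3 \<in> {1, 2::nat} \<or> k \<in> first_strand 3) = (Vb = Va)) = (k \<in> C)) \<longleftrightarrow> 0 \<notin> C \<and> 1 \<notin> C \<and> 2 \<in> C \<and> 3 \<in> C"
  "(\<forall>k<4. ((4 \<in> {1, 2::nat} \<or> k \<in> first_strand 4) = (Va = Va)) = (k \<in> C)) \<longleftrightarrow> 0 \<in> C \<and> 1 \<notin> C \<and> 2 \<notin> C \<and> 3 \<in> C"
  "(\<forall>k<4. ((4 \<in> {1, 2::nat} \<or> k \<in> first_strand 4) = (Vb = Va)) = (k \<in> C)) \<longleftrightarrow> 0 \<notin> C \<and> 1 \<in> C \<and> 2 \<in> C \<and> 3 \<notin> C"
  "(\<forall>k<4. ((5 \<in> {1, 2::nat} \<or> k \<in> first_strand 5) = (Va = Va)) = (k \<in> C)) \<longleftrightarrow> 0 \<in> C \<and> 1 \<notin> C \<and> 2 \<in> C \<and> 3 \<notin> C"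
  "(\<forall>k<4. ((5 \<in> {1, 2::nat} \<or> k \<in> first_strand 5) = (Vb = Va)) = (k \<in> C)) \<longleftrightarrow> 0 \<notin> C \<and> 1 \<in> C \<and> 2 \<notin> C \<and> 3 \<in> C"
  unfolding all_less_four by (simp_all add: first_strand_def)

text \<open>The five summands come from the five types. In each type the two variants carry complementary
  colours, so at most one of them matches \<open>C\<close>.\<close>

lemma local_loop_weight_eq:
  "local_loop_weight w C P =
     (if (0 \<in> C) = (1 \<in> C) \<and> (1 \<in> C) = (2 \<in> C) \<and> (2 \<in> C) = (3 \<in> C)
         \<and> (0 \<in> P) = (1 \<in> P) \<and> (2 \<in> P) = (3 \<in> P) then w 1 else 0) +
     (if (0 \<in> C) = (1 \<in> C) \<and> (1 \<in> C) = (2 \<in> C) \<and> (2 \<in> C) = (3 \<in> C)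
         \<and> (0 \<in> P) = (3 \<in> P) \<and> (1 \<in> P) = (2 \<in> P) then w 2 else 0) +
     (if (0 \<in> C) = (1 \<in> C) \<and> (2 \<in> C) = (3 \<in> C) \<and> (0 \<in> C) \<noteq> (2 \<in> C)
         \<and> (0 \<in> P) = (1 \<in> P) \<and> (2 \<in> P) = (3 \<in> P) then w 3 else 0) +
     (if (0 \<in> C) = (3 \<in> C) \<and> (1 \<in> C) = (2 \<in> C) \<and> (0 \<in> C) \<noteq> (1 \<in> C)
         \<and> (0 \<in> P) = (3 \<in> P) \<and> (1 \<in> P) = (2 \<in> P) then w 4 else 0) +
     (if (0 \<in> C) = (2 \<in> C) \<and> (1 \<in> C) = (3 \<in> C) \<and> (0 \<in> C) \<noteq> (1 \<in> C)
         \<and> (0 \<in> P) \<noteq> (2 \<in> P) \<and> (1 \<in> P) \<noteq> (3 \<in> P) then w 5 else 0)"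
proof -
  define t where "t i v =
    (if (\<forall>k<4. ((i \<in> {1, 2} \<or> k \<in> first_strand i) = (v = Va)) = (k \<in> C)) \<and>
        (\<forall>k<4. ((k \<in> P) = (mate i k \<in> P)) = (even k \<noteq> even (mate i k)))
     then w i else 0)" for i v
  have red: "(\<forall>k<4. (side_colour (i, v) k = Red) = (k \<in> C)) \<longleftrightarrow>
      (\<forall>k<4. ((i \<in> {1, 2} \<or> k \<in> first_strand i) = (v = Va)) = (k \<in> C))" if "i \<in> {1..5}" for i v
    by (intro all_cong1 imp_cong refl) (simp only: side_colour_red[OF that])
  have "local_loop_weight w C P = (\<Sum>i\<in>{1..5}. \<Sum>v\<in>{Va, Vb}.
     if (\<forall>k<4. side_colour (i, v) k = Red \<longleftrightarrow> k \<in> C) \<and>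
        (\<forall>k<4. (k \<in> P \<longleftrightarrow> mate i k \<in> P) \<longleftrightarrow> (even k \<noteq> even (mate i k)))
     then w i else 0)"
    unfolding local_loop_weight_def local_configs_def UNIV_variant sum.cartesian_product
    by (intro sum.cong refl) (simp only: case_prod_unfold prod.collapse)
  also have "\<dots> = (\<Sum>i\<in>{1..5}. \<Sum>v\<in>{Va, Vb}. t i v)"
    unfolding t_def by (intro sum.cong refl) (simp only: red)
  also have "\<dots> =
    (t 1 Va + t 1 Vb) + (t 2 Va + t 2 Vb) + (t 3 Va + t 3 Vb) + (t 4 Va + t 4 Vb) + (t 5 Va + t 5 Vb)"
    unfolding one_to_five_set by (simp add: add.assoc)
  finally have sum: "local_loop_weight w C P =
    (t 1 Va + t 1 Vb) + (t 2 Va + t 2 Vb) + (t 3 Va + t 3 Vb) + (t 4 Va + t 4 Vb) + (t 5 Va + t 5 Vb)" .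
  have t1: "t 1 Va + t 1 Vb = (if (0 \<in> C) = (1 \<in> C) \<and> (1 \<in> C) = (2 \<in> C) \<and> (2 \<in> C) = (3 \<in> C)
         \<and> (0 \<in> P) = (1 \<in> P) \<and> (2 \<in> P) = (3 \<in> P) then w 1 else 0)"
    unfolding t_def strand_directions strand_colours by auto
  have t2: "t 2 Va + t 2 Vb = (if (0 \<in> C) = (1 \<in> C) \<and> (1 \<in> C) = (2 \<in> C) \<and> (2 \<in> C) = (3 \<in> C)
         \<and> (0 \<in> P) = (3 \<in> P) \<and> (1 \<in> P) = (2 \<in> P) then w 2 else 0)"
    unfolding t_def strand_directions strand_colours by auto
  have t3: "t 3 Va + t 3 Vb = (if (0 \<in> C) = (1 \<in> C) \<and> (2 \<in> C) = (3 \<in> C) \<and> (0 \<in> C) \<noteq> (2 \<in> C)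
         \<and> (0 \<in> P) = (1 \<in> P) \<and> (2 \<in> P) = (3 \<in> P) then w 3 else 0)"
    unfolding t_def strand_directions strand_colours by auto
  have t4: "t 4 Va + t 4 Vb = (if (0 \<in> C) = (3 \<in> C) \<and> (1 \<in> C) = (2 \<in> C) \<and> (0 \<in> C) \<noteq> (1 \<in> C)
         \<and> (0 \<in> P) = (3 \<in> P) \<and> (1 \<in> P) = (2 \<in> P) then w 4 else 0)"
    unfolding t_def strand_directions strand_colours by auto
  have t5: "t 5 Va + t 5 Vb = (if (0 \<in> C) = (2 \<in> C) \<and> (1 \<in> C) = (3 \<in> C) \<and> (0 \<in> C) \<noteq> (1 \<in> C)
         \<and> (0 \<in> P) \<noteq> (2 \<in> P) \<and> (1 \<in> P) \<noteq> (3 \<in> P) then w 5 else 0)"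
    unfolding t_def strand_directions strand_colours by auto
  show ?thesis unfolding sum t1 t2 t3 t4 t5 ..
qed

text \<open>The heart of the matter. Up to complementation, a set of sides with nonzero city weight is trivial,
  or cut off at the white corners, or cut off at the black corners, with weights \<open>1\<close>, \<open>a\<close>,
  \<open>b\<close>. Equal classes of \<open>P\<close> and of the symmetric difference make \<open>C\<close> constant and yield
  \<open>1 = a\<^sup>2 + b\<^sup>2\<close> (both turning types fit), \<open>a\<^sup>2\<close> or \<open>b\<^sup>2\<close>; different classes yield the two-coloured
  types with weights \<open>a\<close>, \<open>b\<close> and, for the crossing, \<open>a b\<close>.\<close>

lemma local_factorisation:
  assumes "ff_parameters w (l, a, b)"
  shows "local_loop_weight w C P = l * city_weight a b P * city_weight a b ((P - C) \<union> (C - P))"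
proof -
  have ab: "a\<^sup>2 + b\<^sup>2 = 1" and w: "w 1 = l * a\<^sup>2" "w 2 = l * b\<^sup>2" "w 3 = l * a" "w 4 = l * b" "w 5 = l * a * b"
    using assms by (auto simp: ff_parameters_def)
  have ab': "a * (a * l) + b * (b * l) = l"
    using ab by (metis distrib_right mult.assoc mult_1 power2_eq_square)
  have sym_diff: "k \<in> (P - C) \<union> (C - P) \<longleftrightarrow> (k \<in> P) \<noteq> (k \<in> C)" for k by blast
  show ?thesis
    unfolding local_loop_weight_eq city_weight_eq sym_diff ab w
    by (cases "0 \<in> C"; cases "1 \<in> C"; cases "2 \<in> C"; cases "3 \<in> C";
      cases "0 \<in> P"; cases "1 \<in> P"; cases "2 \<in> P"; cases "3 \<in> P";
      simp only: simp_thms if_True if_False if_cancel add_0_left add_0_right mult_zero_left mult_zero_right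
        mult_1_left mult_1_right ab' power2_eq_square mult_ac)
qed

section \<open>The loop model as a sum over pairs of edge sets\<close>

lemma strand_link:
  assumes "i \<in> {1..5}"
  shows "(\<exists>t. t \<in> strands i \<and> k \<in> t \<and> l \<in> t) \<longleftrightarrow> k < 4 \<and> (l = k \<or> l = mate i k)"
proof (cases "k < 4")
  case True
  have "(\<exists>t. t \<in> strands i \<and> k \<in> t \<and> l \<in> t) \<longleftrightarrow> (\<exists>t. (t \<in> strands i \<and> k \<in> t) \<and> l \<in> t)" by blast
  then show ?thesis unfolding strand_eq[OF assms True] using True by simp
next
  case False
  have "\<Union>(strands i) \<subseteq> {..<4}" by (simp add: strands_def first_strand_def)
  then show ?thesis using False by blast
qed

lemma ex1_of_three:
  assumes "x \<noteq> y" "y \<noteq> z" "x \<noteq> z"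
  shows "(\<exists>!q. q \<in> m \<and> (q = x \<or> q = y \<or> q = z)) \<longleftrightarrow> covered_once (x \<in> m) (y \<in> m) (z \<in> m)"
  using assms unfolding covered_once_def by (cases "x \<in> m"; cases "y \<in> m"; cases "z \<in> m") auto

text \<open>Besides finiteness, all that the counting argument needs to know about the surface: the sides of the faces are glued
  in pairs along the edges, and the numbers of glued sides have opposite parity.\<close>

locale glued_sides =
  fixes G :: "('s::t2_space) surface_graph"
  assumes finite_faces: "finite (faces G)"
    and finite_edges: "finite (edges G)"
    and side_edge_in: "s \<in> sides G \<Longrightarrow> side_edge G s \<in> edges G"
    and two_sides: "e \<in> edges G \<Longrightarrow>
      \<exists>s s'. {t \<in> sides G. side_edge G t = e} = {s, s'} \<and> even (snd s) \<noteq> even (snd s')"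
begin

definition partner :: "'s set \<times> nat \<Rightarrow> 's set \<times> nat" where
  "partner s = (THE t. t \<in> sides G \<and> t \<noteq> s \<and> side_edge G t = side_edge G s)"

lemma finite_sides: "finite (sides G)"
  using finite_faces by (simp add: sides_def)

lemma partner_unique:
  assumes "s \<in> sides G"
  shows "t \<in> sides G \<and> t \<noteq> s \<and> side_edge G t = side_edge G s \<longleftrightarrow> t = partner s"
    and "even (snd (partner s)) \<noteq> even (snd s)"
proof -
  obtain p q where pq: "{t \<in> sides G. side_edge G t = side_edge G s} = {p, q}" "even (snd p) \<noteq> even (snd q)"
    using two_sides[OF side_edge_in[OF assms]] by blast
  then have "s = p \<or> s = q" using assms by blast
  then have "\<exists>u. {t \<in> sides G. side_edge G t = side_edge G s} = {s, u} \<and> even (snd s) \<noteq> even (snd u)"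
  proof
    assume "s = p"
    then show ?thesis using pq by (intro exI[of _ q]) simp
  next
    assume "s = q"
    then show ?thesis using pq by (intro exI[of _ p]) (simp add: insert_commute)
  qed
  then obtain u where u: "{t \<in> sides G. side_edge G t = side_edge G s} = {s, u}" "even (snd s) \<noteq> even (snd u)"
    by blast
  have "t \<in> sides G \<and> side_edge G t = side_edge G s \<longleftrightarrow> t = s \<or> t = u" for t
    using eqset_imp_iff[OF u(1), of t] by simp
  then have *: "t \<in> sides G \<and> t \<noteq> s \<and> side_edge G t = side_edge G s \<longleftrightarrow> t = u" for t
    using u(2) by metis
  have "partner s = u" unfolding partner_def * by simp
  then show "t \<in> sides G \<and> t \<noteq> s \<and> side_edge G t = side_edge G s \<longleftrightarrow> t = partner s"
    and "even (snd (partner s)) \<noteq> even (snd s)"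
    using * u by simp_all
qed

lemma partner:
  assumes "s \<in> sides G"
  shows "partner s \<in> sides G" "partner s \<noteq> s" "side_edge G (partner s) = side_edge G s"
  using partner_unique(1)[OF assms] by blast+

lemma perfect_matching_partner: "perfect_matching (sides G) partner"
proof -
  have "partner (partner s) = s" if "s \<in> sides G" for s
    using partner[OF that] partner_unique(1)[OF partner(1)[OF that], of s] that by simp
  then show ?thesis using partner by (auto simp: perfect_matching_def)
qed

lemma same_edge_iff:
  assumes "s \<in> sides G" "s' \<in> sides G"
  shows "side_edge G s = side_edge G s' \<longleftrightarrow> s' = s \<or> s' = partner s"
proof -
  have "s' \<noteq> s \<and> side_edge G s' = side_edge G s \<longleftrightarrow> s' = partner s"
    using partner_unique(1)[OF assms(1), of s'] assms(2) by simp
  then show ?thesis using partner(3)[OF assms(1)] by (cases "s' = s") auto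
qed

definition strand_end :: "('s set \<Rightarrow> local_config) \<Rightarrow> 's set \<times> nat \<Rightarrow> 's set \<times> nat" where
  "strand_end \<sigma> = (\<lambda>(f, k). (f, mate (fst (\<sigma> f)) k))"

lemma local_config_type:
  assumes "\<sigma> \<in> faces G \<rightarrow>\<^sub>E local_configs" "f \<in> faces G"
  shows "fst (\<sigma> f) \<in> {1..5}"
  using PiE_mem[OF assms] unfolding local_configs_def by (rule mem_Times_iff[THEN iffD1, THEN conjunct1])

lemma perfect_matching_strand_end:
  assumes "\<sigma> \<in> faces G \<rightarrow>\<^sub>E local_configs"
  shows "perfect_matching (sides G) (strand_end \<sigma>)"
proof -
  have "fst (\<sigma> f) \<in> {1..5}" if "f \<in> faces G" for f using local_config_type[OF assms that] .
  then show ?thesis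
    unfolding perfect_matching_def strand_end_def sides_def
    by (clarsimp simp del: atLeastAtMost_iff simp: mate_less mate_mate mate_neq)
qed

text \<open>Loops are the components of the graph on the sides formed by two perfect matchings, the
  strands and the gluing along edges.\<close>

lemma linked_iff:
  assumes "\<sigma> \<in> faces G \<rightarrow>\<^sub>E local_configs"
  shows "(s, s') \<in> linked G \<sigma> \<longleftrightarrow> s \<in> sides G \<and> (s' = s \<or> s' = strand_end \<sigma> s \<or> s' = partner s)"
proof -
  obtain f k g l where s: "s = (f, k)" "s' = (g, l)" by (metis surj_pair)
  have "(s, s') \<in> {((f, k), (f, l)) | f k l t. f \<in> faces G \<and> t \<in> strands (fst (\<sigma> f)) \<and> k \<in> t \<and> l \<in> t}
      \<longleftrightarrow> f \<in> faces G \<and> g = f \<and> (\<exists>t. t \<in> strands (fst (\<sigma> f)) \<and> k \<in> t \<and> l \<in> t)"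
    unfolding s by blast
  also have "\<dots> \<longleftrightarrow> s \<in> sides G \<and> (s' = s \<or> s' = strand_end \<sigma> s)"
    using strand_link[OF local_config_type[OF assms]] unfolding s strand_end_def sides_def by auto
  finally have 1: "(s, s') \<in> {((f, k), (f, l)) | f k l t. f \<in> faces G \<and> t \<in> strands (fst (\<sigma> f)) \<and> k \<in> t \<and> l \<in> t}
      \<longleftrightarrow> s \<in> sides G \<and> (s' = s \<or> s' = strand_end \<sigma> s)" .
  have "(s, s') \<in> {(s, s'). s \<in> sides G \<and> s' \<in> sides G \<and> side_edge G s = side_edge G s'} \<longleftrightarrow>
      s \<in> sides G \<and> s' \<in> sides G \<and> side_edge G s = side_edge G s'" by simp
  also have "\<dots> \<longleftrightarrow> s \<in> sides G \<and> (s' = s \<or> s' = partner s)"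
    using same_edge_iff[of s s'] partner[of s] by metis
  finally show ?thesis unfolding linked_def Un_iff 1 by blast
qed

lemma linked_rtrancl:
  assumes "\<sigma> \<in> faces G \<rightarrow>\<^sub>E local_configs"
  shows "(linked G \<sigma>)\<^sup>* = (matching_steps (sides G) (strand_end \<sigma>) partner)\<^sup>*"
proof (rule rtrancl_subset)
  show "matching_steps (sides G) (strand_end \<sigma>) partner \<subseteq> linked G \<sigma>"
    using linked_iff[OF assms] by (auto simp: matching_steps_def)
  show "linked G \<sigma> \<subseteq> (matching_steps (sides G) (strand_end \<sigma>) partner)\<^sup>*"
  proof (rule subrelI)
    fix s s' assume "(s, s') \<in> linked G \<sigma>"
    then have "s' = s \<or> (s, s') \<in> matching_steps (sides G) (strand_end \<sigma>) partner"
      unfolding linked_iff[OF assms] matching_steps_def by blast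
    then show "(s, s') \<in> (matching_steps (sides G) (strand_end \<sigma>) partner)\<^sup>*" by blast
  qed
qed

text \<open>The sets of direction bits compatible with a configuration \<open>\<sigma>\<close> of strands.\<close>

definition directions :: "('s set \<Rightarrow> local_config) \<Rightarrow> 's set set set" where
  "directions \<sigma> = {P \<in> Pow (edges G). \<forall>f\<in>faces G. \<forall>k<4.
     ((side_edge G (f, k) \<in> P) = (side_edge G (f, mate (fst (\<sigma> f)) k) \<in> P))
       = (even k \<noteq> even (mate (fst (\<sigma> f)) k))}"

text \<open>An orientation of the loops is an alternating set \<open>D\<close> of sides, the sides at which the loop enters
  the face, say. It is turned into bits by comparing with the parity of the number of the side.
  Gluing flips membership in \<open>D\<close> and flips the parity, so the bit depends only on the edge.\<close>

lemma card_directions: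
  assumes "\<sigma> \<in> faces G \<rightarrow>\<^sub>E local_configs"
  shows "card (directions \<sigma>) = 2 ^ card (loops G \<sigma>)"
proof -
  let ?A = "{D. alternating (sides G) (strand_end \<sigma>) D \<and> alternating (sides G) partner D}"
  \<comment> \<open>the sides at which the oriented loops enter, recovered from the bits\<close>
  define T where "T P = {s \<in> sides G. (side_edge G s \<in> P) \<noteq> even (snd s)}" for P
  have T: "s \<in> T P \<longleftrightarrow> (side_edge G s \<in> P) \<noteq> even (snd s)" if "s \<in> sides G" for s P
    using that by (simp add: T_def)
  note sm = perfect_matching_strand_end[OF assms]
  have se: "strand_end \<sigma> s \<in> sides G" if "s \<in> sides G" for s
    using sm that by (auto simp: perfect_matching_def)
  have cond: "P \<in> directions \<sigma> \<longleftrightarrow> P \<subseteq> edges G \<and> alternating (sides G) (strand_end \<sigma>) (T P)" for P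
  proof -
    have "alternating (sides G) (strand_end \<sigma>) (T P) \<longleftrightarrow>
      (\<forall>s\<in>sides G. (side_edge G s \<in> P) = (side_edge G (strand_end \<sigma> s) \<in> P) \<longleftrightarrow>
         even (snd s) \<noteq> even (snd (strand_end \<sigma> s)))"
      using T se unfolding alternating_def by (auto simp: T_def)
    also have "\<dots> \<longleftrightarrow> (\<forall>f\<in>faces G. \<forall>k<4.
       ((side_edge G (f, k) \<in> P) = (side_edge G (f, mate (fst (\<sigma> f)) k) \<in> P))
       = (even k \<noteq> even (mate (fst (\<sigma> f)) k)))"
      by (auto simp: sides_def strand_end_def)
    finally show ?thesis by (simp add: directions_def)
  qed
  have edge_side: "\<exists>s\<in>sides G. side_edge G s = e" if "e \<in> edges G" for e
    using two_sides[OF that] by blast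
  have "bij_betw T (directions \<sigma>) ?A"
  proof (rule bij_betwI')
    fix P Q assume PQ: "P \<in> directions \<sigma>" "Q \<in> directions \<sigma>"
    show "T P = T Q \<longleftrightarrow> P = Q"
    proof
      assume eq: "T P = T Q"
      have "e \<in> P \<longleftrightarrow> e \<in> Q" if "e \<in> edges G" for e using edge_side[OF that] T eq by blast
      then show "P = Q" using PQ by (auto simp: directions_def)
    qed simp
  next
    fix P assume P: "P \<in> directions \<sigma>"
    moreover have "alternating (sides G) partner (T P)"
      using partner partner_unique(2) T unfolding alternating_def by (auto simp: T_def)
    ultimately show "T P \<in> ?A" using cond by blast
  next
    fix D assume D: "D \<in> ?A"
    define P where "P = side_edge G ` {s \<in> sides G. (s \<in> D) \<noteq> even (snd s)}"
    have P: "side_edge G s \<in> P \<longleftrightarrow> (s \<in> D) \<noteq> even (snd s)" if s: "s \<in> sides G" for s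
    proof
      assume "side_edge G s \<in> P"
      then obtain t where t: "t \<in> sides G" "(t \<in> D) \<noteq> even (snd t)" "side_edge G s = side_edge G t"
        by (auto simp: P_def)
      then have "t = s \<or> t = partner s" using same_edge_iff[OF s t(1)] by simp
      then show "(s \<in> D) \<noteq> even (snd s)"
        using t(2) D s partner_unique(2)[OF s] by (auto simp: alternating_def)
    qed (use s in \<open>auto simp: P_def\<close>)
    have "T P = D" using P D unfolding T_def alternating_def by blast
    moreover have "P \<subseteq> edges G" using side_edge_in by (auto simp: P_def)
    ultimately show "\<exists>P\<in>directions \<sigma>. D = T P" using cond D by blast
  qed
  then have "card (directions \<sigma>) = card ?A" by (rule bij_betw_same_card)
  also have "\<dots> = 2 ^ card (loops G \<sigma>)"
    unfolding card_alternating[OF sm perfect_matching_partner finite_sides] loops_def linked_rtrancl[OF assms] ..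
  finally show ?thesis .
qed

definition red_edges :: "('s set \<Rightarrow> local_config) \<Rightarrow> 's set set set" where
  "red_edges \<sigma> = {C \<in> Pow (edges G). \<forall>f\<in>faces G. \<forall>k<4.
     (side_colour (\<sigma> f) k = Red) = (side_edge G (f, k) \<in> C)}"

text \<open>Membership in \<open>loop_configs\<close> says precisely that the colours of the sides come from a colouring of
  the edges. That colouring is unique because each edge has a side.\<close>

lemma card_red_edges:
  assumes "\<sigma> \<in> faces G \<rightarrow>\<^sub>E local_configs"
  shows "card (red_edges \<sigma>) = (if \<sigma> \<in> loop_configs G then 1 else 0)"
proof -
  define col where "col s = side_colour (\<sigma> (fst s)) (snd s)" for s
  have loop: "\<sigma> \<in> loop_configs G \<longleftrightarrow>
      (\<forall>s\<in>sides G. \<forall>s'\<in>sides G. side_edge G s = side_edge G s' \<longrightarrow> col s = col s')"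
    using assms unfolding loop_configs_def col_def by (simp add: case_prod_unfold)
  have red: "C \<in> red_edges \<sigma> \<longleftrightarrow> C \<subseteq> edges G \<and> (\<forall>s\<in>sides G. col s = Red \<longleftrightarrow> side_edge G s \<in> C)" for C
    unfolding red_edges_def col_def sides_def by (simp add: Ball_def) blast
  have eqc: "c = d" if "(c = Red) = (d = Red)" for c d :: colour using that by (cases c; cases d) auto
  show ?thesis
  proof (cases "\<sigma> \<in> loop_configs G")
    case True
    define C where "C = {side_edge G s | s. s \<in> sides G \<and> col s = Red}"
    have memC: "col s = Red \<longleftrightarrow> side_edge G s \<in> C" if "s \<in> sides G" for s
      using True that unfolding loop C_def by (smt (verit) mem_Collect_eq)
    have "C' = C" if C': "C' \<in> red_edges \<sigma>" for C'
    proof (rule set_eqI)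
      fix e
      have "e \<in> C' \<longleftrightarrow> e \<in> C" if "e \<in> edges G"
      proof -
        obtain s where s: "s \<in> sides G" "side_edge G s = e" using two_sides[OF \<open>e \<in> edges G\<close>] by blast
        then show ?thesis using C' memC[OF s(1)] unfolding red by blast
      qed
      moreover have "e \<in> edges G" if "e \<in> C" using that side_edge_in unfolding C_def by blast
      moreover have "e \<in> edges G" if "e \<in> C'" using that C' unfolding red by blast
      ultimately show "e \<in> C' \<longleftrightarrow> e \<in> C" by blast
    qed
    moreover have "C \<in> red_edges \<sigma>"
      unfolding red using memC side_edge_in by (auto simp: C_def)
    ultimately have "red_edges \<sigma> = {C}" by blast
    then show ?thesis using True by simp
  next
    case False
    have "\<sigma> \<in> loop_configs G" if "C \<in> red_edges \<sigma>" for C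
      using that unfolding red loop by (metis eqc)
    then have "red_edges \<sigma> = {}" using False by blast
    then show ?thesis using False by simp
  qed
qed

definition at_face :: "'s set \<Rightarrow> 's set set \<Rightarrow> nat set" where
  "at_face f A = {k. k < 4 \<and> side_edge G (f, k) \<in> A}"

lemma prod_if_zero:
  "finite A \<Longrightarrow> (\<Prod>x\<in>A. if P x then g x else 0) = (if \<forall>x\<in>A. P x then \<Prod>x\<in>A. g x else (0::real))"
  by (induction A rule: finite_induct) auto

lemma finite_local_configs: "finite local_configs"
  unfolding local_configs_def UNIV_variant by simp

text \<open>Distributing the product over the faces turns a choice of local configurations into a
  configuration \<open>\<sigma>\<close>. For fixed \<open>\<sigma>\<close> the conditions on \<open>C\<close> and on \<open>P\<close> are independent, and the number
  of solutions is \<open>1\<close> or \<open>0\<close> for \<open>C\<close> and a power of \<open>2\<close> for \<open>P\<close>.\<close>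

lemma Z_loop_as_vertex_model:
  "Z_loop G w = (\<Sum>C\<in>Pow (edges G). \<Sum>P\<in>Pow (edges G).
     \<Prod>f\<in>faces G. local_loop_weight (w f) (at_face f C) (at_face f P))"
proof -
  let ?E = "Pow (edges G)" and ?S = "faces G \<rightarrow>\<^sub>E local_configs"
  let ?c = "\<lambda>C \<sigma> f. \<forall>k<4. (side_colour (\<sigma> f) k = Red) = (side_edge G (f, k) \<in> C)"
  let ?p = "\<lambda>P \<sigma> f. \<forall>k<4. ((side_edge G (f, k) \<in> P) = (side_edge G (f, mate (fst (\<sigma> f)) k) \<in> P))
     = (even k \<noteq> even (mate (fst (\<sigma> f)) k))"
  let ?w = "\<lambda>\<sigma>. \<Prod>f\<in>faces G. w f (fst (\<sigma> f))"
  have finE: "finite ?E" using finite_edges by simp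
  have finS: "finite ?S" using finite_faces finite_local_configs by (simp add: finite_PiE)
  have "(\<Prod>f\<in>faces G. local_loop_weight (w f) (at_face f C) (at_face f P)) =
      (\<Sum>\<sigma>\<in>?S. if (\<forall>f\<in>faces G. ?c C \<sigma> f) \<and> (\<forall>f\<in>faces G. ?p P \<sigma> f) then ?w \<sigma> else 0)" for C P
  proof -
    have "(\<Prod>f\<in>faces G. local_loop_weight (w f) (at_face f C) (at_face f P)) =
        (\<Sum>\<sigma>\<in>?S. \<Prod>f\<in>faces G. if (\<forall>k<4. (side_colour (\<sigma> f) k = Red) = (k \<in> at_face f C)) \<and>
          (\<forall>k<4. ((k \<in> at_face f P) = (mate (fst (\<sigma> f)) k \<in> at_face f P)) = (even k \<noteq> even (mate (fst (\<sigma> f)) k)))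
          then w f (fst (\<sigma> f)) else 0)"
      unfolding local_loop_weight_def
      by (rule prod_sum_PiE) (use finite_faces finite_local_configs in auto)
    also have "\<dots> = (\<Sum>\<sigma>\<in>?S. \<Prod>f\<in>faces G. if ?c C \<sigma> f \<and> ?p P \<sigma> f then w f (fst (\<sigma> f)) else 0)"
    proof (intro sum.cong prod.cong refl)
      fix \<sigma> f assume "\<sigma> \<in> ?S" "f \<in> faces G"
      then have "fst (\<sigma> f) \<in> {1..5}" by (rule local_config_type)
      then have "k \<in> at_face f C \<longleftrightarrow> side_edge G (f, k) \<in> C"
        "mate (fst (\<sigma> f)) k \<in> at_face f P \<longleftrightarrow> side_edge G (f, mate (fst (\<sigma> f)) k) \<in> P"
        "k \<in> at_face f P \<longleftrightarrow> side_edge G (f, k) \<in> P" if "k < 4" for k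
        using that mate_less by (auto simp: at_face_def)
      then have "((\<forall>k<4. (side_colour (\<sigma> f) k = Red) = (k \<in> at_face f C)) \<and>
          (\<forall>k<4. ((k \<in> at_face f P) = (mate (fst (\<sigma> f)) k \<in> at_face f P)) = (even k \<noteq> even (mate (fst (\<sigma> f)) k))))
          = (?c C \<sigma> f \<and> ?p P \<sigma> f)" by (simp cong: conj_cong all_cong)
      then show "(if (\<forall>k<4. (side_colour (\<sigma> f) k = Red) = (k \<in> at_face f C)) \<and>
          (\<forall>k<4. ((k \<in> at_face f P) = (mate (fst (\<sigma> f)) k \<in> at_face f P)) = (even k \<noteq> even (mate (fst (\<sigma> f)) k)))
          then w f (fst (\<sigma> f)) else 0) = (if ?c C \<sigma> f \<and> ?p P \<sigma> f then w f (fst (\<sigma> f)) else 0)"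
        by presburger
    qed
    also have "\<dots> = (\<Sum>\<sigma>\<in>?S. if (\<forall>f\<in>faces G. ?c C \<sigma> f) \<and> (\<forall>f\<in>faces G. ?p P \<sigma> f) then ?w \<sigma> else 0)"
      unfolding prod_if_zero[OF finite_faces] ball_conj_distrib ..
    finally show ?thesis .
  qed
  then have "(\<Sum>C\<in>?E. \<Sum>P\<in>?E. \<Prod>f\<in>faces G. local_loop_weight (w f) (at_face f C) (at_face f P)) =
      (\<Sum>C\<in>?E. \<Sum>P\<in>?E. \<Sum>\<sigma>\<in>?S. if (\<forall>f\<in>faces G. ?c C \<sigma> f) \<and> (\<forall>f\<in>faces G. ?p P \<sigma> f) then ?w \<sigma> else 0)"
    by simp
  also have "\<dots> = (\<Sum>\<sigma>\<in>?S. \<Sum>C\<in>?E. \<Sum>P\<in>?E.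
      if (\<forall>f\<in>faces G. ?c C \<sigma> f) \<and> (\<forall>f\<in>faces G. ?p P \<sigma> f) then ?w \<sigma> else 0)"
    unfolding sum.swap[of _ ?S ?E] ..
  also have "\<dots> = (\<Sum>\<sigma>\<in>?S. if \<sigma> \<in> loop_configs G then loop_weight G w \<sigma> else 0)"
  proof (intro sum.cong refl)
    fix \<sigma> assume \<sigma>: "\<sigma> \<in> ?S"
    have ind: "(\<Sum>A\<in>?E. if Q A then 1 else 0::real) = real (card {A \<in> ?E. Q A})" for Q
      using finE by (simp add: sum.If_cases Int_def)
    have gen: "(\<Sum>C\<in>?E. \<Sum>P\<in>?E. x C * y P * z) = sum x ?E * sum y ?E * z" for x y and z :: real
      by (subst sum_product) (simp only: sum_distrib_right)
    have "(\<Sum>C\<in>?E. \<Sum>P\<in>?E. if (\<forall>f\<in>faces G. ?c C \<sigma> f) \<and> (\<forall>f\<in>faces G. ?p P \<sigma> f) then ?w \<sigma> else 0)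
      = (\<Sum>C\<in>?E. \<Sum>P\<in>?E. (if \<forall>f\<in>faces G. ?c C \<sigma> f then 1 else 0) * (if \<forall>f\<in>faces G. ?p P \<sigma> f then 1 else 0) * ?w \<sigma>)"
      by (intro sum.cong refl) auto
    also have "\<dots> = real (card (red_edges \<sigma>)) * real (card (directions \<sigma>)) * ?w \<sigma>"
      unfolding red_edges_def directions_def ind[symmetric] gen ..
    also have "\<dots> = (if \<sigma> \<in> loop_configs G then loop_weight G w \<sigma> else 0)"
      unfolding card_red_edges[OF \<sigma>] card_directions[OF \<sigma>] by (simp add: loop_weight_def)
    finally show "(\<Sum>C\<in>?E. \<Sum>P\<in>?E. if (\<forall>f\<in>faces G. ?c C \<sigma> f) \<and> (\<forall>f\<in>faces G. ?p P \<sigma> f) then ?w \<sigma> else 0)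
      = (if \<sigma> \<in> loop_configs G then loop_weight G w \<sigma> else 0)" .
  qed
  also have "\<dots> = Z_loop G w"
  proof -
    have "loop_configs G \<subseteq> ?S" by (auto simp: loop_configs_def)
    then show ?thesis unfolding Z_loop_def using finS by (simp add: sum.inter_restrict[symmetric] inf_absorb2)
  qed
  finally show ?thesis by simp
qed


section \<open>The dimer model as a sum over edge sets\<close>

lemma dec_ends_iff:
  assumes "f \<in> faces G" "k < 4" "q \<in> dec_edges G"
  shows "(f, k) \<in> dec_ends G q \<longleftrightarrow>
    q = Road (side_edge G (f, k)) \<or> q = City f k \<or> q = City f ((k + 1) mod 4)"
proof (cases q)
  case (City f' k')
  then have "k' < 4" using assms(3) by (auto simp: dec_edges_def)
  then have "k = (k' + 3) mod 4 \<longleftrightarrow> k' = (k + 1) mod 4"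
    using assms(2) unfolding less_four by (elim disjE) simp_all
  then show ?thesis using City by auto
next
  case (Road e)
  then show ?thesis using assms(1,2) by (auto simp: sides_def)
qed

lemma dimer_configs_iff:
  "m \<in> dimer_configs G \<longleftrightarrow> m \<subseteq> dec_edges G \<and> (\<forall>f\<in>faces G. \<forall>k<4.
     covered_once (Road (side_edge G (f, k)) \<in> m) (City f k \<in> m) (City f ((k + 1) mod 4) \<in> m))"
proof -
  have "(\<exists>!q. q \<in> m \<and> (f, k) \<in> dec_ends G q) \<longleftrightarrow>
      covered_once (Road (side_edge G (f, k)) \<in> m) (City f k \<in> m) (City f ((k + 1) mod 4) \<in> m)"
    if "m \<subseteq> dec_edges G" "f \<in> faces G" "k < 4" for f k
  proof -
    have "(\<exists>!q. q \<in> m \<and> (f, k) \<in> dec_ends G q) \<longleftrightarrow>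
        (\<exists>!q. q \<in> m \<and> (q = Road (side_edge G (f, k)) \<or> q = City f k \<or> q = City f ((k + 1) mod 4)))"
    proof -
      have "(q \<in> m \<and> (f, k) \<in> dec_ends G q) \<longleftrightarrow>
          (q \<in> m \<and> (q = Road (side_edge G (f, k)) \<or> q = City f k \<or> q = City f ((k + 1) mod 4)))" for q
        using dec_ends_iff[OF that(2,3), of q] that(1) by blast
      then show ?thesis by simp
    qed
    also have "k \<noteq> (k + 1) mod 4" using that(3) unfolding less_four by (elim disjE) simp_all
    then have "(\<exists>!q. q \<in> m \<and> (q = Road (side_edge G (f, k)) \<or> q = City f k \<or> q = City f ((k + 1) mod 4))) \<longleftrightarrow>
        covered_once (Road (side_edge G (f, k)) \<in> m) (City f k \<in> m) (City f ((k + 1) mod 4) \<in> m)"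
      by (intro ex1_of_three) simp_all
    finally show ?thesis .
  qed
  then show ?thesis unfolding dimer_configs_def sides_def by (simp add: Ball_def) blast
qed

text \<open>A set of edges of the decorated graph is split into the set \<open>R\<close> of its roads and, for each face, the
  set of its city edges. Each vertex lies on one road and two city edges, so the dimer condition
  can be tested in each face separately once \<open>R\<close> is fixed.\<close>

lemma Z_dim_as_vertex_model:
  "Z_dim G (dec_weight a b) =
     (\<Sum>R\<in>Pow (edges G). \<Prod>f\<in>faces G. city_weight (a f) (b f) (at_face f R))"
proof -
  let ?E = "Pow (edges G)" and ?S = "faces G \<rightarrow>\<^sub>E Pow {..<4::nat}"
  let ?ok = "\<lambda>R C f. \<forall>k<4. covered_once (side_edge G (f, k) \<in> R) (k \<in> C f) ((k + 1) mod 4 \<in> C f)"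
  let ?w = "\<lambda>C. \<Prod>f\<in>faces G. \<Prod>k\<in>C f. if odd k then a f else b f"
  define T where "T = (\<lambda>(R, C). Road ` R \<union> (\<Union>f\<in>faces G. City f ` C f))"
  define U where "U m = ({e. Road e \<in> m}, \<lambda>f\<in>faces G. {k. City f k \<in> m})" for m :: "'s dec_edge set"
  have finS: "finite ?S" using finite_faces by (simp add: finite_PiE)
  have T_Road: "Road e \<in> T (R, C) \<longleftrightarrow> e \<in> R" for e R C by (auto simp: T_def)
  have T_City: "City f k \<in> T (R, C) \<longleftrightarrow> k \<in> C f" if "f \<in> faces G" for f k R C
    using that by (auto simp: T_def)
  have T_iff: "T (R, C) \<in> dimer_configs G \<longleftrightarrow> (\<forall>f\<in>faces G. ?ok R C f)" if "R \<in> ?E" "C \<in> ?S" for R C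
  proof -
    have "T (R, C) \<subseteq> dec_edges G"
    proof
      fix q assume "q \<in> T (R, C)"
      then show "q \<in> dec_edges G" using that PiE_mem[OF that(2)]
        by (cases q) (auto simp: T_def dec_edges_def)
    qed
    then show ?thesis unfolding dimer_configs_iff by (simp add: T_Road T_City)
  qed
  have "Z_dim G (dec_weight a b) = (\<Sum>(R, C)\<in>{x \<in> ?E \<times> ?S. \<forall>f\<in>faces G. ?ok (fst x) (snd x) f}. ?w C)"
    unfolding Z_dim_def
  proof (rule sum.reindex_bij_witness[where i = T and j = U])
    fix m assume m: "m \<in> dimer_configs G"
    then have sub: "m \<subseteq> dec_edges G" by (simp add: dimer_configs_def)
    show TU: "T (U m) = m"
    proof (rule set_eqI)
      fix q show "q \<in> T (U m) \<longleftrightarrow> q \<in> m"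
        using sub by (cases q) (auto simp: T_def U_def dec_edges_def)
    qed
    have "fst (U m) \<in> ?E" "snd (U m) \<in> ?S" using sub by (auto simp: U_def dec_edges_def)
    then show Um: "U m \<in> {x \<in> ?E \<times> ?S. \<forall>f\<in>faces G. ?ok (fst x) (snd x) f}"
      using T_iff[of "fst (U m)" "snd (U m)"] TU m by (simp add: mem_Times_iff)
    obtain R C where RC: "U m = (R, C)" by (metis surj_pair)
    then have R: "finite R" and C: "finite (C f)" if "f \<in> faces G" for f
      using Um PiE_mem[of C "faces G" "\<lambda>_. Pow {..<4}" f] finite_edges that 
      by (auto intro: finite_subset)
    have "(\<Prod>q\<in>m. dec_weight a b q) = (\<Prod>q\<in>T (R, C). dec_weight a b q)" using TU RC by simp
    also have "\<dots> = (\<Prod>q\<in>Road ` R. dec_weight a b q) * (\<Prod>q\<in>(\<Union>f\<in>faces G. City f ` C f). dec_weight a b q)"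
      unfolding T_def prod.case using Um RC finite_edges finite_faces C
      by (subst prod.union_disjoint) (auto intro: finite_subset)
    also have "(\<Prod>q\<in>Road ` R. dec_weight a b q) = 1" by (rule prod.neutral) auto
    also have "(\<Prod>q\<in>(\<Union>f\<in>faces G. City f ` C f). dec_weight a b q) =
        (\<Prod>f\<in>faces G. \<Prod>q\<in>City f ` C f. dec_weight a b q)"
      using finite_faces C by (intro prod.UNION_disjoint) auto
    also have "\<dots> = ?w C" by (intro prod.cong refl, subst prod.reindex) (auto simp: inj_on_def)
    finally show "(case U m of (R, C) \<Rightarrow> ?w C) = (\<Prod>q\<in>m. dec_weight a b q)" using RC by simp
  next
    fix x assume "x \<in> {x \<in> ?E \<times> ?S. \<forall>f\<in>faces G. ?ok (fst x) (snd x) f}"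
    then obtain R C where x: "x = (R, C)" "R \<in> ?E" "C \<in> ?S" "\<forall>f\<in>faces G. ?ok R C f" by auto
    show "T x \<in> dimer_configs G" using x T_iff by simp
    have "(\<lambda>f\<in>faces G. {k. City f k \<in> T (R, C)}) = C"
      using x(3) T_City by (intro ext) (auto simp: PiE_def extensional_def)
    then show "U (T x) = x" unfolding U_def x(1) by (simp add: T_Road)
  qed
  also have "\<dots> = (\<Sum>(R, C)\<in>?E \<times> ?S. if \<forall>f\<in>faces G. ?ok R C f then ?w C else 0)"
    using finite_edges finS by (subst sum.inter_filter) (auto simp: case_prod_unfold intro!: sum.cong)
  also have "\<dots> = (\<Sum>R\<in>?E. \<Sum>C\<in>?S. if \<forall>f\<in>faces G. ?ok R C f then ?w C else 0)"
    by (rule sum.cartesian_product[symmetric])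
  also have "\<dots> = (\<Sum>R\<in>?E. \<Prod>f\<in>faces G. city_weight (a f) (b f) (at_face f R))"
  proof (intro sum.cong refl)
    fix R
    have "(\<Prod>f\<in>faces G. city_weight (a f) (b f) (at_face f R)) = (\<Sum>C\<in>?S. \<Prod>f\<in>faces G.
        if \<forall>k<4. covered_once (k \<in> at_face f R) (k \<in> C f) ((k + 1) mod 4 \<in> C f)
        then \<Prod>k\<in>C f. if odd k then a f else b f else 0)"
      unfolding city_weight_def by (rule prod_sum_PiE) (use finite_faces in auto)
    also have "\<dots> = (\<Sum>C\<in>?S. if \<forall>f\<in>faces G. ?ok R C f then ?w C else 0)"
      unfolding prod_if_zero[OF finite_faces] by (simp add: at_face_def)
    finally show "(\<Sum>C\<in>?S. if \<forall>f\<in>faces G. ?ok R C f then ?w C else 0) =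
      (\<Prod>f\<in>faces G. city_weight (a f) (b f) (at_face f R))" by simp
  qed
  finally show ?thesis .
qed

section \<open>The loop model as two dimer models\<close>

text \<open>For fixed \<open>P\<close>, taking the symmetric difference with \<open>P\<close> permutes the sets of edges, so the sum
  over \<open>C\<close> becomes a free sum over the second dimer configuration.\<close>

theorem Z_loop_eq_Z_dim_squared:
  assumes "\<forall>f\<in>faces G. ff_parameters (w f) (l f, a f, b f)"
  shows "Z_loop G w = (\<Prod>f\<in>faces G. l f) * (Z_dim G (dec_weight a b))\<^sup>2"
proof -
  let ?E = "Pow (edges G)"
  define V where "V R = (\<Prod>f\<in>faces G. city_weight (a f) (b f) (at_face f R))" for R
  define D where "D P C = (P - C) \<union> (C - P)" for P C :: "'s set set"
  have at_D: "at_face f (D P C) = (at_face f P - at_face f C) \<union> (at_face f C - at_face f P)" for f P C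
    by (auto simp: at_face_def D_def)
  have "Z_loop G w = (\<Sum>C\<in>?E. \<Sum>P\<in>?E. (\<Prod>f\<in>faces G. l f) * V P * V (D P C))"
  proof -
    have "(\<Prod>f\<in>faces G. local_loop_weight (w f) (at_face f C) (at_face f P)) =
        (\<Prod>f\<in>faces G. l f) * V P * V (D P C)" for C P
      unfolding V_def at_D prod.distrib[symmetric]
    proof (rule prod.cong[OF refl])
      fix f assume "f \<in> faces G"
      then have "ff_parameters (w f) (l f, a f, b f)" using assms by blast
      from local_factorisation[OF this] show "local_loop_weight (w f) (at_face f C) (at_face f P) =
        l f * city_weight (a f) (b f) (at_face f P) *
        city_weight (a f) (b f) (at_face f P - at_face f C \<union> (at_face f C - at_face f P))" .
    qed
    then show ?thesis unfolding Z_loop_as_vertex_model by simp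
  qed
  also have "\<dots> = (\<Sum>P\<in>?E. (\<Prod>f\<in>faces G. l f) * V P * (\<Sum>C\<in>?E. V (D P C)))"
    by (subst sum.swap) (simp add: sum_distrib_left)
  also have "\<dots> = (\<Sum>P\<in>?E. (\<Prod>f\<in>faces G. l f) * V P * (\<Sum>C\<in>?E. V C))"
  proof -
    have "(\<Sum>C\<in>?E. V (D P C)) = (\<Sum>C\<in>?E. V C)" if "P \<in> ?E" for P
      using that by (intro sum.reindex_bij_witness[where i = "D P" and j = "D P"]) (auto simp: D_def)
    then show ?thesis by simp
  qed
  also have "\<dots> = (\<Prod>f\<in>faces G. l f) * (\<Sum>P\<in>?E. V P)\<^sup>2"
    by (simp add: power2_eq_square sum_distrib_right sum_distrib_left mult_ac)
  finally show ?thesis unfolding Z_dim_as_vertex_model V_def .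
qed

end

text \<open>The parameters are forced to be \<open>\<lambda> = w\<^sub>1 + w\<^sub>2\<close>, \<open>a = w\<^sub>3 / \<lambda>\<close> and \<open>b = w\<^sub>4 / \<lambda>\<close>.\<close>

lemma ex1_ff_parameters:
  assumes pos: "\<And>i. i \<in> {1..5} \<Longrightarrow> 0 < w i" and ff: "free_fermionic w"
  shows "\<exists>!p. ff_parameters w p"
proof -
  have w: "0 < w 1" "0 < w 2" "0 < w 3" "0 < w 4" "0 < w 5" using pos by auto
  have e: "w 1 * w 4 = w 3 * w 5" "w 2 * w 3 = w 4 * w 5" "w 5 * (w 1 + w 2) = w 3 * w 4"
    using ff by (auto simp: free_fermionic_def)
  define l where "l = w 1 + w 2"
  have l: "0 < l" using w by (simp add: l_def)
  have "w 4 * (w 1 * l) = w 4 * (w 3)\<^sup>2" using e by (simp add: l_def power2_eq_square) algebra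
  then have 1: "w 1 * l = (w 3)\<^sup>2" using w by simp
  have "w 3 * (w 2 * l) = w 3 * (w 4)\<^sup>2" using e by (simp add: l_def power2_eq_square) algebra
  then have 2: "w 2 * l = (w 4)\<^sup>2" using w by simp
  have 5: "w 5 * l = w 3 * w 4" using e(3) by (simp add: l_def)
  have "(w 3)\<^sup>2 + (w 4)\<^sup>2 = l\<^sup>2"
    using 1 2 by (simp add: l_def power2_eq_square algebra_simps)
  then have sq: "(w 3 / l)\<^sup>2 + (w 4 / l)\<^sup>2 = 1"
    using l by (simp add: power_divide add_divide_distrib[symmetric])
  show ?thesis
  proof (rule ex1I[of _ "(l, w 3 / l, w 4 / l)"])
    show "ff_parameters w (l, w 3 / l, w 4 / l)"
    proof -
      have "w 1 = l * (w 3 / l)\<^sup>2" "w 2 = l * (w 4 / l)\<^sup>2" "w 5 = l * (w 3 / l) * (w 4 / l)"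
        using l 1 2 5 by (simp_all add: field_simps power2_eq_square)
      then show ?thesis using l w sq by (simp add: ff_parameters_def)
    qed
  next
    fix p assume p: "ff_parameters w p"
    obtain l' a b where p': "p = (l', a, b)" by (metis prod_cases3)
    have q: "0 < l'" "a\<^sup>2 + b\<^sup>2 = 1" "w 1 = l' * a\<^sup>2" "w 2 = l' * b\<^sup>2" "w 3 = l' * a" "w 4 = l' * b"
      using p unfolding p' by (auto simp: ff_parameters_def)
    have "l = l'" unfolding l_def q(3,4) using q(2) by (metis distrib_left mult.right_neutral)
    then show "p = (l, w 3 / l, w 4 / l)" unfolding p' q(5,6) using q(1) by simp
  qed
qed

section \<open>Orientation and winding numbers in the plane\<close>

lemma path_circlepath_compose:
  assumes "continuous_on (cball z r) g" "0 < r"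
  shows "path (g \<circ> circlepath z r)"
  using assms by (intro path_continuous_image) (auto intro: continuous_on_subset)

text \<open>The fundamental group of a punctured disk is infinite cyclic and classified by the winding number,
  so a loop that winds once around \<open>z\<close> may be deformed into the circle. The deformation in the
  punctured plane is pushed into the disk by a radial retraction \<open>\<rho>\<close>, so that \<open>g\<close> can be applied.\<close>

lemma winding_number_inj_image_loop:
  assumes g: "continuous_on (cball z r) g" "inj_on g (cball z r)" and r: "0 < r"
    and \<gamma>: "path \<gamma>" "pathfinish \<gamma> = pathstart \<gamma>" "path_image \<gamma> \<subseteq> cball z r - {z}"
    and w: "winding_number \<gamma> z = 1"
  shows "winding_number (g \<circ> \<gamma>) (g z) = winding_number (g \<circ> circlepath z r) (g z)"
proof -
  define \<rho> where "\<rho> w = z + of_real (min 1 (r / cmod (w - z))) * (w - z)" for w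
  have \<rho>_in: "\<rho> w \<in> cball z r - {z}" if "w \<noteq> z" for w
  proof -
    have m: "0 < min 1 (r / cmod (w - z))" "min 1 (r / cmod (w - z)) \<le> r / cmod (w - z)" using that r by auto
    have "cmod (\<rho> w - z) = min 1 (r / cmod (w - z)) * cmod (w - z)"
      using m(1) by (simp add: \<rho>_def norm_mult)
    also have "\<dots> \<le> r / cmod (w - z) * cmod (w - z)" using m(2) by (intro mult_right_mono) auto
    also have "\<dots> = r" using that by simp
    finally have "dist z (\<rho> w) \<le> r" by (simp add: dist_norm norm_minus_commute)
    moreover have "\<rho> w \<noteq> z" using m(1) that by (simp add: \<rho>_def)
    ultimately show ?thesis by simp
  qed
  have \<rho>_id: "\<rho> w = w" if "w \<in> cball z r - {z}" for w
  proof -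
    have "1 \<le> r / cmod (w - z)" using that by (auto simp: dist_norm norm_minus_commute field_simps)
    then show ?thesis by (simp add: \<rho>_def min_def)
  qed
  have cont\<rho>: "continuous_on (-{z}) \<rho>" unfolding \<rho>_def by (intro continuous_intros) auto
  have "\<rho> ` (-{z}) \<subseteq> cball z r" using \<rho>_in by blast
  then have "continuous_on (\<rho> ` (-{z})) g" by (rule continuous_on_subset[OF g(1)])
  then have cont: "continuous_on (-{z}) (g \<circ> \<rho>)" using cont\<rho> by (rule continuous_on_compose[rotated])
  have maps: "g \<circ> \<rho> \<in> -{z} \<rightarrow> -{g z}"
  proof
    fix w assume "w \<in> -{z}"
    then have "\<rho> w \<in> cball z r" "\<rho> w \<noteq> z" using \<rho>_in[of w] by auto
    moreover have "z \<in> cball z r" using r by simp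
    ultimately show "(g \<circ> \<rho>) w \<in> -{g z}" using inj_onD[OF g(2), of "\<rho> w" z] by auto
  qed
  have "homotopic_loops (-{z}) \<gamma> (circlepath z r)"
  proof (rule winding_number_homotopic_loops_eq[THEN iffD1])
    show "z \<notin> path_image \<gamma>" using \<gamma>(3) by blast
    show "winding_number \<gamma> z = winding_number (circlepath z r) z"
      using w r by (simp add: winding_number_circlepath_centre)
  qed (use \<gamma> r in simp_all)
  then have "homotopic_loops (-{g z}) ((g \<circ> \<rho>) \<circ> \<gamma>) ((g \<circ> \<rho>) \<circ> circlepath z r)"
    using cont maps by (rule homotopic_loops_continuous_image)
  then have "winding_number ((g \<circ> \<rho>) \<circ> \<gamma>) (g z) = winding_number ((g \<circ> \<rho>) \<circ> circlepath z r) (g z)"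
    by (rule winding_number_homotopic_loops)
  moreover have "winding_number ((g \<circ> \<rho>) \<circ> \<gamma>) (g z) = winding_number (g \<circ> \<gamma>) (g z)"
  proof (rule winding_number_cong)
    fix t :: real assume "0 \<le> t" "t \<le> 1"
    then have "\<gamma> t \<in> path_image \<gamma>" by (simp add: path_image_def)
    then have "\<gamma> t \<in> cball z r - {z}" using \<gamma>(3) by blast
    from \<rho>_id[OF this] show "((g \<circ> \<rho>) \<circ> \<gamma>) t = (g \<circ> \<gamma>) t" by simp
  qed
  moreover have "(g \<circ> \<rho>) \<circ> circlepath z r = g \<circ> circlepath z r"
  proof
    fix t
    have "circlepath z r t \<in> cball z r - {z}" using r by (simp add: circlepath dist_norm norm_mult)
    from \<rho>_id[OF this] show "((g \<circ> \<rho>) \<circ> circlepath z r) t = (g \<circ> circlepath z r) t" by simp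
  qed
  ultimately show ?thesis by simp
qed

lemma orientation_preserving_onD:
  assumes "orientation_preserving_on U g" "cball z r \<subseteq> U" "0 < r"
  shows "continuous_on (cball z r) g" "inj_on g (cball z r)" "winding_number (g \<circ> circlepath z r) (g z) = 1"
proof -
  have g: "continuous_on U g" "inj_on g U"
    "\<forall>z r. 0 < r \<and> cball z r \<subseteq> U \<longrightarrow> winding_number (g \<circ> circlepath z r) (g z) = 1"
    using assms(1) unfolding orientation_preserving_on_def by simp_all
  show "continuous_on (cball z r) g" using g(1) assms(2) by (rule continuous_on_subset)
  show "inj_on g (cball z r)" using g(2) assms(2) by (rule inj_on_subset)
  show "winding_number (g \<circ> circlepath z r) (g z) = 1" using g(3) assms(2,3) by blast
qed

lemma orientation_preserving_on_subset:
  "orientation_preserving_on U g \<Longrightarrow> V \<subseteq> U \<Longrightarrow> orientation_preserving_on V g"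
  unfolding orientation_preserving_on_def by (meson continuous_on_subset inj_on_subset order_trans)

text \<open>The image under \<open>f\<close> of a circle need not lie in a round disk contained in \<open>V\<close>. Shrinking the
  circle, which does not change the winding number, brings it into one.\<close>

lemma orientation_preserving_on_compose:
  assumes f: "orientation_preserving_on U f" and g: "orientation_preserving_on V g"
    and V: "open V" "f ` U \<subseteq> V"
  shows "orientation_preserving_on U (g \<circ> f)"
  unfolding orientation_preserving_on_def
proof (intro conjI allI impI)
  have cf: "continuous_on U f" "inj_on f U" and cg: "continuous_on V g" "inj_on g V"
    and wf: "\<And>z r. 0 < r \<Longrightarrow> cball z r \<subseteq> U \<Longrightarrow> winding_number (f \<circ> circlepath z r) (f z) = 1"
    and wg: "\<And>z r. 0 < r \<Longrightarrow> cball z r \<subseteq> V \<Longrightarrow> winding_number (g \<circ> circlepath z r) (g z) = 1"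
    using f g by (auto simp: orientation_preserving_on_def)
  show c: "continuous_on U (g \<circ> f)"
    using cf cg V by (blast intro: continuous_on_compose continuous_on_subset)
  show i: "inj_on (g \<circ> f) U" using cf cg V by (meson comp_inj_on inj_on_subset)
  fix z r assume zr: "0 < r \<and> cball z r \<subseteq> U"
  then have r: "0 < r" and sub: "cball z r \<subseteq> U" by auto
  have zU: "z \<in> U" using r sub by (auto simp: subset_iff)
  obtain \<rho> where \<rho>: "0 < \<rho>" "cball (f z) \<rho> \<subseteq> V"
    using V zU open_contains_cball by (metis image_subset_iff)
  have "continuous_on (cball z r) f" using cf sub continuous_on_subset by blast
  then obtain d where d: "0 < d" "\<And>w. w \<in> cball z r \<Longrightarrow> dist w z < d \<Longrightarrow> dist (f w) (f z) < \<rho>"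
    using r \<rho>(1) unfolding continuous_on_iff by (metis centre_in_cball less_imp_le)
  \<comment> \<open>a radius small enough for the image to lie in the round disk\<close>
  define s where "s = min r (d / 2)"
  have s: "0 < s" "s \<le> r" "s < d" using r d by (auto simp: s_def)
  have sph: "sphere z s \<subseteq> cball z r - {z}" using s by auto
  have fs: "f ` sphere z s \<subseteq> cball (f z) \<rho> - {f z}"
  proof clarify
    fix w assume w: "w \<in> sphere z s"
    then have "w \<in> U" "w \<noteq> z" using sph sub by auto
    then have "f w \<noteq> f z" using cf zU by (auto simp: inj_on_def)
    moreover have "dist (f w) (f z) < \<rho>" using d(2)[of w] w s by (auto simp: dist_commute)
    ultimately show "f w \<in> cball (f z) \<rho> - {f z}" by (auto simp: dist_commute)
  qed
  have cs: "cball z s \<subseteq> U" using s sub by auto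
  have "winding_number (g \<circ> f \<circ> circlepath z r) ((g \<circ> f) z) = winding_number (g \<circ> f \<circ> circlepath z s) ((g \<circ> f) z)"
    using c i sub r s sph
    by (intro winding_number_inj_image_loop[symmetric])
       (auto intro: continuous_on_subset inj_on_subset simp: winding_number_circlepath_centre)
  also have "\<dots> = winding_number (g \<circ> (f \<circ> circlepath z s)) (g (f z))" by (simp add: comp_assoc)
  also have "\<dots> = winding_number (g \<circ> circlepath (f z) \<rho>) (g (f z))"
  proof (rule winding_number_inj_image_loop)
    show "continuous_on (cball (f z) \<rho>) g" "inj_on g (cball (f z) \<rho>)" 
      using cg \<rho> by (auto intro: continuous_on_subset inj_on_subset)
    show "path (f \<circ> circlepath z s)"
      using cf cs s by (intro path_circlepath_compose) (auto intro: continuous_on_subset)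
    show "path_image (f \<circ> circlepath z s) \<subseteq> cball (f z) \<rho> - {f z}"
      using fs s by (simp add: path_image_compose)
    show "winding_number (f \<circ> circlepath z s) (f z) = 1" using wf s cs by blast
  qed (use \<rho> in \<open>auto simp: pathfinish_compose pathstart_compose\<close>)
  also have "\<dots> = 1" using wg \<rho> by blast
  finally show "winding_number (g \<circ> f \<circ> circlepath z r) ((g \<circ> f) z) = 1" .
qed

lemma winding_number_rotated_circle:
  assumes "d \<noteq> 0"
  shows "winding_number (\<lambda>t. exp (2 * of_real pi * \<i> * of_real t) * d) 0 = 1"
proof -
  define p where "p t = Ln d + 2 * of_real pi * \<i> * of_real t" for t :: real
  have "path p" unfolding path_def p_def by (intro continuous_intros)
  then have "winding_number (exp \<circ> p) 0 = (pathfinish p - pathstart p) / (2 * of_real pi * \<i>)"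
    by (rule winding_number_compose_exp)
  also have "\<dots> = 1" by (simp add: pathfinish_def pathstart_def p_def)
  finally have "winding_number (exp \<circ> p) 0 = 1" .
  moreover have "exp \<circ> p = (\<lambda>t. exp (2 * of_real pi * \<i> * of_real t) * d)"
    using assms by (auto simp: p_def exp_add)
  ultimately show ?thesis by simp
qed

text \<open>Writing \<open>f w - f z = (w - z) q w\<close> with \<open>q\<close> continuous and without zeros, the image of a circle
  around \<open>z\<close> is deformed, by contracting only the argument of \<open>q\<close>, into a circle multiplied by the
  constant \<open>q z\<close>.\<close>

lemma holomorphic_inj_orientation_preserving_on:
  assumes f: "f holomorphic_on U" and U: "open U" and inj: "inj_on f U"
  shows "orientation_preserving_on U f"
  unfolding orientation_preserving_on_def
proof (intro conjI allI impI)
  fix z r assume "0 < r \<and> cball z r \<subseteq> U"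
  then have r: "0 < r" and sub: "cball z r \<subseteq> U" by auto
  then have z: "z \<in> U" by auto
  define q where "q w = (if w = z then deriv f z else (f w - f z) / (w - z))" for w
  have "q holomorphic_on U" unfolding q_def by (rule pole_lemma_open[OF f U])
  then have q: "continuous_on (cball z r) q"
    using sub holomorphic_on_imp_continuous_on continuous_on_subset by blast
  have q0: "q w \<noteq> 0" if "w \<in> U" for w
    using that z inj holomorphic_injective_imp_regular[OF f U inj z] by (auto simp: q_def inj_on_def)
  define c where "c t = exp (2 * of_real pi * \<i> * of_real t)" for t :: real
  have c: "cmod (c t) = 1" for t by (simp add: c_def)
  \<comment> \<open>the homotopy contracts the argument of \<open>q\<close> to \<open>z\<close>\<close>
  define h where "h x = c (snd x) * (of_real r * q (z + of_real ((1 - fst x) * r) * c (snd x)))" for x :: "real \<times> real"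
  have in_ball: "z + of_real ((1 - u) * r) * c t \<in> cball z r" if "u \<in> {0..1}" for u t
  proof -
    have "(1 - u) * r \<le> 1 * r" using that r by (intro mult_right_mono) auto
    moreover have "cmod (of_real ((1 - u) * r) * c t) = (1 - u) * r"
      using that r unfolding norm_mult c norm_of_real by simp
    ultimately show ?thesis by (simp add: dist_norm)
  qed
  have conth: "continuous_on ({0..1} \<times> {0..1}) h"
    unfolding h_def c_def
    by (intro continuous_intros continuous_on_compose2[OF q]) 
       (use in_ball in \<open>auto simp: c_def mult_ac\<close>)
  have "winding_number (f \<circ> circlepath z r) (f z) = winding_number (\<lambda>t. (f \<circ> circlepath z r) t - f z) 0"
    by (rule winding_number_offset)
  also have "\<dots> = winding_number (\<lambda>t. h (0, t)) 0"
  proof (rule winding_number_cong)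
    fix t show "(f \<circ> circlepath z r) t - f z = h (0, t)"
      using r by (simp add: h_def c_def circlepath q_def)
  qed
  also have "\<dots> = winding_number (\<lambda>t. h (1, t)) 0"
  proof (rule winding_number_homotopic_loops)
    have "h \<in> {0..1} \<times> {0..1} \<rightarrow> -{0}"
      using in_ball q0 sub r by (auto simp: h_def c_def subset_iff)
    moreover have "c 1 = c 0" by (simp add: c_def)
    ultimately show "homotopic_loops (-{0}) (\<lambda>t. h (0, t)) (\<lambda>t. h (1, t))"
      unfolding homotopic_loops using conth
      by (intro exI[of _ h]) (auto simp: pathfinish_def pathstart_def h_def)
  qed
  also have "\<dots> = 1"
    using winding_number_rotated_circle[of "of_real r * q z"] q0[OF z] r by (simp add: h_def c_def)
  finally show "winding_number (f \<circ> circlepath z r) (f z) = 1" .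
qed (use assms in \<open>auto intro: holomorphic_on_imp_continuous_on\<close>)

text \<open>This is the change of coordinates between the two parametrisations of a common edge. In each
  coordinate separately, the displacement from the centre keeps its sign, so the image of a
  circle can be deformed linearly into a circle without meeting the centre.\<close>

lemma orientation_preserving_on_reparametrised_real_part:
  assumes cont: "continuous_on {a<..<b} \<tau>" and mono: "strict_mono_on {a<..<b} \<tau>"
  shows "orientation_preserving_on {w. a < Re w \<and> Re w < b} (\<lambda>w. Complex (\<tau> (Re w)) (Im w))"
    (is "orientation_preserving_on ?U ?g")
  unfolding orientation_preserving_on_def
proof (intro conjI allI impI)
  have inj: "inj_on \<tau> {a<..<b}" using mono by (rule strict_mono_on_imp_inj_on)
  show contg: "continuous_on ?U ?g"
    unfolding Complex_eq by (intro continuous_intros continuous_on_compose2[OF cont]) auto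
  show "inj_on ?g ?U"
    using inj by (auto simp: inj_on_def complex_eq_iff)
  fix z r assume "0 < r \<and> cball z r \<subseteq> ?U"
  then have r: "0 < r" and sub: "cball z r \<subseteq> ?U" by auto
  have "winding_number (?g \<circ> circlepath z r) (?g z) = winding_number (circlepath (?g z) r) (?g z)"
  proof (rule winding_number_loops_linear_eq)
    show "path (?g \<circ> circlepath z r)"
      using contg sub r by (intro path_circlepath_compose) (auto intro: continuous_on_subset)
    fix t :: real
    define w where "w = circlepath z r t"
    have "dist z w = r" using r by (simp add: w_def circlepath dist_norm norm_mult)
    then have "w \<in> cball z r" "w \<noteq> z" using r by auto
    then have w: "w \<in> ?U" "w \<noteq> z" using sub by blast+
    have z: "z \<in> ?U" using sub r by (auto simp: subset_iff)
    have c: "circlepath (?g z) r t = ?g z + (w - z)" by (simp add: w_def circlepath)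
    show "?g z \<notin> closed_segment (circlepath (?g z) r t) ((?g \<circ> circlepath z r) t)"
    proof
      assume "?g z \<in> closed_segment (circlepath (?g z) r t) ((?g \<circ> circlepath z r) t)"
      then obtain u where u: "0 \<le> u" "u \<le> 1"
        and eq: "?g z = (1 - u) *\<^sub>R (?g z + (w - z)) + u *\<^sub>R ?g w"
        unfolding closed_segment_def c by (auto simp: w_def)
      have im: "Im w = Im z" using arg_cong[OF eq, of Im] by (simp add: algebra_simps)
      have re: "(1 - u) * (Re w - Re z) + u * (\<tau> (Re w) - \<tau> (Re z)) = 0"
        using arg_cong[OF eq, of Re] by (simp add: algebra_simps)
      have "Re w < Re z \<or> Re z < Re w" using im w(2) by (auto simp: complex_eq_iff)
      then show False
      proof
        assume l: "Re w < Re z"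
        then have "\<tau> (Re w) < \<tau> (Re z)" using mono w z by (auto simp: strict_mono_on_def)
        then have "(1 - u) * (Re w - Re z) + u * (\<tau> (Re w) - \<tau> (Re z)) < 0"
          using u l by (cases "u = 0") (auto intro!: add_nonpos_neg mult_nonneg_nonpos mult_pos_neg)
        then show False using re by simp
      next
        assume l: "Re z < Re w"
        then have "\<tau> (Re z) < \<tau> (Re w)" using mono w z by (auto simp: strict_mono_on_def)
        then have "(1 - u) * (Re w - Re z) + u * (\<tau> (Re w) - \<tau> (Re z)) > 0"
          using u l by (cases "u = 0") (auto intro!: add_nonneg_pos mult_nonneg_nonneg mult_pos_pos)
        then show False using re by simp
      qed
    qed
  qed (auto simp: pathfinish_compose pathstart_compose)
  also have "\<dots> = 1" using r by (rule winding_number_circlepath_centre)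
  finally show "winding_number (?g \<circ> circlepath z r) (?g z) = 1" .
qed

text \<open>The local degree of an injective map is locally constant, since the image of a moving circle never
  meets the image of its moving centre.\<close>

lemma winding_number_moved_circle:
  assumes H: "continuous_on D H" "inj_on H D" and D: "convex D"
    and "0 < r" "cball z r \<subseteq> D" "cball z' r \<subseteq> D"
  shows "winding_number (H \<circ> circlepath z r) (H z) = winding_number (H \<circ> circlepath z' r) (H z')"
proof -
  define c where "c t = of_real r * exp (2 * of_real pi * \<i> * of_real t)" for t :: real
  have c: "cmod (c t) = r" for t using \<open>0 < r\<close> by (simp add: c_def norm_mult)
  \<comment> \<open>the centre of the moving circle\<close>
  define m where "m u = (1 - u) *\<^sub>R z + u *\<^sub>R z'" for u :: real
  define h where "h x = H (m (fst x) + c (snd x)) - H (m (fst x))" for x :: "real \<times> real"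
  have mD: "m u + d \<in> D" if "u \<in> {0..1}" "cmod d \<le> r" for u d
  proof -
    have "z + d \<in> D" "z' + d \<in> D" using assms(5,6) that by (auto simp: subset_iff dist_norm)
    then have "(1 - u) *\<^sub>R (z + d) + u *\<^sub>R (z' + d) \<in> D"
      using D that by (auto simp: convex_alt)
    then show ?thesis by (simp add: m_def algebra_simps)
  qed
  have mD0: "m u \<in> D" if "u \<in> {0..1}" for u using mD[OF that, of 0] \<open>0 < r\<close> by simp
  have h: "continuous_on ({0..1} \<times> {0..1}) h"
    unfolding h_def
    by (intro continuous_intros continuous_on_compose2[OF H(1)])
       (use mD mD0 c in \<open>auto simp: m_def c_def intro!: continuous_intros\<close>)
  have h0: "h \<in> {0..1} \<times> {0..1} \<rightarrow> -{0}"
  proof clarify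
    fix u t :: real assume u: "u \<in> {0..1}" "h (u, t) = 0"
    then have "H (m u + c t) = H (m u)" by (simp add: h_def)
    then have "m u + c t = m u" using c by (intro inj_onD[OF H(2) _ mD[OF u(1)] mD0[OF u(1)]]) simp_all
    then show False using c[of t] \<open>0 < r\<close> by simp
  qed
  have "winding_number (H \<circ> circlepath z r) (H z) = winding_number (\<lambda>t. (H \<circ> circlepath z r) t - H z) 0"
    by (rule winding_number_offset)
  also have "(\<lambda>t. (H \<circ> circlepath z r) t - H z) = (\<lambda>t. h (0, t))"
    by (simp add: h_def m_def c_def circlepath)
  also have "winding_number (\<lambda>t. h (0, t)) 0 = winding_number (\<lambda>t. h (1, t)) 0"
  proof (rule winding_number_homotopic_loops)
    have "c 1 = c 0" by (simp add: c_def)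
    then show "homotopic_loops (-{0}) (\<lambda>t. h (0, t)) (\<lambda>t. h (1, t))"
      unfolding homotopic_loops using h h0
      by (intro exI[of _ h]) (auto simp: pathfinish_def pathstart_def h_def)
  qed
  also have "(\<lambda>t. h (1, t)) = (\<lambda>t. (H \<circ> circlepath z' r) t - H z')"
    by (simp add: h_def m_def c_def circlepath)
  also have "winding_number (\<lambda>t. (H \<circ> circlepath z' r) t - H z') 0 = winding_number (H \<circ> circlepath z' r) (H z')"
    by (rule winding_number_offset[symmetric])
  finally show ?thesis .
qed

lemma circlepath_cnj: "cnj \<circ> circlepath z r = reversepath (circlepath (cnj z) r)"
proof
  fix t :: real
  have "exp (2 * of_real pi * \<i> * of_real (1 - t)) = exp (2 * of_real pi * \<i>) * exp (- (2 * of_real pi * \<i> * of_real t))"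
    unfolding exp_add[symmetric] by (simp add: algebra_simps)
  then show "(cnj \<circ> circlepath z r) t = reversepath (circlepath (cnj z) r) t"
    by (simp add: circlepath reversepath_def exp_cnj)
qed

section \<open>Injective continuous maps into a surface\<close>

lemma chart:
  assumes "oriented_closed_surface S A" "(U, h) \<in> A"
  shows "openin (top_of_set S) U" "open (h ` U)" "\<exists>k. homeomorphism U (h ` U) h k"
    "continuous_on U h" "inj_on h U"
proof -
  show *: "openin (top_of_set S) U" "open (h ` U)" "\<exists>k. homeomorphism U (h ` U) h k"
    using assms unfolding oriented_closed_surface_def by auto
  then show "continuous_on U h" "inj_on h U"
    by (auto dest: homeomorphism_cont1 simp: homeomorphism_def intro: inj_on_inverseI)
qed

lemma obtain_chart:
  assumes "oriented_closed_surface S A" "x \<in> S"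
  obtains U h where "(U, h) \<in> A" "x \<in> U"
  using assms unfolding oriented_closed_surface_def by blast

lemma openin_continuous_preimage:
  assumes "open D" "continuous_on D \<Phi>" "\<Phi> ` D \<subseteq> S" "openin (top_of_set S) U"
  shows "open {w \<in> D. \<Phi> w \<in> U}"
proof -
  obtain T where T: "open T" "U = S \<inter> T" using assms(4) by (auto simp: openin_open)
  have "{w \<in> D. \<Phi> w \<in> U} = D \<inter> \<Phi> -` T" using assms(3) T by auto
  then show ?thesis using continuous_open_preimage[OF assms(2,1) T(1)] by simp
qed

text \<open>Invariance of domain, read in charts.\<close>

lemma openin_surface_image:
  fixes \<Phi> :: "complex \<Rightarrow> 's::t2_space"
  assumes S: "oriented_closed_surface S A" and D: "open D"
    and \<Phi>: "continuous_on D \<Phi>" "inj_on \<Phi> D" "\<Phi> ` D \<subseteq> S"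
  shows "openin (top_of_set S) (\<Phi> ` D)"
proof (subst openin_subopen, clarify)
  fix c assume c: "c \<in> D"
  then obtain U h where U: "(U, h) \<in> A" "\<Phi> c \<in> U" using obtain_chart[OF S] \<Phi>(3) by blast
  note ch = chart[OF S U(1)]
  define D' where "D' = {w \<in> D. \<Phi> w \<in> U}"
  have D': "open D'" "D' \<subseteq> D" "\<Phi> ` D' \<subseteq> U"
    using openin_continuous_preimage[OF D \<Phi>(1,3) ch(1)] by (auto simp: D'_def)
  have cont: "continuous_on D' (h \<circ> \<Phi>)"
    by (rule continuous_on_compose[OF continuous_on_subset[OF \<Phi>(1) D'(2)] continuous_on_subset[OF ch(4) D'(3)]])
  have "inj_on (h \<circ> \<Phi>) D'" 
    by (rule comp_inj_on[OF inj_on_subset[OF \<Phi>(2) D'(2)] inj_on_subset[OF ch(5) D'(3)]])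
  then have "open ((h \<circ> \<Phi>) ` D')" by (rule invariance_of_domain[OF cont D'(1)])
  then have "openin (top_of_set U) (U \<inter> h -` ((h \<circ> \<Phi>) ` D'))"
    using ch(4) by (intro continuous_openin_preimage_gen)
  moreover have "U \<inter> h -` ((h \<circ> \<Phi>) ` D') = \<Phi> ` D'"
  proof (intro equalityI subsetI)
    fix x assume "x \<in> U \<inter> h -` ((h \<circ> \<Phi>) ` D')"
    then obtain w where w: "x \<in> U" "w \<in> D'" "h x = h (\<Phi> w)" by auto
    then have "x = \<Phi> w" using D'(3) by (intro inj_onD[OF ch(5)]) auto
    then show "x \<in> \<Phi> ` D'" using w(2) by simp
  qed (use D'(3) in auto)
  ultimately have "openin (top_of_set S) (\<Phi> ` D')" using openin_trans[OF _ ch(1)] by simp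
  then show "\<exists>T. openin (top_of_set S) T \<and> \<Phi> c \<in> T \<and> T \<subseteq> \<Phi> ` D"
    using c U(2) D'(2) by (intro exI[of _ "\<Phi> ` D'"]) (auto simp: D'_def)
qed

text \<open>A boundary point of a half plane does not become an interior point of the surface: the inverse map,
  read in a chart, would be an injective continuous map of an open set of the plane, hence open,
  and its image would contain points beyond the boundary line.\<close>

lemma half_plane_image_not_neighbourhood:
  fixes F :: "complex \<Rightarrow> 's::t2_space"
  assumes S: "oriented_closed_surface S A"
    and K: "compact K" "K \<subseteq> {w. Im w \<le> 0}" and F: "continuous_on K F" "inj_on F K"
    and c: "c \<in> K" "Im c = 0" and W: "openin (top_of_set S) W" "F c \<in> W" "W \<subseteq> F ` K"
  shows False
proof -
  have "F c \<in> S" using openin_imp_subset[OF W(1)] W(2) by blast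
  then obtain U h where U: "(U, h) \<in> A" "F c \<in> U" using obtain_chart[OF S] by blast
  note ch = chart[OF S U(1)]
  obtain k where k: "homeomorphism U (h ` U) h k" using ch(3) by blast
  obtain g where g: "homeomorphism K (F ` K) F g"
    using homeomorphism_compact[OF K(1) F(1) refl F(2)] by blast
  define N where "N = h ` (U \<inter> W)"
  have "openin (top_of_set U) (U \<inter> W)"
    by (rule openin_subset_trans[OF openin_Int[OF ch(1) W(1)] inf_le1 openin_imp_subset[OF ch(1)]])
  then have "openin (top_of_set (h ` U)) N"
    unfolding N_def by (rule homeomorphism_imp_open_map[OF k])
  then have N: "open N" by (rule openin_open_trans[OF _ ch(2)])
  have kh: "k (h x) = x" if "x \<in> U" for x using homeomorphism_apply1[OF k that] .
  have gF: "g (F w) = w" if "w \<in> K" for w using homeomorphism_apply1[OF g that] .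
  have Fg: "F (g x) = x" if "x \<in> F ` K" for x using homeomorphism_apply2[OF g that] .
  have kN: "k ` N = U \<inter> W" unfolding N_def image_image using kh by simp
  have NU: "N \<subseteq> h ` U" unfolding N_def by blast
  have kNF: "k ` N \<subseteq> F ` K" using W(3) unfolding kN by blast
  have cont: "continuous_on N (g \<circ> k)"
    by (rule continuous_on_compose[OF continuous_on_subset[OF homeomorphism_cont2[OF k] NU]
      continuous_on_subset[OF homeomorphism_cont2[OF g] kNF]])
  have "inj_on k N" using homeomorphism_apply2[OF k] NU by (intro inj_on_inverseI[where g = h]) blast
  moreover have "inj_on g (k ` N)" using Fg kNF by (intro inj_on_inverseI[where g = F]) blast
  ultimately have "open ((g \<circ> k) ` N)" by (intro invariance_of_domain[OF cont N] comp_inj_on)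
  moreover have "c \<in> (g \<circ> k) ` N"
  proof -
    have "g (k (h (F c))) = c" using kh[OF U(2)] gF[OF c(1)] by simp
    moreover have "h (F c) \<in> N" using U(2) W(2) by (simp add: N_def)
    ultimately show ?thesis unfolding image_comp[symmetric] by (metis imageI)
  qed
  ultimately obtain \<epsilon> where \<epsilon>: "0 < \<epsilon>" "ball c \<epsilon> \<subseteq> (g \<circ> k) ` N" by (meson openE)
  have "(g \<circ> k) ` N \<subseteq> K" using kNF gF unfolding image_comp[symmetric] by fastforce
  moreover have "c + \<i> * of_real (\<epsilon> / 2) \<in> ball c \<epsilon>" using \<epsilon>(1) by (simp add: dist_norm norm_mult)
  ultimately have "Im (c + \<i> * of_real (\<epsilon> / 2)) \<le> 0" using \<epsilon>(2) K(2) by blast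
  then show False using \<epsilon>(1) c(2) by simp
qed

section \<open>Half-plane coordinates along the boundary of a face\<close>

text \<open>Logarithmic polar coordinates on the closed disk. The closed lower half plane is mapped onto the
  closed disk without its centre, the real line runs clockwise along the unit circle, and the
  unit interval starting at \<open>k\<close> is the side number \<open>k\<close> with its corners. The map is holomorphic,
  hence preserves the orientation.\<close>

definition clockwise :: "complex \<Rightarrow> complex" where
  "clockwise w = exp (- (\<i> * of_real (pi / 2)) * w)"

lemma clockwise_of_real: "clockwise (of_real t) = cis (- (pi / 2) * t)"
  unfolding clockwise_def cis_conv_exp by (simp add: mult_ac)

lemma disk_corner_clockwise: "disk_corner k = clockwise (of_nat k)"
  using clockwise_of_real[of "real k"] by (simp add: disk_corner_def)

lemma disk_side_clockwise: "disk_side k = (\<lambda>t. clockwise (of_real t + of_nat k)) ` {0<..<1}"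
proof -
  have "disk_side k = (\<lambda>t. clockwise (of_real t)) ` {real k<..<real k + 1}"
    unfolding disk_side_def clockwise_of_real by auto
  also have "{real k<..<real k + 1} = (\<lambda>t. t + real k) ` {0<..<1}"
  proof (intro equalityI subsetI)
    fix t assume "t \<in> {real k<..<real k + 1}"
    then show "t \<in> (\<lambda>t. t + real k) ` {0<..<1}" by (intro image_eqI[of _ _ "t - real k"]) auto
  qed auto
  finally show ?thesis by (simp add: image_image)
qed

lemma norm_clockwise: "cmod (clockwise w) = exp (pi / 2 * Im w)"
  by (simp add: clockwise_def)

lemma holomorphic_clockwise: "(\<lambda>w. clockwise (w + a)) holomorphic_on S"
  unfolding clockwise_def by (intro holomorphic_intros)

lemma continuous_on_clockwise [continuous_intros]:
  "continuous_on S f \<Longrightarrow> continuous_on S (\<lambda>x. clockwise (f x))"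
  unfolding clockwise_def by (intro continuous_intros)

lemma clockwise_eqD:
  assumes "clockwise (w + of_nat k) = clockwise (w' + of_nat k')" "k < 4" "k' < 4"
    and "0 < Re w" "Re w < 1" "0 < Re w'" "Re w' < 1"
  shows "k = k'" "w = w'"
proof -
  obtain n :: int where n: "- (\<i> * of_real (pi / 2)) * (w + of_nat k) =
      - (\<i> * of_real (pi / 2)) * (w' + of_nat k') + of_int (2 * n) * pi * \<i>"
    using assms(1) unfolding clockwise_def exp_eq by blast
  have "(w + of_nat k) - (w' + of_nat k') = - 4 * of_int n"
  proof -
    have "\<i> * of_real (pi / 2) * ((w + of_nat k) - (w' + of_nat k') + 4 * of_int n) = 0"
      using n by (simp add: algebra_simps)
    then show ?thesis by (simp add: add_eq_0_iff)
  qed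
  then have eq: "w - w' = of_int (int k' - int k - 4 * n)" by (simp add: algebra_simps)
  then have "Re w - Re w' = of_int (int k' - int k - 4 * n)" by (metis Re_complex_of_real minus_complex.sel(1) of_real_of_int_eq)
  then have "\<bar>of_int (int k' - int k - 4 * n)\<bar> < (1::real)" using assms by linarith
  then have 0: "int k' - int k - 4 * n = 0" by linarith
  then show "k = k'" using assms(2,3) by presburger
  show "w = w'" using eq 0 by simp
qed

lemma clockwise_add_4: "clockwise (w + 4) = clockwise w"
proof -
  have "- (\<i> * of_real (pi / 2)) * (w + 4) = - (\<i> * of_real (pi / 2)) * w - 2 * of_real pi * \<i>"
    by (simp add: algebra_simps)
  then show ?thesis unfolding clockwise_def by (simp add: exp_diff)
qed

lemma unit_circle_cases:
  assumes "cmod z = 1"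
  obtains k where "k < 4" "z = disk_corner k" | k where "k < 4" "z \<in> disk_side k"
proof -
  define t0 where "t0 = - (2 / pi) * Arg z"
  have "z \<noteq> 0" using assms by auto
  have "z = cis (Arg z)" using cis_Arg[OF \<open>z \<noteq> 0\<close>] assms by (simp add: sgn_eq)
  then have z: "z = clockwise (of_real t0)" unfolding clockwise_of_real t0_def by simp
  have "- pi < Arg z" "Arg z \<le> pi" using mpi_less_Arg Arg_le_pi by auto
  then have b: "- 2 \<le> t0" "t0 < 2" unfolding t0_def by (simp_all add: field_simps)
  \<comment> \<open>normalise the angle to \<open>[0, 4)\<close>, in quarter turns\<close>
  define t where "t = (if t0 < 0 then t0 + 4 else t0)"
  have t: "0 \<le> t" "t < 4" using b by (auto simp: t_def)
  have zt: "z = clockwise (of_real t)" using z clockwise_add_4[of "of_real t0"] by (auto simp: t_def)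
  define k where "k = nat \<lfloor>t\<rfloor>"
  have k: "real k \<le> t" "t < real k + 1" using t unfolding k_def by linarith+
  then have "k < 4" using t by linarith
  show thesis
  proof (cases "t = real k")
    case True
    then show ?thesis using that(1)[OF \<open>k < 4\<close>] zt by (simp add: disk_corner_clockwise)
  next
    case False
    then have "z \<in> disk_side k" using k zt unfolding disk_side_def clockwise_of_real by force
    then show ?thesis using that(2)[OF \<open>k < 4\<close>] by blast
  qed
qed

section \<open>The sides of the faces\<close>

text \<open>The half-plane coordinates of one side of a face: the real points form the open side, and the points
  below lie in the open face. The set \<open>vertical_strip\<close> is the domain of two such pieces glued
  together.\<close>

definition closed_strip :: "complex set" where
  "closed_strip = {w. 0 < Re w \<and> Re w < 1 \<and> Im w \<le> 0}"

definition open_strip :: "complex set" where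
  "open_strip = {w. 0 < Re w \<and> Re w < 1 \<and> Im w < 0}"

lemma open_strip_subset: "open_strip \<subseteq> closed_strip"
  by (auto simp: open_strip_def closed_strip_def)

lemma closed_strip_real:
  assumes "w \<in> closed_strip" "w \<notin> open_strip"
  shows "w = of_real (Re w)" "Re w \<in> {0<..<1}"
  using assms by (auto simp: closed_strip_def open_strip_def complex_eq_iff)

lemma open_open_strip: "open open_strip"
proof -
  have eq: "open_strip = {w. 0 < Re w} \<inter> {w. Re w < 1} \<inter> {w. Im w < 0}" by (auto simp: open_strip_def)
  show ?thesis
    unfolding eq by (intro open_Int open_halfspace_Re_gt open_halfspace_Re_lt open_halfspace_Im_lt)
qed

definition vertical_strip :: "complex set" where
  "vertical_strip = {w. 0 < Re w \<and> Re w < 1}"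

lemma open_vertical_strip: "open vertical_strip"
proof -
  have eq: "vertical_strip = {w. 0 < Re w} \<inter> {w. Re w < 1}" by (auto simp: vertical_strip_def)
  show ?thesis unfolding eq by (intro open_Int open_halfspace_Re_gt open_halfspace_Re_lt)
qed

locale quadrangulation =
  fixes G :: "('s::t2_space) surface_graph"
  assumes quadrangulation: "bipartite_quadrangulation G"
begin

lemma surface: "oriented_closed_surface (surface G) (atlas G)"
  using quadrangulation by (simp add: bipartite_quadrangulation_def)

lemma embedded: "embedded_simple_graph G"
  using quadrangulation by (simp add: bipartite_quadrangulation_def)

lemma compact_surface: "compact (surface G)"
  using surface by (simp add: oriented_closed_surface_def)

lemma finite_verts: "finite (verts G)" "verts G \<subseteq> surface G"
  using embedded by (simp_all add: embedded_simple_graph_def)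

lemma edge:
  assumes "e \<in> edges G"
  shows "e \<subseteq> verts G" "card e = 2" "curve G e \<subseteq> surface G" "curve G e \<inter> verts G = e"
    "\<exists>g. arc g \<and> path_image g = curve G e \<and> {pathstart g, pathfinish g} = e"
proof -
  have 1: "\<forall>e\<in>edges G. e \<subseteq> verts G \<and> card e = 2"
    using embedded unfolding embedded_simple_graph_def by (elim conjE)
  have 2: "\<forall>e\<in>edges G. curve G e \<subseteq> surface G \<and> curve G e \<inter> verts G = e \<and>
        (\<exists>g. arc g \<and> path_image g = curve G e \<and> {pathstart g, pathfinish g} = e)"
    using embedded unfolding embedded_simple_graph_def by (elim conjE)
  from bspec[OF 1 assms] bspec[OF 2 assms]
  show "e \<subseteq> verts G" "card e = 2" "curve G e \<subseteq> surface G" "curve G e \<inter> verts G = e"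
    "\<exists>g. arc g \<and> path_image g = curve G e \<and> {pathstart g, pathfinish g} = e"
    by simp_all
qed

lemma edge_subset_curve: "e \<in> edges G \<Longrightarrow> e \<subseteq> curve G e"
  using edge(4) by blast

lemma compact_curve: "e \<in> edges G \<Longrightarrow> compact (curve G e)"
  using edge(5) by (metis compact_arc_image)

lemma finite_edges: "finite (edges G)"
proof (rule finite_subset)
  show "edges G \<subseteq> Pow (verts G)" using edge(1) by blast
qed (simp add: finite_verts)

lemma curve_unique:
  assumes "e \<in> edges G" "e' \<in> edges G" "x \<in> curve G e - e" "x \<in> curve G e'"
  shows "e' = e"
proof (rule ccontr)
  assume "e' \<noteq> e"
  moreover have "\<forall>e\<in>edges G. \<forall>e'\<in>edges G. e \<noteq> e' \<longrightarrow> curve G e \<inter> curve G e' = e \<inter> e'"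
    using embedded unfolding embedded_simple_graph_def by (elim conjE)
  ultimately have "curve G e \<inter> curve G e' = e \<inter> e'" using assms(1,2) by simp
  then show False using assms(3,4) by blast
qed

lemma face_subset:
  assumes "f \<in> faces G" "x \<in> f"
  shows "x \<in> surface G" "x \<notin> verts G" "e \<in> edges G \<Longrightarrow> x \<notin> curve G e"
proof -
  have "f \<subseteq> surface G - (verts G \<union> (\<Union>e\<in>edges G. curve G e))"
    using assms(1) unfolding faces_def by (rule in_components_subset)
  then have "x \<in> surface G - (verts G \<union> (\<Union>e\<in>edges G. curve G e))" using assms(2) by (rule subsetD)
  then show "x \<in> surface G" "x \<notin> verts G" "e \<in> edges G \<Longrightarrow> x \<notin> curve G e" by simp_all
qed

lemma faces_disjoint:
  assumes "f \<in> faces G" "f' \<in> faces G" "x \<in> f" "x \<in> f'"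
  shows "f = f'"
proof -
  have "f \<inter> f' \<noteq> {}" using assms(3,4) by blast
  then show ?thesis using components_nonoverlap[OF assms(1,2)[unfolded faces_def]] by simp
qed

lemma face:
  assumes "f \<in> faces G"
  shows "quadrilateral_face G f (param G f)"
  using assms quadrangulation by (simp add: bipartite_quadrangulation_def)

lemma param:
  assumes "f \<in> faces G"
  shows "continuous_on (cball 0 1) (param G f)" "inj_on (param G f) (ball 0 1)" "param G f ` ball 0 1 = f"
proof -
  show "continuous_on (cball 0 1) (param G f)"
    using face[OF assms] by (simp add: quadrilateral_face_def)
  obtain \<psi> where "homeomorphism (ball 0 1) f (param G f) \<psi>"
    using face[OF assms] unfolding quadrilateral_face_def by blast
  then show "inj_on (param G f) (ball 0 1)" "param G f ` ball 0 1 = f"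
    by (auto simp: homeomorphism_def intro: inj_on_inverseI)
qed

text \<open>A parametrisation is only required to map the open disk into the surface and the open sides onto
  edges. The rest follows since the surface is compact, hence closed.\<close>

lemma param_surface:
  assumes "f \<in> faces G"
  shows "param G f ` cball 0 1 \<subseteq> surface G"
proof -
  have "param G f ` closure (ball 0 1) \<subseteq> surface G"
  proof (rule image_closure_subset)
    show "closed (surface G)" using compact_surface by (rule compact_imp_closed)
    show "param G f ` ball 0 1 \<subseteq> surface G" using param(3)[OF assms] face_subset(1)[OF assms] by blast
  qed (use param(1)[OF assms] in simp)
  then show ?thesis by simp
qed

lemma param_corner:
  assumes "f \<in> faces G" "k < 4"
  shows "param G f (disk_corner k) \<in> verts G" "param G f (disk_corner k) \<in> black G \<longleftrightarrow> even k"
proof -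
  have b: "black G \<subseteq> verts G"
    using quadrangulation by (simp add: bipartite_quadrangulation_def properly_coloured_def)
  have c: "param G f (disk_corner 0) \<in> black G" "param G f (disk_corner 2) \<in> black G"
    "param G f (disk_corner 1) \<in> verts G - black G" "param G f (disk_corner 3) \<in> verts G - black G"
    using face[OF assms(1)] by (simp_all add: quadrilateral_face_def)
  have "k = 0 \<or> k = 1 \<or> k = 2 \<or> k = 3" using assms(2) by auto
  then show "param G f (disk_corner k) \<in> verts G" "param G f (disk_corner k) \<in> black G \<longleftrightarrow> even k"
    using b c by auto
qed

lemma side_edge_homeomorphism:
  assumes "s \<in> sides G"
  shows "side_edge G s \<in> edges G"
    "\<exists>\<psi>. homeomorphism (disk_side (snd s)) (curve G (side_edge G s) - side_edge G s) (param G (fst s)) \<psi>"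
proof -
  have s: "fst s \<in> faces G" "snd s < 4" using assms by (auto simp: sides_def)
  then obtain e \<psi> where e: "e \<in> edges G" and
    \<psi>: "homeomorphism (disk_side (snd s)) (curve G e - e) (param G (fst s)) \<psi>"
    using face[OF s(1)] unfolding quadrilateral_face_def by blast
  have img: "param G (fst s) ` disk_side (snd s) = curve G e - e" using \<psi> by (simp add: homeomorphism_def)
  have ne: "curve G e - e \<noteq> {}" unfolding img[symmetric] disk_side_clockwise by simp
  have "side_edge G s = e"
    unfolding side_edge_def
  proof (rule the_equality)
    fix e' assume e': "e' \<in> edges G \<and> param G (fst s) ` disk_side (snd s) = curve G e' - e'"
    obtain x where "x \<in> curve G e - e" using ne by blast
    then show "e' = e" using curve_unique[OF e] e' img by blast
  qed (use e img in simp)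
  then show "side_edge G s \<in> edges G"
    "\<exists>\<psi>. homeomorphism (disk_side (snd s)) (curve G (side_edge G s) - side_edge G s) (param G (fst s)) \<psi>"
    using e \<psi> by auto
qed

definition side_map :: "'s set \<times> nat \<Rightarrow> complex \<Rightarrow> 's" where
  "side_map s w = param G (fst s) (clockwise (w + of_nat (snd s)))"

lemma clockwise_cball: "Im w \<le> 0 \<Longrightarrow> clockwise (w + of_nat k) \<in> cball 0 1"
  by (simp add: norm_clockwise mult_nonneg_nonpos)

lemma clockwise_ball: "Im w < 0 \<Longrightarrow> clockwise (w + of_nat k) \<in> ball 0 1"
  by (simp add: norm_clockwise mult_pos_neg)

lemma continuous_on_side_map:
  assumes "s \<in> sides G"
  shows "continuous_on {w. Im w \<le> 0} (side_map s)"
proof -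
  have f: "fst s \<in> faces G" using assms by (auto simp: sides_def)
  show ?thesis
    unfolding side_map_def
    by (intro continuous_on_compose2[OF param(1)[OF f]] continuous_intros subsetI)
       (use clockwise_cball in blast)
qed

lemma side_map_boundary:
  assumes "s \<in> sides G"
  shows "(\<lambda>t. side_map s (of_real t)) ` {0<..<1} = curve G (side_edge G s) - side_edge G s"
proof -
  obtain \<psi> where "homeomorphism (disk_side (snd s)) (curve G (side_edge G s) - side_edge G s) (param G (fst s)) \<psi>"
    using side_edge_homeomorphism[OF assms] by blast
  then have "param G (fst s) ` disk_side (snd s) = curve G (side_edge G s) - side_edge G s"
    by (simp add: homeomorphism_def)
  then show ?thesis unfolding disk_side_clockwise side_map_def by (simp add: image_image)
qed

lemma side_map_boundary_inj:
  assumes "s \<in> sides G"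
  shows "inj_on (\<lambda>t. side_map s (of_real t)) {0<..<1}"
proof (rule inj_onI)
  fix t u :: real
  assume tu: "t \<in> {0<..<1}" "u \<in> {0<..<1}" and eq: "side_map s (of_real t) = side_map s (of_real u)"
  obtain \<psi> where "homeomorphism (disk_side (snd s)) (curve G (side_edge G s) - side_edge G s) (param G (fst s)) \<psi>"
    using side_edge_homeomorphism[OF assms] by blast
  then have inj: "inj_on (param G (fst s)) (disk_side (snd s))"
    by (auto simp: homeomorphism_def intro: inj_on_inverseI)
  have "clockwise (of_real t + of_nat (snd s)) = clockwise (of_real u + of_nat (snd s))"
  proof (rule inj_onD[OF inj])
    show "param G (fst s) (clockwise (of_real t + of_nat (snd s))) =
        param G (fst s) (clockwise (of_real u + of_nat (snd s)))"
      using eq by (simp add: side_map_def)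
    have "clockwise (of_real v + of_nat (snd s)) \<in> disk_side (snd s)" if "v \<in> {0<..<1}" for v
      unfolding disk_side_clockwise using that by (rule imageI)
    then show "clockwise (of_real t + of_nat (snd s)) \<in> disk_side (snd s)"
      "clockwise (of_real u + of_nat (snd s)) \<in> disk_side (snd s)" using tu by blast+
  qed
  from clockwise_eqD(2)[OF this] have "of_real t = (of_real u :: complex)"
    using assms tu by (auto simp: sides_def)
  then show "t = u" by simp
qed

lemma side_map_corner:
  assumes "s \<in> sides G"
  shows "side_map s 0 \<in> verts G" "side_map s 1 \<in> verts G"
    "side_map s 0 \<in> black G \<longleftrightarrow> even (snd s)" "side_map s 1 \<in> black G \<longleftrightarrow> odd (snd s)"
proof -
  obtain f k where s: "s = (f, k)" "f \<in> faces G" "k < 4" using assms by (auto simp: sides_def)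
  have 0: "side_map s 0 = param G f (disk_corner k)" by (simp add: side_map_def s(1) disk_corner_clockwise)
  have "side_map s 1 = param G f (clockwise (1 + of_nat k))" by (simp add: side_map_def s(1))
  also have "clockwise (1 + of_nat k) = disk_corner ((k + 1) mod 4)"
  proof (cases "k = 3")
    case True
    then show ?thesis using clockwise_add_4[of 0] by (simp add: disk_corner_clockwise)
  next
    case False
    then have "(k + 1) mod 4 = k + 1" using s(3) by simp
    then show ?thesis by (simp add: disk_corner_clockwise)
  qed
  finally have 1: "side_map s 1 = param G f (disk_corner ((k + 1) mod 4))" .
  have "even ((k + 1) mod 4) \<longleftrightarrow> odd k" by presburger
  then show "side_map s 0 \<in> verts G" "side_map s 1 \<in> verts G"
    "side_map s 0 \<in> black G \<longleftrightarrow> even (snd s)" "side_map s 1 \<in> black G \<longleftrightarrow> odd (snd s)"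
    unfolding 0 1 using param_corner[OF s(2,3)] param_corner[OF s(2), of "(k + 1) mod 4"] by (simp_all add: s(1))
qed

text \<open>Only the open side is known to be mapped homeomorphically. The two corners go to vertices on
  the closed arc, that is, to ends of the edge, and to different ones because their colours differ;
  hence the closed side is mapped bijectively onto the closed arc.\<close>

lemma side_map_closed_side:
  assumes "s \<in> sides G"
  defines "\<beta> \<equiv> \<lambda>t. side_map s (of_real t)"
  shows "continuous_on {0..1} \<beta>" "inj_on \<beta> {0..1}" "\<beta> ` {0..1} = curve G (side_edge G s)"
    "{\<beta> 0, \<beta> 1} = side_edge G s"
proof -
  define e where "e = side_edge G s"
  have e: "e \<in> edges G" using side_edge_homeomorphism(1)[OF assms(1)] by (simp add: e_def)
  have img: "\<beta> ` {0<..<1} = curve G e - e" and inj: "inj_on \<beta> {0<..<1}"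
    unfolding \<beta>_def e_def using side_map_boundary[OF assms(1)] side_map_boundary_inj[OF assms(1)] by auto
  show cont: "continuous_on {0..1} \<beta>"
    unfolding \<beta>_def by (intro continuous_on_compose2[OF continuous_on_side_map[OF assms(1)]] continuous_intros) auto
  have "\<beta> ` closure {0<..<1} \<subseteq> curve G e"
  proof (rule image_closure_subset)
    show "closed (curve G e)" using compact_curve[OF e] by (rule compact_imp_closed)
  qed (use cont img in simp_all)
  then have sub: "\<beta> ` {0..1} \<subseteq> curve G e" by simp
  have c: "\<beta> 0 \<in> verts G" "\<beta> 1 \<in> verts G" "\<beta> 0 \<in> black G \<longleftrightarrow> \<beta> 1 \<notin> black G"
    using side_map_corner[OF assms(1)] unfolding \<beta>_def of_real_0 of_real_1 by simp_all
  have "\<beta> 0 \<in> curve G e" "\<beta> 1 \<in> curve G e" using sub by (simp_all add: image_subset_iff)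
  then have "\<beta> 0 \<in> e" "\<beta> 1 \<in> e" using c(1,2) edge(4)[OF e] by blast+
  then have "{\<beta> 0, \<beta> 1} \<subseteq> e" by simp
  moreover have ne: "\<beta> 0 \<noteq> \<beta> 1" using c(3) by auto
  moreover have "finite e" by (intro card_ge_0_finite) (simp add: edge(2)[OF e])
  ultimately have ends: "{\<beta> 0, \<beta> 1} = e" by (intro card_subset_eq) (simp_all add: edge(2)[OF e])
  then show "{\<beta> 0, \<beta> 1} = side_edge G s" by (simp add: e_def)
  have ivl: "{0..1::real} = insert 0 (insert 1 {0<..<1})" by auto
  have "\<beta> ` {0..1} = {\<beta> 0, \<beta> 1} \<union> \<beta> ` {0<..<1}" unfolding ivl image_insert by simp
  also have "\<dots> = e \<union> (curve G e - e)" unfolding ends img ..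
  also have "\<dots> = curve G e" using edge_subset_curve[OF e] by blast
  finally show "\<beta> ` {0..1} = curve G (side_edge G s)" by (simp only: e_def)
  have out: "\<beta> 0 \<notin> \<beta> ` {0<..<1}" "\<beta> 1 \<notin> \<beta> ` {0<..<1}"
    unfolding img using \<open>\<beta> 0 \<in> e\<close> \<open>\<beta> 1 \<in> e\<close> by simp_all
  have diff: "insert 1 {0<..<1} - {0} = insert 1 {0<..<1::real}" "{0<..<1} - {1} = {0<..<1::real}" by auto
  show "inj_on \<beta> {0..1}"
    unfolding ivl inj_on_insert diff image_insert using inj out ne by simp
qed

lemma side_map_real:
  assumes "s \<in> sides G" "w \<in> closed_strip" "w \<notin> open_strip"
  shows "side_map s w \<in> curve G (side_edge G s) - side_edge G s"
  unfolding side_map_boundary[OF assms(1), symmetric]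
  using closed_strip_real[OF assms(2,3)] by (metis imageI)

lemma side_map_face:
  assumes "s \<in> sides G" "w \<in> open_strip"
  shows "side_map s w \<in> fst s"
proof -
  have f: "fst s \<in> faces G" using assms by (auto simp: sides_def)
  have "clockwise (w + of_nat (snd s)) \<in> ball 0 1" using assms(2) by (intro clockwise_ball) (simp add: open_strip_def)
  then show ?thesis unfolding side_map_def using param(3)[OF f] by blast
qed

lemma side_map_surface:
  assumes "s \<in> sides G" "w \<in> closed_strip"
  shows "side_map s w \<in> surface G"
proof -
  have f: "fst s \<in> faces G" using assms by (auto simp: sides_def)
  have "clockwise (w + of_nat (snd s)) \<in> cball 0 1" using assms(2) by (intro clockwise_cball) (simp add: closed_strip_def)
  then show ?thesis unfolding side_map_def using param_surface[OF f] by blast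
qed

text \<open>Interior points of different faces differ, and so do interior points that belong to sectors of
  different sides of one face; boundary points lie on edges, hence in no face.\<close>

lemma side_map_eq_open:
  assumes s: "s \<in> sides G" "s' \<in> sides G" and w: "w \<in> open_strip" "w' \<in> closed_strip"
    and eq: "side_map s w = side_map s' w'"
  shows "s = s'" "w = w'"
proof -
  have fs: "fst s \<in> faces G" "fst s' \<in> faces G" "snd s < 4" "snd s' < 4" using s by (auto simp: sides_def)
  have w': "w' \<in> open_strip"
  proof (rule ccontr)
    assume "w' \<notin> open_strip"
    then have "side_map s w \<in> curve G (side_edge G s')" using side_map_real[OF s(2) w(2)] eq by simp
    then show False
      using face_subset(3)[OF fs(1) side_map_face[OF s(1) w(1)] side_edge_homeomorphism(1)[OF s(2)]] by simp
  qed
  have f: "fst s = fst s'"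
    using faces_disjoint[OF fs(1,2) side_map_face[OF s(1) w(1)]] side_map_face[OF s(2) w'] eq by simp
  have "clockwise (w + of_nat (snd s)) = clockwise (w' + of_nat (snd s'))"
  proof (rule inj_onD[OF param(2)[OF fs(1)]])
    show "param G (fst s) (clockwise (w + of_nat (snd s))) = param G (fst s) (clockwise (w' + of_nat (snd s')))"
      using eq f by (simp add: side_map_def)
    show "clockwise (w + of_nat (snd s)) \<in> ball 0 1" "clockwise (w' + of_nat (snd s')) \<in> ball 0 1"
      using w(1) w' by (intro clockwise_ball; simp add: open_strip_def)+
  qed
  from clockwise_eqD[OF this fs(3,4)] have "snd s = snd s'" "w = w'"
    using w(1) w' by (auto simp: open_strip_def)
  then show "s = s'" "w = w'" using f by (auto simp: prod_eq_iff)
qed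

lemma inj_on_side_map:
  assumes s: "s \<in> sides G"
  shows "inj_on (side_map s) closed_strip"
proof (rule inj_onI)
  fix w w' assume w: "w \<in> closed_strip" "w' \<in> closed_strip" and eq: "side_map s w = side_map s w'"
  consider "w \<in> open_strip" | "w' \<in> open_strip" | "w \<notin> open_strip" "w' \<notin> open_strip" by blast
  then show "w = w'"
  proof cases
    case 1
    then show ?thesis using side_map_eq_open(2)[OF s s 1 w(2) eq] by simp
  next
    case 2
    then show ?thesis using side_map_eq_open(2)[OF s s 2 w(1) eq[symmetric]] by simp
  next
    case 3
    note r = closed_strip_real[OF w(1) 3(1)] closed_strip_real[OF w(2) 3(2)]
    have "Re w = Re w'" using inj_onD[OF side_map_boundary_inj[OF s] _ r(2,4)] eq r(1,3) by metis
    then show ?thesis using r by metis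
  qed
qed

lemma side_map_orientation:
  assumes s: "s \<in> sides G" and U: "(U, h) \<in> atlas G"
  shows "orientation_preserving_on {w \<in> open_strip. side_map s w \<in> U} (h \<circ> side_map s)"
proof -
  have f: "fst s \<in> faces G" and k: "snd s < 4" using s by (auto simp: sides_def)
  define c where "c w = clockwise (w + of_nat (snd s))" for w
  let ?V = "{z \<in> ball 0 1. param G (fst s) z \<in> U}"
  have sm: "side_map s w = param G (fst s) (c w)" for w by (simp add: side_map_def c_def)
  have "c holomorphic_on open_strip" unfolding c_def by (rule holomorphic_clockwise)
  moreover have "inj_on c open_strip"
  proof (rule inj_onI)
    fix w w' assume "w \<in> open_strip" "w' \<in> open_strip" "c w = c w'"
    then show "w = w'" using clockwise_eqD(2)[of w "snd s" w' "snd s"] k by (auto simp: c_def open_strip_def)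
  qed
  ultimately have "orientation_preserving_on open_strip c"
    using open_open_strip by (intro holomorphic_inj_orientation_preserving_on)
  then have c: "orientation_preserving_on {w \<in> open_strip. side_map s w \<in> U} c"
    by (rule orientation_preserving_on_subset) blast
  have g: "orientation_preserving_on ?V (h \<circ> param G (fst s))"
    using face[OF f] U unfolding quadrilateral_face_def by blast
  have "open ?V"
  proof (rule openin_continuous_preimage)
    show "continuous_on (ball 0 1) (param G (fst s))"
      using param(1)[OF f] by (rule continuous_on_subset) auto
    show "param G (fst s) ` ball 0 1 \<subseteq> surface G" using param_surface[OF f] by auto
    show "openin (top_of_set (surface G)) U" using chart(1)[OF surface U] .
  qed simp
  moreover have "c ` {w \<in> open_strip. side_map s w \<in> U} \<subseteq> ?V"
  proof clarify
    fix w assume w: "w \<in> open_strip" "side_map s w \<in> U"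
    have "c w \<in> ball 0 1" unfolding c_def using w(1) by (intro clockwise_ball) (simp add: open_strip_def)
    then show "c w \<in> ball 0 1 \<and> param G (fst s) (c w) \<in> U" using w(2) by (simp add: sm)
  qed
  ultimately have "orientation_preserving_on {w \<in> open_strip. side_map s w \<in> U} (h \<circ> param G (fst s) \<circ> c)"
    by (rule orientation_preserving_on_compose[OF c g])
  moreover have "h \<circ> param G (fst s) \<circ> c = h \<circ> side_map s" by (auto simp: sm)
  ultimately show ?thesis by simp
qed


section \<open>Gluing two faces along an edge\<close>

text \<open>The change of coordinates \<open>\<tau>\<close> along the edge. It comes from a homeomorphism of closed intervals, so
  it is monotone. If the numbers of the two sides have the same parity, both coordinates start at
  the same end of the edge, the black one for even numbers, and \<open>\<tau>\<close> is increasing.\<close>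

lemma transition:
  assumes s: "s \<in> sides G" "s' \<in> sides G" and e: "side_edge G s' = side_edge G s"
  obtains \<tau> where "continuous_on {0<..<1} \<tau>" "inj_on \<tau> {0<..<1}" "\<And>t. t \<in> {0<..<1} \<Longrightarrow> \<tau> t \<in> {0<..<1}"
    "\<And>t. t \<in> {0<..<1} \<Longrightarrow> side_map s' (of_real (\<tau> t)) = side_map s (of_real t)"
    "even (snd s) = even (snd s') \<Longrightarrow> strict_mono_on {0<..<1} \<tau>"
proof -
  define \<beta> where "\<beta> = (\<lambda>t. side_map s (of_real t))"
  define \<beta>' where "\<beta>' = (\<lambda>t. side_map s' (of_real t))"
  have b: "continuous_on {0..1} \<beta>" "inj_on \<beta> {0..1}" "\<beta> ` {0..1} = curve G (side_edge G s)"
      "{\<beta> 0, \<beta> 1} = side_edge G s"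
    unfolding \<beta>_def by (fact side_map_closed_side[OF s(1)])+
  have b': "continuous_on {0..1} \<beta>'" "inj_on \<beta>' {0..1}" "\<beta>' ` {0..1} = curve G (side_edge G s)"
      "{\<beta>' 0, \<beta>' 1} = side_edge G s"
    unfolding \<beta>'_def e[symmetric] by (fact side_map_closed_side[OF s(2)])+
  obtain g where g: "homeomorphism {0..1} (curve G (side_edge G s)) \<beta>' g"
    using homeomorphism_compact[OF compact_Icc b'(1,3,2)] by blast
  define \<tau> where "\<tau> = g \<circ> \<beta>"
  have in01: "\<tau> t \<in> {0..1}" and eq: "\<beta>' (\<tau> t) = \<beta> t" if "t \<in> {0..1}" for t
  proof -
    have "\<beta> t \<in> curve G (side_edge G s)" using b(3) that by blast
    then show "\<tau> t \<in> {0..1}" "\<beta>' (\<tau> t) = \<beta> t"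
      using homeomorphism_image2[OF g] homeomorphism_apply2[OF g] unfolding \<tau>_def comp_apply by blast+
  qed
  have "continuous_on (\<beta> ` {0..1}) g" unfolding b(3) by (rule homeomorphism_cont2[OF g])
  then have cont: "continuous_on {0..1} \<tau>" unfolding \<tau>_def by (rule continuous_on_compose[OF b(1)])
  have inj: "inj_on \<tau> {0..1}"
  proof (rule inj_onI)
    fix t u assume tu: "t \<in> {0..1}" "u \<in> {0..1}" "\<tau> t = \<tau> u"
    then have "\<beta> t = \<beta> u" using eq[OF tu(1)] eq[OF tu(2)] by simp
    then show "t = u" by (rule inj_onD[OF b(2) _ tu(1,2)])
  qed
  have open01: "\<tau> t \<in> {0<..<1}" if t: "t \<in> {0<..<1}" for t
  proof -
    have t': "t \<in> {0..1}" using t by auto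
    have "\<beta> t \<in> curve G (side_edge G s) - side_edge G s"
      unfolding side_map_boundary[OF s(1), symmetric] \<beta>_def using t by (rule imageI)
    then have out: "\<beta>' (\<tau> t) \<notin> side_edge G s" using eq[OF t'] by simp
    have ends: "\<beta>' 0 \<in> side_edge G s" "\<beta>' 1 \<in> side_edge G s" unfolding b'(4)[symmetric] by simp_all
    have "\<tau> t \<noteq> 0"
    proof
      assume "\<tau> t = 0"
      then show False using out ends(1) by simp
    qed
    moreover have "\<tau> t \<noteq> 1"
    proof
      assume "\<tau> t = 1"
      then show False using out ends(2) by simp
    qed
    ultimately show ?thesis using in01[OF t'] by simp
  qed
  have mono: "strict_mono_on {0<..<1} \<tau>" if par: "even (snd s) = even (snd s')"
  proof -
    have "\<beta> 0 \<in> {\<beta> 0, \<beta> 1}" by simp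
    then have "\<beta> 0 \<in> {\<beta>' 0, \<beta>' 1}" unfolding b(4) b'(4) .
    moreover have "\<beta> 0 \<in> black G \<longleftrightarrow> \<beta>' 1 \<notin> black G"
      using side_map_corner(3)[OF s(1)] side_map_corner(4)[OF s(2)] par by (simp add: \<beta>_def \<beta>'_def)
    then have "\<beta> 0 \<noteq> \<beta>' 1" by metis
    ultimately have "\<beta>' (\<tau> 0) = \<beta>' 0" using eq[of 0] by simp
    then have \<tau>0: "\<tau> 0 = 0" by (rule inj_onD[OF b'(2)]) (use in01[of 0] in simp_all)
    have "strict_mono_on {0..1} \<tau> \<or> strict_antimono_on {0..1} \<tau>"
      using injective_eq_monotone_map[OF is_interval_cc cont] inj by (rule iffD1)
    moreover have "\<not> strict_antimono_on {0..1} \<tau>"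
    proof
      assume "strict_antimono_on {0..1} \<tau>"
      then have "\<tau> 1 < \<tau> 0" by (simp add: monotone_on_def)
      then show False using \<tau>0 in01[of 1] by simp
    qed
    ultimately have "strict_mono_on {0..1} \<tau>" by blast
    then show ?thesis by (rule monotone_on_subset) auto
  qed
  show thesis
  proof (rule that[of \<tau>])
    show "continuous_on {0<..<1} \<tau>" using cont by (rule continuous_on_subset) auto
    show "inj_on \<tau> {0<..<1}" using inj by (rule inj_on_subset) auto
    show "side_map s' (of_real (\<tau> t)) = side_map s (of_real t)" if "t \<in> {0<..<1}" for t
      using eq[of t] that by (simp add: \<beta>_def \<beta>'_def)
  qed (use open01 mono in blast)+
qed

text \<open>The lower half of the strip is mapped by the first face, the upper half is reflected and mapped by
  the second face, after matching the boundary values by \<open>\<tau>\<close>.\<close>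

definition glued :: "'s set \<times> nat \<Rightarrow> 's set \<times> nat \<Rightarrow> (real \<Rightarrow> real) \<Rightarrow> complex \<Rightarrow> 's" where
  "glued s s' \<tau> w =
     (if Im w \<le> 0 then side_map s w else side_map s' (Complex (\<tau> (Re w)) (- Im w)))"

lemma glued:
  assumes s: "s \<in> sides G" "s' \<in> sides G" "s \<noteq> s'"
    and \<tau>: "continuous_on {0<..<1} \<tau>" "inj_on \<tau> {0<..<1}" "\<And>t. t \<in> {0<..<1} \<Longrightarrow> \<tau> t \<in> {0<..<1}"
    and eq: "\<And>t. t \<in> {0<..<1} \<Longrightarrow> side_map s' (of_real (\<tau> t)) = side_map s (of_real t)"
  shows "continuous_on vertical_strip (glued s s' \<tau>)" "inj_on (glued s s' \<tau>) vertical_strip"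
    "glued s s' \<tau> ` vertical_strip \<subseteq> surface G"
proof -
  let ?r = "\<lambda>w. Complex (\<tau> (Re w)) (- Im w)"
  have lower: "w \<in> closed_strip" if "w \<in> vertical_strip" "Im w \<le> 0" for w
    using that by (simp add: vertical_strip_def closed_strip_def)
  have upper: "?r w \<in> open_strip" if "w \<in> vertical_strip" "0 < Im w" for w
    using that \<tau>(3)[of "Re w"] by (simp add: vertical_strip_def open_strip_def)
  have "continuous_on {w \<in> vertical_strip. Im w \<le> 0} (side_map s)"
    by (rule continuous_on_subset[OF continuous_on_side_map[OF s(1)]]) auto
  moreover have "continuous_on {w \<in> vertical_strip. 0 \<le> Im w} (\<lambda>w. side_map s' (?r w))"
  proof (rule continuous_on_compose2[OF continuous_on_side_map[OF s(2)]])
    show "continuous_on {w \<in> vertical_strip. 0 \<le> Im w} ?r"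
      unfolding Complex_eq
      by (intro continuous_intros continuous_on_compose2[OF \<tau>(1)]) (auto simp: vertical_strip_def)
  qed auto
  moreover have "side_map s w = side_map s' (?r w)" if "w \<in> vertical_strip" "Im w = 0" for w
  proof -
    have "Re w \<in> {0<..<1}" using that by (simp add: vertical_strip_def)
    from eq[OF this] have "side_map s (of_real (Re w)) = side_map s' (of_real (\<tau> (Re w)))" ..
    moreover have "of_real (Re w) = w" "of_real (\<tau> (Re w)) = ?r w"
      using that(2) by (simp_all add: complex_eq_iff)
    ultimately show ?thesis by (simp only:)
  qed
  ultimately show "continuous_on vertical_strip (glued s s' \<tau>)"
    unfolding glued_def by (intro continuous_on_cases_le[where h = Im and a = 0] continuous_on_Im continuous_on_id)
  show "glued s s' \<tau> ` vertical_strip \<subseteq> surface G"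
  proof clarify
    fix w assume w: "w \<in> vertical_strip"
    show "glued s s' \<tau> w \<in> surface G"
    proof (cases "Im w \<le> 0")
      case True
      then show ?thesis using side_map_surface[OF s(1) lower[OF w]] by (simp add: glued_def)
    next
      case False
      then show ?thesis
        using side_map_surface[OF s(2) subsetD[OF open_strip_subset upper[OF w]]] by (simp add: glued_def)
    qed
  qed
  have mixed: False if w: "w \<in> vertical_strip" "w' \<in> vertical_strip" "Im w \<le> 0" "0 < Im w'"
    and "side_map s w = side_map s' (?r w')" for w w'
  proof -
    have "s' = s" by (rule side_map_eq_open(1)[OF s(2,1) upper[OF w(2,4)] lower[OF w(1,3)] that(5)[symmetric]])
    then show False using s(3) by simp
  qed
  show "inj_on (glued s s' \<tau>) vertical_strip"
  proof (rule inj_onI)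
    fix w w' assume w: "w \<in> vertical_strip" "w' \<in> vertical_strip" and e: "glued s s' \<tau> w = glued s s' \<tau> w'"
    consider "Im w \<le> 0" "Im w' \<le> 0" | "Im w \<le> 0" "0 < Im w'" | "0 < Im w" "Im w' \<le> 0" | "0 < Im w" "0 < Im w'"
      by linarith
    then show "w = w'"
    proof cases
      case 1
      then have "side_map s w = side_map s w'" using e by (simp add: glued_def)
      then show ?thesis by (rule inj_onD[OF inj_on_side_map[OF s(1)] _ lower[OF w(1) 1(1)] lower[OF w(2) 1(2)]])
    next
      case 2
      then have "side_map s w = side_map s' (?r w')" using e by (simp add: glued_def)
      from mixed[OF w 2 this] show ?thesis by (rule FalseE)
    next
      case 3
      then have "side_map s w' = side_map s' (?r w)" using e by (simp add: glued_def)
      from mixed[OF w(2,1) 3(2,1) this] show ?thesis by (rule FalseE)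
    next
      case 4
      then have "side_map s' (?r w) = side_map s' (?r w')" using e by (simp add: glued_def)
      then have r: "?r w = ?r w'"
        by (rule inj_onD[OF inj_on_side_map[OF s(2)] _ subsetD[OF open_strip_subset upper[OF w(1) 4(1)]]
          subsetD[OF open_strip_subset upper[OF w(2) 4(2)]]])
      then have "\<tau> (Re w) = \<tau> (Re w')" by simp
      then have "Re w = Re w'" by (rule inj_onD[OF \<tau>(2)]) (use w in \<open>simp_all add: vertical_strip_def\<close>)
      then show ?thesis using r by (simp add: complex_eq_iff)
    qed
  qed
qed

section \<open>Every edge has two sides of opposite parity\<close>

text \<open>Two sides glued together already fill a neighbourhood of each interior point of the edge. Interior
  points of a third face close to that point would lie in it too.\<close>

lemma at_most_two_sides:
  assumes s: "s \<in> sides G" "s' \<in> sides G" "s'' \<in> sides G"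
    and e: "side_edge G s' = side_edge G s" "side_edge G s'' = side_edge G s" and ne: "s \<noteq> s'"
  shows "s'' = s \<or> s'' = s'"
proof -
  obtain \<tau> where \<tau>: "continuous_on {0<..<1} \<tau>" "inj_on \<tau> {0<..<1}" "\<And>t. t \<in> {0<..<1} \<Longrightarrow> \<tau> t \<in> {0<..<1}"
    "\<And>t. t \<in> {0<..<1} \<Longrightarrow> side_map s' (of_real (\<tau> t)) = side_map s (of_real t)"
    using transition[OF s(1,2) e(1)] by metis
  define W where "W = glued s s' \<tau> ` vertical_strip"
  note gl = glued[OF s(1,2) ne \<tau>]
  have "openin (top_of_set (surface G)) W"
    unfolding W_def using gl by (intro openin_surface_image[OF surface open_vertical_strip])
  then obtain T where T: "open T" "W = surface G \<inter> T" by (auto simp: openin_open)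
  have half: "(1/2 :: real) \<in> {0<..<1}" by simp
  have "side_map s (of_real (1/2)) \<in> (\<lambda>t. side_map s'' (of_real t)) ` {0<..<1}"
    unfolding side_map_boundary[OF s(3)] e(2) unfolding side_map_boundary[OF s(1), symmetric]
    using half by (rule imageI)
  then obtain t where t: "t \<in> {0<..<1}" "side_map s'' (of_real t) = side_map s (of_real (1/2))" by auto
  have "glued s s' \<tau> (of_real (1/2)) \<in> W" unfolding W_def by (intro imageI) (simp add: vertical_strip_def)
  then have "side_map s'' (of_real t) \<in> T" using T t(2) by (simp add: glued_def)
  moreover have "continuous_on {w. Im w \<le> 0} (side_map s'')" by (rule continuous_on_side_map[OF s(3)])
  ultimately obtain X where X: "open X" "of_real t \<in> X" "\<And>w. w \<in> X \<Longrightarrow> Im w \<le> 0 \<Longrightarrow> side_map s'' w \<in> T"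
    using T(1) unfolding continuous_on_topological by (metis Im_complex_of_real mem_Collect_eq order_refl)
  obtain d where d: "0 < d" "ball (of_real t) d \<subseteq> X" using X(1,2) by (meson openE)
  \<comment> \<open>a point of the third face close to the edge\<close>
  define w where "w = Complex t (- (d / 2))"
  have "dist (of_real t) w = d / 2"
    using d(1) by (simp add: w_def dist_norm Complex_eq norm_mult)
  then have wX: "w \<in> X" using d by auto
  have w: "w \<in> open_strip" using d t by (simp add: w_def open_strip_def)
  have "side_map s'' w \<in> T" using X(3)[OF wX] d(1) by (simp add: w_def)
  moreover have "side_map s'' w \<in> surface G"
    using side_map_surface[OF s(3)] w open_strip_subset by blast
  ultimately have "side_map s'' w \<in> W" using T(2) by simp
  then obtain v where v: "v \<in> vertical_strip" "side_map s'' w = glued s s' \<tau> v" by (auto simp: W_def)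
  show ?thesis
  proof (cases "Im v \<le> 0")
    case True
    then have "v \<in> closed_strip" "side_map s'' w = side_map s v" 
      using v by (auto simp: glued_def vertical_strip_def closed_strip_def)
    then show ?thesis using side_map_eq_open(1)[OF s(3,1) w] by blast
  next
    case False
    then have "Complex (\<tau> (Re v)) (- Im v) \<in> closed_strip" "side_map s'' w = side_map s' (Complex (\<tau> (Re v)) (- Im v))"
      using v \<tau>(3)[of "Re v"] by (auto simp: glued_def vertical_strip_def closed_strip_def)
    then show ?thesis using side_map_eq_open(1)[OF s(3,2) w] by blast
  qed
qed

text \<open>Every face has a side, and there are at most two sides for each of the finitely many edges.\<close>

lemma finite_faces: "finite (faces G)"
proof -
  have "finite {s \<in> sides G. side_edge G s = e}" for e
  proof (cases "\<exists>s s'. s \<in> sides G \<and> s' \<in> sides G \<and> side_edge G s = e \<and> side_edge G s' = e \<and> s \<noteq> s'")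
    case True
    then obtain s s' where s: "s \<in> sides G" "s' \<in> sides G" "side_edge G s = e" "side_edge G s' = e" "s \<noteq> s'"
      by blast
    have "{s \<in> sides G. side_edge G s = e} \<subseteq> {s, s'}"
      using at_most_two_sides[OF s(1,2) _ _ _ s(5)] s(3,4) by blast
    then show ?thesis by (rule finite_subset) simp
  next
    case False
    then have "\<exists>s. {s \<in> sides G. side_edge G s = e} \<subseteq> {s}" by blast
    then show ?thesis using finite_subset by (metis finite.emptyI finite_insert)
  qed
  then have "finite (\<Union>e\<in>edges G. {s \<in> sides G. side_edge G s = e})" using finite_edges by simp
  moreover have "(\<Union>e\<in>edges G. {s \<in> sides G. side_edge G s = e}) = sides G"
    using side_edge_homeomorphism(1) by blast
  ultimately have "finite (fst ` sides G)" by simp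
  moreover have "faces G \<subseteq> fst ` sides G"
  proof
    fix f assume "f \<in> faces G"
    then have "(f, 0) \<in> sides G" by (simp add: sides_def)
    then show "f \<in> fst ` sides G" by force
  qed
  ultimately show ?thesis by (rule finite_subset[rotated])
qed

lemma param_on_curve:
  assumes f: "f \<in> faces G" and z: "z \<in> cball 0 1" and e: "e \<in> edges G" and p: "param G f z \<in> curve G e - e"
  obtains k t where "(f, k) \<in> sides G" "side_edge G (f, k) = e" "t \<in> {0<..<1}" "z = clockwise (of_real t + of_nat k)"
proof -
  have "z \<notin> ball 0 1"
  proof
    assume "z \<in> ball 0 1"
    then have "param G f z \<in> f" using param(3)[OF f] by blast
    then show False using face_subset(3)[OF f _ e] p by blast
  qed
  then have "cmod z = 1" using z by simp
  then show thesis
  proof (cases rule: unit_circle_cases)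
    case (1 k)
    then have "param G f z \<in> verts G" using param_corner[OF f] by simp
    then show ?thesis using p edge(4)[OF e] by blast
  next
    case (2 k)
    then have s: "(f, k) \<in> sides G" using f by (simp add: sides_def)
    obtain t where t: "t \<in> {0<..<1}" "z = clockwise (of_real t + of_nat k)"
      using 2 unfolding disk_side_clockwise by blast
    have "param G f z = side_map (f, k) (of_real t)" using t by (simp add: side_map_def)
    then have "param G f z \<in> curve G (side_edge G (f, k))"
      using side_map_boundary[OF s] t(1) by blast
    then have "side_edge G (f, k) = e"
      using curve_unique[OF e side_edge_homeomorphism(1)[OF s] p] by blast
    then show ?thesis using that s t by blast
  qed
qed

text \<open>An interior point \<open>p\<close> of an edge is approached only along the part \<open>N f\<close> of each face that
  contains all its preimages: the remaining parts of the finitely many faces, and the other edges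
  and vertices, form a compact set that misses \<open>p\<close>.\<close>

lemma neighbourhood_of_edge_point:
  assumes e: "e \<in> edges G" and p: "p \<in> curve G e - e" and O: "\<And>f. open (N f)"
    and N: "\<And>f z. f \<in> faces G \<Longrightarrow> z \<in> cball 0 1 \<Longrightarrow> param G f z = p \<Longrightarrow> z \<in> N f"
  obtains W where "openin (top_of_set (surface G)) W" "p \<in> W"
    "\<And>f z. f \<in> faces G \<Longrightarrow> z \<in> cball 0 1 \<Longrightarrow> param G f z \<in> W \<Longrightarrow> z \<in> N f"
    "\<And>x. x \<in> W \<Longrightarrow> x \<in> curve G e - e \<or> (\<exists>f\<in>faces G. x \<in> f)"
proof -
  \<comment> \<open>everything that has to stay away from \<open>p\<close>\<close>
  define B where "B = verts G \<union> (\<Union>e'\<in>edges G - {e}. curve G e') \<union>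
    (\<Union>f\<in>faces G. param G f ` (cball 0 1 - N f))"
  have "compact (verts G)" using finite_verts(1) by (rule finite_imp_compact)
  moreover have "compact (\<Union>e'\<in>edges G - {e}. curve G e')"
    using finite_edges compact_curve by (intro compact_UN) auto
  moreover have "compact (\<Union>f\<in>faces G. param G f ` (cball 0 1 - N f))"
  proof (intro compact_UN finite_faces)
    fix f assume f: "f \<in> faces G"
    have "compact (cball 0 1 - N f)" using O by (intro compact_diff compact_cball)
    then show "compact (param G f ` (cball 0 1 - N f))"
      using continuous_on_subset[OF param(1)[OF f] Diff_subset] by (intro compact_continuous_image)
  qed
  ultimately have "compact B" unfolding B_def by (intro compact_Un)
  then have "open (- B)" by (simp add: compact_imp_closed open_Compl)
  then have W: "openin (top_of_set (surface G)) (surface G \<inter> - B)" by (rule openin_open_Int)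
  have pS: "p \<in> surface G" using p edge(3)[OF e] by blast
  have pB: "p \<notin> B"
  proof
    assume "p \<in> B"
    then consider "p \<in> verts G" | e' where "e' \<in> edges G" "e' \<noteq> e" "p \<in> curve G e'"
      | f z where "f \<in> faces G" "z \<in> cball 0 1" "z \<notin> N f" "param G f z = p"
      unfolding B_def by blast
    then show False
    proof cases
      case 1
      then show ?thesis using p edge(4)[OF e] by blast
    next
      case (2 e')
      then show ?thesis using curve_unique[OF e 2(1) p] by blast
    next
      case (3 f z)
      then show ?thesis using N by blast
    qed
  qed
  show thesis
  proof (rule that[OF W])
    show "p \<in> surface G \<inter> - B" using pS pB by simp
  next
    fix f z assume "f \<in> faces G" "z \<in> cball 0 1" "param G f z \<in> surface G \<inter> - B"
    then show "z \<in> N f" unfolding B_def by blast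
  next
    fix x assume x: "x \<in> surface G \<inter> - B"
    show "x \<in> curve G e - e \<or> (\<exists>f\<in>faces G. x \<in> f)"
    proof (cases "x \<in> (\<Union>e\<in>edges G. curve G e)")
      case True
      then have "x \<in> curve G e" using x unfolding B_def by blast
      moreover have "x \<notin> e" using x edge(1)[OF e] unfolding B_def by blast
      ultimately show ?thesis by blast
    next
      case False
      then have "x \<in> surface G - (verts G \<union> (\<Union>e\<in>edges G. curve G e))" using x unfolding B_def by blast
      then have "x \<in> \<Union>(faces G)" unfolding faces_def by simp
      then show ?thesis by blast
    qed
  qed
qed


text \<open>Otherwise the midpoint of the arc would have a neighbourhood inside the arc. An arc is the image of a
  segment of the real line, in particular of a compact part of a half plane.\<close>

lemma ex_side:
  assumes e: "e \<in> edges G"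
  shows "\<exists>s\<in>sides G. side_edge G s = e"
proof (rule ccontr)
  assume none: "\<not> ?thesis"
  obtain g where g: "arc g" "path_image g = curve G e" "{pathstart g, pathfinish g} = e" using edge(5)[OF e] by blast
  define F where "F w = g (Re w)" for w
  define K where "K = complex_of_real ` {0..1}"
  have gp: "continuous_on {0..1} g" "inj_on g {0..1}" using g(1) by (simp_all add: arc_def path_def)
  have "continuous_on K F"
    unfolding F_def by (rule continuous_on_compose2[OF gp(1)]) (auto simp: K_def intro!: continuous_intros)
  moreover have "inj_on F K"
  proof (rule inj_onI)
    fix w w' assume "w \<in> K" "w' \<in> K" and eq: "F w = F w'"
    then obtain t t' where t: "w = of_real t" "w' = of_real t'" "t \<in> {0..1}" "t' \<in> {0..1}"
      unfolding K_def by blast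
    then have "g t = g t'" using eq by (simp add: F_def)
    then show "w = w'" using inj_onD[OF gp(2) _ t(3,4)] t(1,2) by simp
  qed
  ultimately have F: "continuous_on K F" "inj_on F K" by simp_all
  have "F ` K = g ` {0..1}" unfolding K_def image_image F_def by simp
  then have FK: "F ` K = curve G e" using g(2) by (simp add: path_image_def)
  define p where "p = g (1/2)"
  have p: "p \<in> curve G e - e"
  proof -
    have "p \<in> curve G e" unfolding p_def g(2)[symmetric] path_image_def by (intro imageI) simp
    moreover have "g (1/2) \<noteq> g 0" "g (1/2) \<noteq> g 1"
      using inj_on_eq_iff[OF gp(2), of "1/2" 0] inj_on_eq_iff[OF gp(2), of "1/2" 1] by simp_all
    then have "p \<notin> e" unfolding g(3)[symmetric] p_def pathstart_def pathfinish_def by simp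
    ultimately show ?thesis by simp
  qed
  have no: "z \<in> {}" if "f \<in> faces G" "z \<in> cball 0 1" and zp: "param G f z = p" for f z
  proof -
    have "param G f z \<in> curve G e - e" using p zp by simp
    from param_on_curve[OF that(1,2) e this] show ?thesis using none by blast
  qed
  obtain W where W: "openin (top_of_set (surface G)) W" "p \<in> W"
    "\<And>f z. f \<in> faces G \<Longrightarrow> z \<in> cball 0 1 \<Longrightarrow> param G f z \<in> W \<Longrightarrow> z \<in> {}"
    "\<And>x. x \<in> W \<Longrightarrow> x \<in> curve G e - e \<or> (\<exists>f\<in>faces G. x \<in> f)"
  proof (rule neighbourhood_of_edge_point[OF e p, of "\<lambda>_. {}"])
    show "z \<in> {}" if "f \<in> faces G" "z \<in> cball 0 1" "param G f z = p" for f z using that by (rule no)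
  qed (simp, rule that)
  have "W \<subseteq> F ` K"
  proof
    fix x assume x: "x \<in> W"
    have "x \<notin> f" if f: "f \<in> faces G" for f
    proof
      assume "x \<in> f"
      then obtain z where "z \<in> ball 0 1" "x = param G f z" using param(3)[OF f] by blast
      then show False using W(3)[OF f, of z] x by auto
    qed
    then show "x \<in> F ` K" unfolding FK using W(4)[OF x] by blast
  qed
  moreover have "compact K" unfolding K_def by (intro compact_continuous_image continuous_intros compact_Icc)
  moreover have "of_real (1/2) \<in> K" unfolding K_def by (intro imageI) simp
  moreover have "F (of_real (1/2)) \<in> W" using W(2) by (simp add: F_def p_def)
  moreover have "K \<subseteq> {w. Im w \<le> 0}" by (auto simp: K_def)
  ultimately show False
    using half_plane_image_not_neighbourhood[OF surface, of K F "of_real (1/2)" W] F W(1) by simp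
qed

text \<open>Otherwise the midpoint of the side would have a neighbourhood that is the image of half a disk.\<close>

lemma ex_second_side:
  assumes s: "s \<in> sides G"
  shows "\<exists>s'\<in>sides G. s' \<noteq> s \<and> side_edge G s' = side_edge G s"
proof (rule ccontr)
  assume "\<not> ?thesis"
  then have only: "s' = s" if "s' \<in> sides G" "side_edge G s' = side_edge G s" for s' using that by blast
  have f: "fst s \<in> faces G" and k: "snd s < 4" using s by (auto simp: sides_def)
  define c where "c w = clockwise (w + of_nat (snd s))" for w
  define D where "D = ball (1/2 :: complex) (1/4)"
  define K where "K = cball (1/2 :: complex) (1/4) \<inter> {w. Im w \<le> 0}"
  define e where "e = side_edge G s"
  define p where "p = side_map s (of_real (1/2))"
  have sm: "side_map s w = param G (fst s) (c w)" for w by (simp add: side_map_def c_def)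
  have e: "e \<in> edges G" unfolding e_def by (rule side_edge_homeomorphism(1)[OF s])
  have half: "(1/2 :: real) \<in> {0<..<1}" by simp
  have p: "p \<in> curve G e - e" unfolding e_def side_map_boundary[OF s, symmetric] p_def using half by (rule imageI)
  have re: "0 < Re w" "Re w < 1" if "w \<in> cball (1/2) (1/4)" for w
    using abs_Re_le_cmod[of "1/2 - w"] that by (auto simp: dist_norm)
  have DK: "D \<subseteq> cball (1/2) (1/4)" unfolding D_def by (rule ball_subset_cball)
  have KS: "K \<subseteq> closed_strip" using re by (auto simp: K_def closed_strip_def)
  have c_inj: "w = w'" if "c w = c w'" "0 < Re w" "Re w < 1" "0 < Re w'" "Re w' < 1" for w w'
    using clockwise_eqD(2)[OF that(1)[unfolded c_def] k k that(2-5)] .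
  have "open (c ` D)"
  proof (rule invariance_of_domain)
    show "continuous_on D c" unfolding c_def by (intro continuous_intros)
    show "inj_on c D" using c_inj re DK by (intro inj_onI) blast
  qed (simp add: D_def)
  \<comment> \<open>only the given side is adjacent to the edge\<close>
  define V where "V f = (if f = fst s then c ` D else {})" for f
  have O: "open (V f)" for f unfolding V_def using \<open>open (c ` D)\<close> by simp
  have N: "z \<in> V f"
    if f': "f \<in> faces G" "z \<in> cball 0 1" and zp: "param G f z = p" for f z
  proof -
    obtain k' t where t: "(f, k') \<in> sides G" "side_edge G (f, k') = e" "t \<in> {0<..<1}"
        "z = clockwise (of_real t + of_nat k')"
      using param_on_curve[OF f' e] zp p by metis
    then have fk: "(f, k') = s" using only by (simp add: e_def)
    then have z: "z = c (of_real t)" using t(4) by (auto simp: c_def)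
    have "side_map s (of_real t) = side_map s (of_real (1/2))" using zp fk by (auto simp: sm z p_def)
    then have half_t: "t = 1/2" using inj_onD[OF side_map_boundary_inj[OF s], of t "1/2"] t(3) by simp
    have "complex_of_real t = 1/2" unfolding half_t by simp
    then have "complex_of_real t \<in> D" by (simp only: D_def centre_in_ball)
    then have "z \<in> c ` D" unfolding z by (rule imageI)
    moreover have "f = fst s" using fk by (simp add: fk[symmetric])
    ultimately show ?thesis unfolding V_def by simp
  qed
  obtain W where W: "openin (top_of_set (surface G)) W" "p \<in> W"
    "\<And>f z. f \<in> faces G \<Longrightarrow> z \<in> cball 0 1 \<Longrightarrow> param G f z \<in> W \<Longrightarrow> z \<in> V f"
    "\<And>x. x \<in> W \<Longrightarrow> x \<in> curve G e - e \<or> (\<exists>f\<in>faces G. x \<in> f)"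
  proof (rule neighbourhood_of_edge_point[OF e p, of V])
    show "open (V f)" for f by (rule O)
    show "z \<in> V f" if "f \<in> faces G" "z \<in> cball 0 1" "param G f z = p" for f z using that by (rule N)
  qed (rule that)
  have "W \<subseteq> side_map s ` K"
  proof
    fix x assume x: "x \<in> W"
    from W(4)[OF this] show "x \<in> side_map s ` K"
    proof
      assume "x \<in> curve G e - e"
      then obtain t where t: "t \<in> {0<..<1}" "x = side_map s (of_real t)"
        unfolding e_def side_map_boundary[OF s, symmetric] by blast
      have "c (of_real t) \<in> cball 0 1" unfolding c_def by (rule clockwise_cball) simp
      moreover have "param G (fst s) (c (of_real t)) \<in> W" using x unfolding t(2) sm .
      ultimately have "c (of_real t) \<in> V (fst s)" by (rule W(3)[OF f])
      then have "c (of_real t) \<in> c ` D" by (simp only: V_def simp_thms if_True)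
      then obtain w where w: "w \<in> D" "c (of_real t) = c w" by blast
      have "w \<in> cball (1/2) (1/4)" using w(1) DK by (rule rev_subsetD)
      then have "of_real t = w" using re[of w] t(1) by (intro c_inj[OF w(2)]) simp_all
      then have "of_real t \<in> K" using w(1) DK by (auto simp: K_def)
      then show ?thesis using t(2) by blast
    next
      assume "\<exists>f\<in>faces G. x \<in> f"
      then obtain f' where f': "f' \<in> faces G" "x \<in> f'" by blast
      then obtain z where z: "z \<in> ball 0 1" "x = param G f' z" using param(3)[OF f'(1)] by blast
      have "z \<in> cball 0 1" using z(1) by simp
      moreover have "param G f' z \<in> W" using x unfolding z(2) .
      ultimately have "z \<in> V f'" by (rule W(3)[OF f'(1)])
      then have "f' = fst s" "z \<in> c ` D" unfolding V_def by (simp_all split: if_splits)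
      then obtain w where w: "w \<in> D" "z = c w" by blast
      have "exp (pi / 2 * Im w) < 1" using z(1) by (simp add: w c_def norm_clockwise)
      then have "Im w \<le> 0" by (simp add: mult_less_0_iff)
      then have "w \<in> K" using w(1) DK by (auto simp: K_def)
      moreover have "x = side_map s w" unfolding sm using z(2) w(2) \<open>f' = fst s\<close> by simp
      ultimately show ?thesis by (rule rev_image_eqI)
    qed
  qed
  moreover have "compact K" unfolding K_def
    by (intro compact_Int_closed compact_cball closed_halfspace_Im_le)
  moreover have "continuous_on K (side_map s)"
    by (rule continuous_on_subset[OF continuous_on_side_map[OF s]]) (auto simp: K_def)
  moreover have "inj_on (side_map s) K" by (rule inj_on_subset[OF inj_on_side_map[OF s] KS])
  moreover have "of_real (1/2) \<in> K" by (simp add: K_def)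
  moreover have "K \<subseteq> {w. Im w \<le> 0}" by (auto simp: K_def)
  ultimately show False
    using half_plane_image_not_neighbourhood[OF surface, of K "side_map s" "of_real (1/2)" W] W(1,2)
    unfolding p_def by simp
qed

text \<open>If the parities agreed, \<open>\<tau>\<close> would be increasing. Below the real line the glued map is then a
  parametrisation of the first face, which preserves the orientation. Above, it is a map that
  preserves the orientation, preceded by complex conjugation. So the winding numbers around the
  images of a point and of its conjugate would be \<open>1\<close> and \<open>-1\<close>, although one circle can be moved
  into the other.\<close>

lemma opposite_parity:
  assumes s: "s \<in> sides G" "s' \<in> sides G" and e: "side_edge G s' = side_edge G s" and ne: "s \<noteq> s'"
  shows "even (snd s) \<noteq> even (snd s')"
proof
  assume par: "even (snd s) = even (snd s')"
  obtain \<tau> where \<tau>: "continuous_on {0<..<1} \<tau>" "inj_on \<tau> {0<..<1}" "\<And>t. t \<in> {0<..<1} \<Longrightarrow> \<tau> t \<in> {0<..<1}"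
    "\<And>t. t \<in> {0<..<1} \<Longrightarrow> side_map s' (of_real (\<tau> t)) = side_map s (of_real t)"
    and mono': "even (snd s) = even (snd s') \<Longrightarrow> strict_mono_on {0<..<1} \<tau>"
    by (rule transition[OF s e]) (rule that)
  note mono = mono'[OF par]
  let ?\<Phi> = "glued s s' \<tau>"
  note gl = glued[OF s ne \<tau>]
  have half: "of_real (1/2) \<in> vertical_strip" by (simp add: vertical_strip_def)
  obtain U h where U: "(U, h) \<in> atlas G" "?\<Phi> (of_real (1/2)) \<in> U"
    by (rule obtain_chart[OF surface subsetD[OF gl(3) imageI[OF half]]])
  note ch = chart[OF surface U(1)]
  define X where "X = {w \<in> vertical_strip. ?\<Phi> w \<in> U}"
  have X: "open X"
    unfolding X_def by (rule openin_continuous_preimage[OF open_vertical_strip gl(1,3) ch(1)])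
  have "of_real (1/2) \<in> X" using half U(2) by (simp only: X_def mem_Collect_eq)
  then obtain R where R: "0 < R" "ball (of_real (1/2)) R \<subseteq> X" by (rule openE[OF X])
  define B where "B = ball (of_real (1/2) :: complex) R"
  have "B \<subseteq> X" using R(2) by (simp only: B_def)
  then have B: "w \<in> vertical_strip" "?\<Phi> w \<in> U" if "w \<in> B" for w using that by (auto simp: X_def)
  define H where "H = h \<circ> ?\<Phi>"
  have BV: "B \<subseteq> vertical_strip" by (rule subsetI) (rule B(1))
  have BU: "?\<Phi> ` B \<subseteq> U" by (rule image_subsetI) (rule B(2))
  have H: "continuous_on B H"
    unfolding H_def
    by (rule continuous_on_compose[OF continuous_on_subset[OF gl(1) BV] continuous_on_subset[OF ch(4) BU]])
  have H': "inj_on H B"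
    unfolding H_def by (rule comp_inj_on[OF inj_on_subset[OF gl(2) BV] inj_on_subset[OF ch(5) BU]])
  have convex_B: "convex B" by (simp add: B_def)
  define z where "z = Complex (1/2) (- (R/2))"
  define \<epsilon> where "\<epsilon> = R/4"
  have \<epsilon>: "0 < \<epsilon>" using R(1) by (simp add: \<epsilon>_def)
  have lower: "w \<in> B" "Im w < 0" if "w \<in> cball z \<epsilon>" for w
  proof -
    have "dist (of_real (1/2)) z = R / 2" using R(1) by (simp add: z_def dist_norm Complex_eq norm_mult)
    then have "dist (of_real (1/2)) w \<le> R/2 + \<epsilon>" using dist_triangle[of "of_real (1/2)" w z] that by auto
    then show "w \<in> B" using R(1) by (simp add: B_def \<epsilon>_def)
    have "cmod (z - w) \<le> \<epsilon>" using that by (simp only: mem_cball dist_norm)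
    then have "\<bar>Im z - Im w\<bar> \<le> \<epsilon>" using abs_Im_le_cmod[of "z - w"] by simp
    then have "Im w - Im z \<le> \<epsilon>" by linarith
    moreover have "Im z = - (R / 2)" by (simp only: z_def complex.sel)
    ultimately show "Im w < 0" using R(1) unfolding \<epsilon>_def by linarith
  qed
  have upper: "cnj w \<in> B" if "w \<in> cball z \<epsilon>" for w
  proof -
    have "dist (of_real (1/2)) (cnj w) = dist (of_real (1/2)) w"
    proof -
      have "of_real (1/2) - cnj w = cnj (of_real (1/2) - w)" by simp
      then show ?thesis unfolding dist_norm by (simp only: complex_mod_cnj)
    qed
    then show ?thesis using lower(1)[OF that] by (simp add: B_def)
  qed
  have in_lower: "circlepath z \<epsilon> t \<in> cball z \<epsilon>" for t
    using \<epsilon> by (simp add: circlepath dist_norm norm_mult)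
  have zc: "z \<in> cball z \<epsilon>" using \<epsilon> by simp
  have "cball z \<epsilon> \<subseteq> B" by (rule subsetI) (rule lower(1))
  moreover have "cball (cnj z) \<epsilon> \<subseteq> B"
  proof
    fix w assume "w \<in> cball (cnj z) \<epsilon>"
    moreover have "z - cnj w = cnj (cnj z - w)" by simp
    then have "cmod (z - cnj w) = cmod (cnj z - w)" by (simp only: complex_mod_cnj)
    ultimately have "cnj w \<in> cball z \<epsilon>" by (simp add: dist_norm)
    from upper[OF this] show "w \<in> B" by simp
  qed
  ultimately have same: "winding_number (H \<circ> circlepath z \<epsilon>) (H z) = winding_number (H \<circ> circlepath (cnj z) \<epsilon>) (H (cnj z))"
    by (rule winding_number_moved_circle[OF H H' convex_B \<epsilon>])
  have "winding_number (H \<circ> circlepath z \<epsilon>) (H z) = 1"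
  proof -
    have \<Phi>: "?\<Phi> w = side_map s w" if "w \<in> cball z \<epsilon>" for w
      using lower(2)[OF that] by (simp add: glued_def)
    have Hl: "H w = (h \<circ> side_map s) w" if "w \<in> cball z \<epsilon>" for w
      unfolding H_def comp_apply \<Phi>[OF that] ..
    have "cball z \<epsilon> \<subseteq> {w \<in> open_strip. side_map s w \<in> U}"
    proof
      fix w assume w: "w \<in> cball z \<epsilon>"
      have "w \<in> open_strip"
        using B(1)[OF lower(1)[OF w]] lower(2)[OF w] by (simp add: vertical_strip_def open_strip_def)
      moreover have "side_map s w \<in> U" using B(2)[OF lower(1)[OF w]] unfolding \<Phi>[OF w] .
      ultimately show "w \<in> {w \<in> open_strip. side_map s w \<in> U}" by simp
    qed
    then have "winding_number (h \<circ> side_map s \<circ> circlepath z \<epsilon>) ((h \<circ> side_map s) z) = 1"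
      by (rule orientation_preserving_onD(3)[OF side_map_orientation[OF s(1) U(1)] _ \<epsilon>])
    moreover have "H \<circ> circlepath z \<epsilon> = h \<circ> side_map s \<circ> circlepath z \<epsilon>"
      by (rule ext) (use Hl[OF in_lower] in \<open>simp only: comp_apply\<close>)
    ultimately show ?thesis using Hl[OF zc] by simp
  qed
  moreover have "winding_number (H \<circ> circlepath (cnj z) \<epsilon>) (H (cnj z)) = - 1"
  proof -
    \<comment> \<open>on the upper half the glued map is \<open>side_map s' \<circ> r \<circ> cnj\<close>\<close>
    define r where "r w = Complex (\<tau> (Re w)) (Im w)" for w
    define g where "g = h \<circ> side_map s' \<circ> r"
    have Hu: "H (cnj w) = g w" and Xw: "w \<in> {w \<in> open_strip. side_map s' (r w) \<in> U}"
      if w: "w \<in> cball z \<epsilon>" for w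
    proof -
      have \<Phi>: "?\<Phi> (cnj w) = side_map s' (r w)" using lower(2)[OF w] by (simp add: glued_def r_def)
      then show "H (cnj w) = g w" by (simp add: H_def g_def)
      have "w \<in> open_strip"
        using B(1)[OF upper[OF w]] lower(2)[OF w] by (simp add: vertical_strip_def open_strip_def)
      moreover have "side_map s' (r w) \<in> U" using B(2)[OF upper[OF w]] unfolding \<Phi> .
      ultimately show "w \<in> {w \<in> open_strip. side_map s' (r w) \<in> U}" by simp
    qed
    define Y where "Y = {w \<in> open_strip. side_map s' (r w) \<in> U}"
    define V where "V = {w \<in> open_strip. side_map s' w \<in> U}"
    have r_strip: "r w \<in> open_strip" if "w \<in> open_strip" for w
      using that \<tau>(3)[of "Re w"] by (simp add: r_def open_strip_def)
    have "orientation_preserving_on {w. 0 < Re w \<and> Re w < 1} r"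
      unfolding r_def by (rule orientation_preserving_on_reparametrised_real_part[OF \<tau>(1) mono])
    moreover have "Y \<subseteq> {w. 0 < Re w \<and> Re w < 1}" unfolding Y_def open_strip_def by blast
    ultimately have op_r: "orientation_preserving_on Y r" by (rule orientation_preserving_on_subset)
    have op_V: "orientation_preserving_on V (h \<circ> side_map s')"
      unfolding V_def by (rule side_map_orientation[OF s(2) U(1)])
    have cont: "continuous_on open_strip (side_map s')"
      by (rule continuous_on_subset[OF continuous_on_side_map[OF s(2)]]) (auto simp: open_strip_def)
    have img: "side_map s' ` open_strip \<subseteq> surface G"
    proof (rule image_subsetI)
      fix w assume "w \<in> open_strip"
      then show "side_map s' w \<in> surface G"
        by (intro side_map_surface[OF s(2)] subsetD[OF open_strip_subset])
    qed
    have "open V" unfolding V_def by (rule openin_continuous_preimage[OF open_open_strip cont img ch(1)])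
    moreover have "r ` Y \<subseteq> V"
    proof (rule image_subsetI)
      fix w assume "w \<in> Y"
      then show "r w \<in> V" using r_strip[of w] by (simp add: Y_def V_def)
    qed
    ultimately have op: "orientation_preserving_on Y g"
      unfolding g_def by (rule orientation_preserving_on_compose[OF op_r op_V])
    have sub: "cball z \<epsilon> \<subseteq> Y" unfolding Y_def by (rule subsetI) (rule Xw)
    have w1: "winding_number (g \<circ> circlepath z \<epsilon>) (g z) = 1"
      by (rule orientation_preserving_onD(3)[OF op sub \<epsilon>])
    have gc: "continuous_on (cball z \<epsilon>) g" "inj_on g (cball z \<epsilon>)"
      by (rule orientation_preserving_onD[OF op sub \<epsilon>])+
    have circ: "circlepath (cnj z) \<epsilon> t = cnj (circlepath z \<epsilon> (1 - t))" for t
      using fun_cong[OF circlepath_cnj[of z \<epsilon>], of "1 - t"] by (simp add: reversepath_def)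
    have "H \<circ> circlepath (cnj z) \<epsilon> = reversepath (g \<circ> circlepath z \<epsilon>)"
    proof (rule ext)
      fix t
      show "(H \<circ> circlepath (cnj z) \<epsilon>) t = reversepath (g \<circ> circlepath z \<epsilon>) t"
        unfolding comp_apply reversepath_def circ by (rule Hu[OF in_lower])
    qed
    moreover have "winding_number (reversepath (g \<circ> circlepath z \<epsilon>)) (g z) = - winding_number (g \<circ> circlepath z \<epsilon>) (g z)"
    proof (rule winding_number_reversepath)
      show "path (g \<circ> circlepath z \<epsilon>)" using gc(1) \<epsilon> by (rule path_circlepath_compose)
      show "g z \<notin> path_image (g \<circ> circlepath z \<epsilon>)"
      proof
        assume "g z \<in> path_image (g \<circ> circlepath z \<epsilon>)"
        then have "g z \<in> g ` sphere z \<epsilon>" using \<epsilon> by (simp add: path_image_compose)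
        then obtain w where w: "w \<in> sphere z \<epsilon>" "g z = g w" by blast
        have "w \<in> cball z \<epsilon>" using w(1) by simp
        with gc(2) w(2) zc have "z = w" by (rule inj_onD)
        then have "z \<in> sphere z \<epsilon>" using w(1) by simp
        then show False using \<epsilon> by simp
      qed
    qed
    ultimately show ?thesis using w1 Hu[OF zc] by simp
  qed
  ultimately show False using same by simp
qed

lemma glued_sides: "glued_sides G"
proof (rule glued_sides.intro)
  show "finite (faces G)" by (rule finite_faces)
  show "finite (edges G)" by (rule finite_edges)
  show "side_edge G s \<in> edges G" if "s \<in> sides G" for s using that by (rule side_edge_homeomorphism(1))
  show "\<exists>s s'. {t \<in> sides G. side_edge G t = e} = {s, s'} \<and> even (snd s) \<noteq> even (snd s')" if e: "e \<in> edges G" for e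
  proof -
    obtain s where s: "s \<in> sides G" "side_edge G s = e" using ex_side[OF e] by blast
    obtain s' where s': "s' \<in> sides G" "s' \<noteq> s" "side_edge G s' = side_edge G s" using ex_second_side[OF s(1)] by blast
    have "t \<in> {t \<in> sides G. side_edge G t = e} \<longleftrightarrow> t \<in> {s, s'}" for t
    proof
      assume "t \<in> {t \<in> sides G. side_edge G t = e}"
      then have "t \<in> sides G" "side_edge G t = side_edge G s" using s(2) by simp_all
      then show "t \<in> {s, s'}" using at_most_two_sides[OF s(1) s'(1) _ s'(3) _ s'(2)[symmetric], of t] by simp
    qed (use s s' in auto)
    then have "{t \<in> sides G. side_edge G t = e} = {s, s'}" by (rule set_eqI)
    moreover have "even (snd s) \<noteq> even (snd s')" by (rule opposite_parity[OF s(1) s'(1,3) s'(2)[symmetric]])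
    ultimately show ?thesis by blast
  qed
qed

end

section \<open>The partition functions of a quadrangulation\<close>

theorem theorem1:
  fixes G :: "('s::t2_space) surface_graph"
    and w :: "'s set \<Rightarrow> nat \<Rightarrow> real"
  assumes "bipartite_quadrangulation G"
    and "\<And>f i. f \<in> faces G \<Longrightarrow> i \<in> {1..5} \<Longrightarrow> 0 < w f i"
    and "\<And>f. f \<in> faces G \<Longrightarrow> free_fermionic (w f)"
  shows "(\<forall>f\<in>faces G. \<exists>!p. ff_parameters (w f) p) \<and>
    (\<forall>lam a b. (\<forall>f\<in>faces G. ff_parameters (w f) (lam f, a f, b f)) \<longrightarrow>
       Z_loop G w = (\<Prod>f\<in>faces G. lam f) * (Z_dim G (dec_weight a b))\<^sup>2)"
proof (intro conjI ballI allI impI)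
  fix f assume f: "f \<in> faces G"
  show "\<exists>!p. ff_parameters (w f) p"
    by (rule ex1_ff_parameters) (rule assms(2)[OF f], assumption, rule assms(3)[OF f])
next
  fix lam a b assume p: "\<forall>f\<in>faces G. ff_parameters (w f) (lam f, a f, b f)"
  interpret quadrangulation G using assms(1) by (rule quadrangulation.intro)
  show "Z_loop G w = (\<Prod>f\<in>faces G. lam f) * (Z_dim G (dec_weight a b))\<^sup>2"
    by (rule glued_sides.Z_loop_eq_Z_dim_squared[OF glued_sides p])
qed

end
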